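(* Suppose that: (1) for every $i\in\mathcal{N}$ the digraph $\mathcal{G}_i$ is strongly connected and its adjacency matrix $A^i$ is column stochastic ($\mathbf{1}_{n_i}^\top A^i=\mathbf{1}_{n_i}^\top$); (2) the digraph $\bar{\mathcal{G}}$ is strongly connected and its adjacency matrix $\bar{A}$ is row stochastic ($\bar A\mathbf{1}_n=\mathbf{1}_n$); (3) for each $j\in\mathcal{V}^i$, $i\in\mathcal{N}$, the local cost $J^i_j(\mathbf{x}^i,\mathbf{x}^{-i})$ is convex and continuously differentiable in $\mathbf{x}^i$, and for every $k\in\mathcal{V}^i$ the partial gradient $\nabla^i_kJ^i_j$ is $\mathcal{L}$-Lipschitz in $\mathbf{x}$, i.e. $\|\nabla^i_kJ^i_j(\mathbf{x})-\nabla^i_kJ^i_j(\mathbf{x}')\|_2\le\mathcal{L}\|\mathbf{x}-\mathbf{x}'\|_2$ for all $\mathbf{x},\mathbf{x}'\in\mathbb{R}^n$; (4) the game mapping $\boldsymbol{F}$ is strongly monotone with constant $\chi>0$, i.e. $\langle\boldsymbol{F}(\mathbf{x})-\boldsymbol{F}(\mathbf{x}'),\mathbf{x}-\mathbf{x}'\rangle\ge\chi\|\mathbf{x}-\mathbf{x}'\|_2^2$ for all $\mathbf{x},\mathbf{x}'\in\mathbb{R}^n$. Let the parameters $\delta_p>0$ satisfy $0\le\delta_p\bar a_{pq}<2\bar a_{pp}$ for all $p,q\in\bar{\mathcal{V}}$. Let the actions $\{x^i_{j,t}\}_{t\ge0}$, gradient trackers $\{g^i_{jk,t}\}_{t\ge0}$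 and estimates $\{y^p_{q,t}\}_{t\ge0}$ be generated by the distributed algorithm given in the context, with uncoordinated constant step-sizes $\gamma^i_j>0$ satisfying $$0\le\epsilon_\gamma<\frac{k_1}{k_3},\qquad 0<\gamma_M<\min\Big\{\frac1{k_1},\gamma_1^*,\gamma_2^*,\gamma_3^*\Big\},$$ where $k_1,k_3,\gamma_1^*,\gamma_2^*,\gamma_3^*$ are the constants defined in the context ($\gamma^*_1,\gamma_2^*,\gamma_3^*$ depend on $\epsilon_\gamma$). Let $\mathbf{x}^*$ be the (unique) NE of the game. Then $\rho(\mathbf{T})<1$ for the $3\times3$ matrix $\mathbf{T}$ defined in the context, and each of $$\sup_{\ell\ge t}\|\mathbf{x}_\ell-\mathbf{x}^*\|_{\boldsymbol{\pi}}^2,\qquad \sup_{\ell\ge t}\sum_{i=1}^N\sum_{k=1}^{n_i}\|\mathbf{g}^i_{k,\ell}-A^i_\infty\mathbf{g}^i_{k,\ell}\|_{\boldsymbol{\pi}^i}^2,\qquad \sup_{\ell\ge t}\sum_{q=1}^n\|\mathbf{1}_n\mathsf{y}_{q,\ell}-\mathbf{y}_{q,\ell}\|_e^2$$ converges linearly to $0$ (as $t\to\infty$) at a rate of $\rho(\mathbf{T})$.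
   Context: **Game.** There are $N$ clusters indexed by $i\in\mathcal{N}=\{1,\dots,N\}$; cluster $i$ has agents $\mathcal{V}^i=\{1,\dots,n_i\}$; $n=\sum_{i=1}^Nn_i$, $n_0=0$. Agent $j$ of cluster $i$ has decision $x^i_j\in\mathbb{R}$; $\mathbf{x}^i=[x^i_1,\dots,x^i_{n_i}]^\top$, $\mathbf{x}=[\mathbf{x}^{1\top},\dots,\mathbf{x}^{N\top}]^\top\in\mathbb{R}^n$, and $\mathbf{x}^{-i}\in\mathbb{R}^{n-n_i}$ collects all decisions except those of cluster $i$. Agent $j$ of cluster $i$ has local cost $J^i_j:\mathbb{R}^n\to\mathbb{R}$, and the cost of cluster $i$ is $J^i(\mathbf{x})=\frac1{n_i}\sum_{j=1}^{n_i}J^i_j(\mathbf{x}^i,\mathbf{x}^{-i})$. $\nabla^i_k$ denotes the partial derivative with respect to $x^i_k$. The game mapping is $\boldsymbol{F}(\mathbf{x})=[\nabla_{\mathbf{x}^1}J^1(\mathbf{x})^\top,\dots,\nabla_{\mathbf{x}^N}J^N(\mathbf{x})^\top]^\top$. A vector $\mathbf{x}^*$ is a Nash equilibrium (NE) if $J^i(\mathbf{x}^{i*},\mathbf{x}^{-i*})\le J^i(\mathbf{x}^i,\mathbf{x}^{-i*})$ for all $\mathbf{x}^i\in\mathbb{R}^{n_i}$ and all $i\in\mathcal{N}$. (Under hypotheses (3) and (4) there is a unique NE $\mathbf{x}^*$, and $\boldsymbol F(\mathbf{x}^* )=\mathbf{0}$.) **Networks.** For each $i$, $\mathcal{G}_i=(\mathcal{V}^i,\mathcal{E}^i)$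 is a digraph with nonnegative adjacency matrix $A^i=[a^i_{jk}]\in\mathbb{R}^{n_i\times n_i}$, $a^i_{jk}>0$ if $(k,j)\in\mathcal{E}^i$ and $a^i_{jk}=0$ otherwise; $(k,k)\in\mathcal{E}^i$ for all $k$. $\bar{\mathcal{G}}=(\bar{\mathcal{V}},\bar{\mathcal{E}})$, $\bar{\mathcal{V}}=\{1,\dots,n\}$, is a digraph with nonnegative adjacency matrix $\bar A=[\bar a_{pq}]\in\mathbb{R}^{n\times n}$, $\bar a_{pq}>0$ if $(q,p)\in\bar{\mathcal{E}}$ and $0$ otherwise; $(p,p)\in\bar{\mathcal{E}}$ for all $p$. Agent $j$ of cluster $i$ is identified with agent $\sum_{l=0}^{i-1}n_l+j$ of $\bar{\mathcal{V}}$; its action is also written $\mathsf{y}_{\sum_{l=0}^{i-1}n_l+j}=x^i_j$. **Perron vectors and weighted norms.** When $\mathcal{G}_i$ is strongly connected and $A^i$ is column stochastic, $\pi^i=[\pi^i_1,\dots,\pi^i_{n_i}]^\top$ is the positive vector with $A^i\pi^i=\pi^i$, $\mathbf{1}_{n_i}^\top\pi^i=1$, and $A^i_\infty=\lim_{k\to\infty}(A^i)^k=\pi^i\mathbf{1}_{n_i}^\top$. Put $\iota=\max_i\|\pi^i\|_2$, $\boldsymbol{\pi}^i=n_i\pi^i$, $\boldsymbol{\pi}=[\boldsymbol{\pi}^{1\top},\dots,\boldsymbol{\pi}^{N\top}]^\top$; $\underline{\boldsymbol{\pi}}$ and $\overline{\boldsymbol{\pi}}$ are the smallest and largest entries of $\boldsymbol{\pi}$.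 For a positive vector $\pi$: $\|u\|_\pi=\|\mathrm{diag}(\sqrt\pi)^{-1}u\|_2$ for vectors $u$, and $\|A\|_\pi=\|\mathrm{diag}(\sqrt\pi)^{-1}A\,\mathrm{diag}(\sqrt\pi)\|_2$ (spectral norm) for matrices $A$. **Algorithm.** Agent $p\in\bar{\mathcal{V}}$ keeps an estimate $y^p_q\in\mathbb{R}$ of $\mathsf{y}_q$ for each $q\in\bar{\mathcal{V}}$; $\mathbf{y}^p=[y^p_1,\dots,y^p_n]^\top$. Agent $j$ of cluster $i$ keeps gradient trackers $g^i_{jk}\in\mathbb{R}$, $k\in\mathcal{V}^i$. For $t\ge0$, $$y^p_{q,t+1}=\sum_{l=1}^n\bar a_{pl}y^l_{q,t}+\delta_p\bar a_{pq}(\mathsf{y}_{q,t}-y^p_{q,t}),\quad p,q\in\bar{\mathcal{V}},$$ $$x^i_{j,t+1}=x^i_{j,t}-\gamma^i_jg^i_{jj,t},\quad j\in\mathcal{V}^i,\ i\in\mathcal{N},$$ $$g^i_{jk,t+1}=\sum_{l=1}^{n_i}a^i_{jl}g^i_{lk,t}+\nabla^i_kJ^i_j(\mathbf{y}^{m}_{t+1})-\nabla^i_kJ^i_j(\mathbf{y}^{m}_t),\quad m=\sum_{l=0}^{i-1}n_l+j,\ j,k\in\mathcal{V}^i,\ i\in\mathcal{N},$$ with arbitrary $x^i_{j,0}\in\mathbb{R}$ and $\mathbf{y}^p_0\in\mathbb{R}^n$, and $g^i_{jk,0}=\nabla^i_kJ^i_j(\mathbf{y}^m_0)$. Here $\delta_p$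 and $\gamma^i_j>0$ are constants. Write $\mathbf{g}^i_{k,t}=[g^i_{1k,t},\dots,g^i_{n_ik,t}]^\top$ and $\mathbf{y}_{q,t}=[y^1_{q,t},\dots,y^n_{q,t}]^\top$. **Step-sizes.** $\gamma_M=\max_{i,j}\gamma^i_j$, $\bar\gamma=\frac1n\sum_{i,j}\gamma^i_j$, $\boldsymbol{\gamma}\in\mathbb{R}^n$ is the stacked vector of all $\gamma^i_j$, $\bar{\boldsymbol{\gamma}}=\bar\gamma\mathbf{1}_n$, and the heterogeneity is $\epsilon_\gamma=\|\boldsymbol{\gamma}-\bar{\boldsymbol{\gamma}}\|_2/\|\bar{\boldsymbol{\gamma}}\|_2$. **The norm $\|\cdot\|_e$.** For $q\in\bar{\mathcal{V}}$ let $\tilde A_q=[\tilde a^q_{pm}]$ with $\tilde a^q_{pm}=\bar a_{pm}$ if $p\ne m$ and $\tilde a^q_{pp}=|\bar a_{pp}-\delta_p\bar a_{pq}|$. Under hypothesis (2) and the condition on $\delta_p$ there is a matrix norm $\|\cdot\|_E$ with $\|\tilde A_q\|_E<1$ for all $q$; fix such a norm. $\|\cdot\|_e$ is a vector norm compatible with it ($\|Av\|_e\le\|A\|_E\|v\|_e$), and $\underline C,\overline C>0$ are constants with $\underline C\|v\|_2\le\|v\|_e\le\overline C\|v\|_2$ for all $v$. **Constants.** $\sigma_{A^i}=\|A^i-A^i_\infty\|_{\boldsymbol{\pi}^i}$ (which is $<1$), $\bar\sigma_1=\max_i\sigma_{A^i}$, $\varsigma_1=\max_i\frac{1+\sigma_{A^i}^2}{1-\sigma_{A^i}^2}$;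 $\sigma_{\tilde A_q}=\|\tilde A_q\|_E$, $\bar\sigma_2=\max_q\sigma_{\tilde A_q}$, $\varsigma_2=\max_q\frac{1+\sigma_{\tilde A_q}^2}{1-\sigma_{\tilde A_q}^2}$. With $S=\sum_{i=1}^Nn_i^3$: $k_1=\underline{\boldsymbol{\pi}}\chi$, $k_2=\frac{3\overline{\boldsymbol{\pi}}\iota^2\mathcal{L}^2}{\underline{\boldsymbol{\pi}}}S$, $k_3=2\overline{\boldsymbol{\pi}}\sqrt n\mathcal{L}$, $k_4=\frac{3\overline{\boldsymbol{\pi}}}{\underline{\boldsymbol{\pi}}}$, $k_5=\frac{2}{\underline{\boldsymbol{\pi}}\chi}$, $k_6=\frac{3n^2\iota^2\mathcal{L}^2}{\underline{\boldsymbol{\pi}}\underline C^2}$, $k_7=\frac{2\overline{\boldsymbol{\pi}}n\mathcal{L}^2}{\underline{\boldsymbol{\pi}}\underline C^2\chi}$, $k_8=\frac{9\overline{\boldsymbol{\pi}}n^2\varsigma_1(1+n\varsigma_2\overline C^2)\iota^2\mathcal{L}^4}{\underline{\boldsymbol{\pi}}}S$, $k_9=\frac{9\overline{\boldsymbol{\pi}}n^2\varsigma_1(1+n\varsigma_2\overline C^2)\mathcal{L}^2}{\underline{\boldsymbol{\pi}}}S$, $k_{10}=\frac{1-\bar\sigma_1^2}2$, $k_{11}=\frac{3n\varsigma_1(3+\bar\sigma_2^2)\mathcal{L}^2}{2\underline{\boldsymbol{\pi}}\underline C^2}$, $k_{12}=\frac{9n^4\varsigma_1(1+n\varsigma_2\overline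 C^2)\iota^2\mathcal{L}^4}{\underline{\boldsymbol{\pi}}\underline C^2}$, $k_{13}=3\overline{\boldsymbol{\pi}}n\varsigma_2\overline C^2\iota^2\mathcal{L}^2S$, $k_{14}=3\overline{\boldsymbol{\pi}}n\varsigma_2\overline C^2$, $k_{15}=\frac{3n^3\varsigma_2\overline C^2\iota^2\mathcal{L}^2}{\underline C^2}$, $k_{16}=\frac{1-\bar\sigma_2^2}2$. $$\mathbf{T}=\begin{bmatrix}1-k_1\bar\gamma+k_2\gamma_M^2+k_3\epsilon_\gamma\bar\gamma & k_4\gamma_M^2+k_5\gamma_M^2/\bar\gamma & k_6\gamma_M^2+k_7\gamma_M^2/\bar\gamma\\ k_8\gamma_M^2 & 1-k_{10}+k_9\gamma_M^2 & k_{11}+k_{12}\gamma_M^2\\ k_{13}\gamma_M^2 & k_{14}\gamma_M^2 & 1-k_{16}+k_{15}\gamma_M^2\end{bmatrix}.$$ $\gamma_1^*=\frac{k_7k_{10}(k_1-k_3\epsilon_\gamma)}{q_1^*}$, $\gamma_2^*=\sqrt{\frac{k_{10}k_{11}(k_1-k_3\epsilon_\gamma)}{q_2^*}}$, $\gamma_3^*=\sqrt{\frac{k_{10}k_{16}(k_1-k_3\epsilon_\gamma)}{q_3^*}}$, where $q_1^*=2n^2k_2(k_5k_{11}+k_7k_{10})+(2k_4k_{11}+k_6k_{10})(k_1-k_3\epsilon_\gamma)$, $q_2^*=2n^2k_8(k_5k_{11}+k_7k_{10})+(2k_9k_{11}+k_{10}k_{12})(k_1-k_3\epsilon_\gamma)$,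 $q_3^*=2n^2k_{13}(k_5k_{11}+k_7k_{10})+(2k_{11}k_{14}+k_{10}k_{15})(k_1-k_3\epsilon_\gamma)$. **Convention.** $s_t$ converges linearly to $0$ at a rate of $r<1$ means $s_t\le Cr^t$ for all $t\ge0$ and some constant $C$. $\rho(\cdot)$ is the spectral radius. *)

theory Defs
  imports
    "HOL-Analysis.Analysis"
    "Jordan_Normal_Form.Spectral_Radius"
    "Graph_Theory.Graph_Theory"
begin

no_notation Matrix.vec_index (infixl "$" 100)

text \<open>
  The agents of all clusters together form a finite type \<open>'v\<close>, the clusters form a finite
  type \<open>'c\<close>, and \<open>cl\<close> maps every agent to its cluster. A stacked vector of
  all agents' scalars is an element of \<open>real ^ 'v\<close>; the block belonging to
  cluster \<open>i\<close> consists of its coordinates in \<open>cluster cl i\<close>.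
\<close>

definition cluster :: "('v \<Rightarrow> 'c) \<Rightarrow> 'c \<Rightarrow> 'v set" where
  "cluster cl i = {p. cl p = i}"

definition replace_on :: "'v set \<Rightarrow> real ^ 'v \<Rightarrow> real ^ 'v \<Rightarrow> real ^ 'v" where
  "replace_on I u x = (\<chi> p. if p \<in> I then u $ p else x $ p)"

definition partial_deriv :: "'v \<Rightarrow> (real ^ 'v \<Rightarrow> real) \<Rightarrow> real ^ 'v \<Rightarrow> real" where
  "partial_deriv k f x = deriv (\<lambda>h. f (x + h *\<^sub>R axis k 1)) 0"

definition continuously_differentiable :: "(real ^ 'v \<Rightarrow> real) \<Rightarrow> bool" where
  "continuously_differentiable f \<longleftrightarrow>
     (\<exists>f' :: real ^ 'v \<Rightarrow> ((real ^ 'v) \<Rightarrow>\<^sub>L real).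
        (\<forall>u. (f has_derivative blinfun_apply (f' u)) (at u)) \<and> continuous_on UNIV f')"

text \<open>
  Properties of \<open>f\<close> as a function of the block \<open>I\<close> alone, the other coordinates
  being frozen at those of an arbitrary \<open>x\<close>. The coordinates of \<open>u\<close> outside \<open>I\<close> have no effect.
\<close>

definition convex_in_block :: "'v set \<Rightarrow> (real ^ 'v \<Rightarrow> real) \<Rightarrow> bool" where
  "convex_in_block I f \<longleftrightarrow> (\<forall>x. convex_on UNIV (\<lambda>u. f (replace_on I u x)))"

definition continuously_differentiable_in_block :: "'v set \<Rightarrow> (real ^ 'v \<Rightarrow> real) \<Rightarrow> bool" where
  "continuously_differentiable_in_block I f \<longleftrightarrow>
     (\<forall>x. continuously_differentiable (\<lambda>u. f (replace_on I u x)))"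

definition cluster_cost :: "('v \<Rightarrow> 'c) \<Rightarrow> ('v \<Rightarrow> real ^ 'v \<Rightarrow> real) \<Rightarrow> 'c \<Rightarrow> real ^ 'v \<Rightarrow> real" where
  "cluster_cost cl J i x = (\<Sum>p\<in>cluster cl i. J p x) / real (card (cluster cl i))"

definition game_mapping :: "('v \<Rightarrow> 'c) \<Rightarrow> ('v \<Rightarrow> real ^ 'v \<Rightarrow> real) \<Rightarrow> real ^ 'v \<Rightarrow> real ^ 'v" where
  "game_mapping cl J x = (\<chi> p. partial_deriv p (cluster_cost cl J (cl p)) x)"

definition strongly_monotone :: "real \<Rightarrow> (real ^ 'v \<Rightarrow> real ^ 'v) \<Rightarrow> bool" where
  "strongly_monotone c F \<longleftrightarrow> (\<forall>x x'. (F x - F x') \<bullet> (x - x') \<ge> c * (norm (x - x'))\<^sup>2)"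

definition nash_equilibrium :: "('v \<Rightarrow> 'c) \<Rightarrow> ('v \<Rightarrow> real ^ 'v \<Rightarrow> real) \<Rightarrow> real ^ 'v \<Rightarrow> bool" where
  "nash_equilibrium cl J x \<longleftrightarrow>
     (\<forall>i u. cluster_cost cl J i x \<le> cluster_cost cl J i (replace_on (cluster cl i) u x))"

text \<open>
  The entry in row \<open>p\<close> and column \<open>q\<close> belongs to the arc from \<open>q\<close> to \<open>p\<close>. For a digraph
  whose vertices are only part of \<open>'v\<close>, the adjacency matrix is padded with zeros.
\<close>

definition adjacency_matrix :: "'v pair_pre_digraph \<Rightarrow> real ^ 'v ^ 'v \<Rightarrow> bool" where
  "adjacency_matrix G A \<longleftrightarrow>
     (\<forall>p q. ((q, p) \<in> parcs G \<longrightarrow> A $ p $ q > 0) \<and> ((q, p) \<notin> parcs G \<longrightarrow> A $ p $ q = 0))"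

definition all_loops :: "'v pair_pre_digraph \<Rightarrow> bool" where
  "all_loops G \<longleftrightarrow> (\<forall>p\<in>pverts G. (p, p) \<in> parcs G)"

definition column_stochastic_on :: "'v::finite set \<Rightarrow> real ^ 'v ^ 'v \<Rightarrow> bool" where
  "column_stochastic_on I A \<longleftrightarrow> (\<forall>q\<in>I. (\<Sum>p\<in>I. A $ p $ q) = 1)"

definition row_stochastic :: "real ^ 'v::finite ^ 'v \<Rightarrow> bool" where
  "row_stochastic A \<longleftrightarrow> (\<forall>p. (\<Sum>q\<in>UNIV. A $ p $ q) = 1)"

text \<open>Only the coordinates of \<open>w\<close> in \<open>I\<close> matter, so \<open>w\<close> can stack the Perron vectors of all clusters.\<close>

definition perron_vector_on :: "'v::finite set \<Rightarrow> real ^ 'v ^ 'v \<Rightarrow> real ^ 'v \<Rightarrow> bool" where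
  "perron_vector_on I A w \<longleftrightarrow>
     (\<forall>p\<in>I. w $ p > 0) \<and> (\<forall>p\<in>I. (\<Sum>q\<in>I. A $ p $ q * w $ q) = w $ p) \<and> (\<Sum>p\<in>I. w $ p) = 1"

definition matrix_power :: "real ^ 'v::finite ^ 'v \<Rightarrow> nat \<Rightarrow> real ^ 'v ^ 'v" where
  "matrix_power A k = (((**) A) ^^ k) (Finite_Cartesian_Product.mat 1)"

definition limit_matrix :: "real ^ 'v::finite ^ 'v \<Rightarrow> real ^ 'v ^ 'v" where
  "limit_matrix A = lim (matrix_power A)"

definition A_tilde :: "real ^ 'v ^ 'v \<Rightarrow> real ^ 'v \<Rightarrow> 'v \<Rightarrow> real ^ 'v ^ 'v" where
  "A_tilde A \<delta> q =
     (\<chi> p m. if p \<noteq> m then A $ p $ m else \<bar>A $ p $ p - \<delta> $ p * A $ p $ q\<bar>)"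

definition weighted_norm :: "'v set \<Rightarrow> real ^ 'v \<Rightarrow> real ^ 'v \<Rightarrow> real" where
  "weighted_norm I w u = L2_set (\<lambda>p. u $ p / sqrt (w $ p)) I"

text \<open>
  The weighted spectral norm of the block \<open>I \<times> I\<close> of \<open>M\<close>. The rescaled block is padded with
  zeros, which does not change its spectral norm.
\<close>

definition weighted_matrix_norm :: "'v::finite set \<Rightarrow> real ^ 'v \<Rightarrow> real ^ 'v ^ 'v \<Rightarrow> real" where
  "weighted_matrix_norm I w M =
     onorm ((*v) (\<chi> p q. if p \<in> I \<and> q \<in> I
                         then inverse (sqrt (w $ p)) * M $ p $ q * sqrt (w $ q) else 0))"

definition is_norm :: "('a::real_vector \<Rightarrow> real) \<Rightarrow> bool" where
  "is_norm f \<longleftrightarrow> (\<forall>u. f u \<ge> 0) \<and> (\<forall>u. f u = 0 \<longleftrightarrow> u = 0) \<and>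
     (\<forall>c u. f (c *\<^sub>R u) = \<bar>c\<bar> * f u) \<and> (\<forall>u v. f (u + v) \<le> f u + f v)"

definition is_matrix_norm :: "(real ^ 'v::finite ^ 'v \<Rightarrow> real) \<Rightarrow> bool" where
  "is_matrix_norm f \<longleftrightarrow> is_norm f \<and> (\<forall>A B. f (A ** B) \<le> f A * f B)"

definition spec_radius_real :: "real Matrix.mat \<Rightarrow> real" where
  "spec_radius_real M = spectral_radius (map_mat complex_of_real M)"

text \<open>
  Suprema of tails are taken in \<open>ereal\<close>: the \<open>real\<close> supremum of an unbounded set is unspecified.
\<close>

definition sup_tail :: "(nat \<Rightarrow> real) \<Rightarrow> nat \<Rightarrow> ereal" where
  "sup_tail s t = (SUP l\<in>{t..}. ereal (s l))"

definition converges_linearly_to_0 :: "(nat \<Rightarrow> ereal) \<Rightarrow> real \<Rightarrow> bool" where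
  "converges_linearly_to_0 s r \<longleftrightarrow> r < 1 \<and> (\<exists>C::real. \<forall>t. s t \<le> ereal (C * r ^ t))"

end

theory Submission
  imports Defs
begin

text \<open>
  Three squared errors are followed along the iteration: the distance of the actions to the
  equilibrium in the norm weighted by \<open>bw\<close> (\<open>action_error\<close>), the deviation of the trackers from
  the multiples of the Perron vectors that carry the same cluster sums (\<open>tracker_deviation\<close>), and
  the error of the estimates (\<open>consensus_error\<close>). Each of them at time \<open>t + 1\<close> is at most a linear
  combination of all three at time \<open>t\<close>, with coefficients bounded by the entries of the matrix \<open>T\<close>
  (\<open>action_error_step\<close>, \<open>tracker_deviation_step\<close>, \<open>consensus_error_step\<close>).

  The entries of \<open>T\<close> are positive, so \<open>T\<close> has a positive eigenvector; its eigenvalue is at most the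
  spectral radius, and multiples of it dominate the three errors (\<open>linear_recursion_bound_3\<close>). This
  yields the exact rate, with no loss for possible Jordan blocks. The spectral radius is below \<open>1\<close>
  because the bounds on the step-sizes make \<open>T\<close> decrease every coordinate of a certain positive
  vector (\<open>small_step_decrease\<close>).

  The three recursions rest on the following observations. Column stochasticity makes the sum of the
  trackers of one partial derivative equal to the sum of the current local partial derivatives, so
  an agent moves against \<open>bw\<close> times the game mapping up to the tracker deviation and the error of the
  estimates. In the norm weighted by \<open>bw\<close> the factor \<open>bw\<close> cancels and strong monotonicity applies.
  In the same norm, \<open>A i\<close> minus its limit is a strict contraction: averaging with a
  column-stochastic matrix loses variance unless the averaged quantity is constant along all arcs,
  and strong connectivity then makes it constant on the cluster.

  The errors of the estimates of one action are multiplied by a matrix that agrees with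
  \<open>A_tilde Abar \<delta> q\<close> up to the signs of diagonal entries. A norm in which the latter contracts need
  not contract the former. The norm is therefore replaced by its monotone hull
  (\<open>monotone_hull_contraction\<close>), which depends on absolute values only and inherits the contraction
  factor as well as both constants of comparison with the Euclidean norm. The two norms are
  equivalent, so that linear convergence in the hull carries over to the given norm.

  Finally, the change of the estimates in one step is a function of their current errors alone; the
  movement of the actions enters only at the following step. The recursion for the tracker deviation
  therefore involves the tracker deviation and the consensus error alone.
\<close>

section \<open>Nonnegative matrices and the spectral radius\<close>

text \<open>
  Normalising \<open>M *v v\<close> to coordinate sum \<open>1\<close> maps the standard simplex continuously into its relative
  interior; a fixed point, which exists by Brouwer's theorem, is a positive eigenvector.
\<close>

lemma positive_matrix_has_positive_eigenvector:
  fixes M :: "real ^ 'n::finite ^ 'n"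
  assumes pos: "\<And>i j. M $ i $ j > 0"
  obtains r v where "r > 0" "\<And>i. v $ i > 0" "M *v v = r *\<^sub>R v"
proof -
  define S where "S = {v :: real ^ 'n. (\<forall>i. 0 \<le> v $ i) \<and> (\<Sum>i\<in>UNIV. v $ i) = 1}"
  define s where "s v = (\<Sum>i\<in>UNIV. (M *v v) $ i)" for v
  define f where "f v = inverse (s v) *\<^sub>R (M *v v)" for v
  have image_pos: "(M *v v) $ i > 0" if "v \<in> S" for v i
  proof -
    have "\<exists>j. v $ j > 0"
    proof (rule ccontr)
      assume "\<not> ?thesis"
      then have "(\<Sum>j\<in>UNIV. v $ j) \<le> 0" by (intro sum_nonpos) (auto simp: not_less)
      with that show False by (simp add: S_def)
    qed
    then obtain j where j: "v $ j > 0" by blast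
    have "0 < M $ i $ j * v $ j" using pos j by simp
    also have "\<dots> \<le> (\<Sum>j\<in>UNIV. M $ i $ j * v $ j)"
      using that pos by (intro member_le_sum) (auto simp: S_def less_imp_le)
    finally show ?thesis by (simp add: matrix_vector_mult_def)
  qed
  have s_pos: "s v > 0" if "v \<in> S" for v
    unfolding s_def using image_pos[OF that] by (intro sum_pos) auto
  have "compact S"
  proof -
    have "closed S"
      unfolding S_def
      by (intro closed_Collect_conj closed_Collect_all closed_Collect_le closed_Collect_eq
            continuous_intros)
    moreover have "bounded S"
    proof (rule boundedI)
      fix v assume v: "v \<in> S"
      have "norm v \<le> (\<Sum>i\<in>UNIV. \<bar>v $ i\<bar>)" by (rule norm_le_l1_cart)
      also have "\<dots> = 1" using v by (simp add: S_def)
      finally show "norm v \<le> 1" .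
    qed
    ultimately show ?thesis by (simp add: compact_eq_bounded_closed)
  qed
  moreover have "convex S"
    unfolding convex_def S_def by (auto simp: sum.distrib simp flip: sum_distrib_left)
  moreover have "S \<noteq> {}"
  proof -
    have "axis undefined 1 \<in> S" by (auto simp: S_def axis_def if_distrib cong: if_cong)
    then show ?thesis by blast
  qed
  moreover have "continuous_on S f"
    unfolding f_def s_def using s_pos
    by (intro continuous_intros) (force simp: s_def)
  moreover have "f \<in> S \<rightarrow> S"
  proof
    fix v assume v: "v \<in> S"
    have "(\<Sum>i\<in>UNIV. f v $ i) = 1"
      using s_pos[OF v] by (simp add: f_def s_def flip: sum_distrib_left)
    then show "f v \<in> S"
      using image_pos[OF v] s_pos[OF v] by (auto simp: S_def f_def less_imp_le)
  qed
  ultimately obtain v where v: "v \<in> S" "f v = v" using brouwer by blast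
  have eig: "M *v v = s v *\<^sub>R v"
    using s_pos[OF v(1)] by (subst (3) v(2)[symmetric]) (simp add: f_def)
  show thesis
  proof (rule that[of "s v" v])
    fix i
    show "v $ i > 0"
      by (subst v(2)[symmetric]) (use image_pos[OF v(1)] s_pos[OF v(1)] in \<open>simp add: f_def\<close>)
  qed (use s_pos v eig in auto)
qed

lemma spec_radius_real_ge_eigenvalue:
  fixes T :: "real Matrix.mat"
  assumes T: "T \<in> carrier_mat n n" and ev: "eigenvector T v r"
  shows "\<bar>r\<bar> \<le> spec_radius_real T"
proof -
  let ?T = "map_mat complex_of_real T"
  have "eigenvector ?T (map_vec complex_of_real v) (complex_of_real r)"
    using of_real_hom.eigenvector_hom[OF T ev] .
  then have "complex_of_real r \<in> spectrum ?T"
    unfolding spectrum_def eigenvalue_def by blast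
  then have *: "norm (complex_of_real r) \<in> norm ` spectrum ?T" by blast
  have "v \<in> carrier_vec n" "v \<noteq> 0\<^sub>v n"
    using ev T unfolding eigenvector_def by auto
  then have "n > 0" by (metis carrier_vecD eq_vecI gr0I index_zero_vec(2) not_less_zero)
  moreover have "?T \<in> carrier_mat n n" using T by simp
  ultimately show ?thesis
    using spectral_radius_mem_max(2)[OF _ _ *] unfolding spec_radius_real_def by simp
qed

text \<open>
  A positive vector \<open>\<nu>\<close> that \<open>T\<close> decreases certifies that the spectral radius is below \<open>1\<close>: in the
  maximum norm weighted by \<open>1 / \<nu>\<close> the matrix is a strict contraction, so an eigenvector is strictly
  shrunk at the coordinate where this norm is attained.
\<close>

lemma spec_radius_real_less_1:
  fixes T :: "real Matrix.mat" and \<nu> :: "nat \<Rightarrow> real"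
  assumes T: "T \<in> carrier_mat n n" and n: "n > 0"
    and nonneg: "\<And>i j. i < n \<Longrightarrow> j < n \<Longrightarrow> T $$ (i, j) \<ge> 0"
    and \<nu>: "\<And>i. i < n \<Longrightarrow> \<nu> i > 0"
    and decr: "\<And>i. i < n \<Longrightarrow> (\<Sum>j<n. T $$ (i, j) * \<nu> j) < \<nu> i"
  shows "spec_radius_real T < 1"
proof -
  let ?T = "map_mat complex_of_real T"
  have "spectral_radius ?T \<in> norm ` spectrum ?T"
    using spectral_radius_mem_max(1)[of ?T n] T n by auto
  then obtain e where e: "e \<in> spectrum ?T" "spectral_radius ?T = norm e" by auto
  then obtain u where u: "eigenvector ?T u e" unfolding spectrum_def eigenvalue_def by auto
  have u_dim: "dim_vec u = n" and u0: "u \<noteq> 0\<^sub>v n" and Tu: "?T *\<^sub>v u = e \<cdot>\<^sub>v u"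
    using u T unfolding eigenvector_def by auto
  define h where "h i = cmod (Matrix.vec_index u i) / \<nu> i" for i
  \<comment> \<open>The coordinate at which the weighted maximum norm of the eigenvector is attained.\<close>
  obtain m where m: "m < n" "\<And>i. i < n \<Longrightarrow> h i \<le> h m"
  proof -
    have "Max (h ` {..<n}) \<in> h ` {..<n}" using n by (intro Max_in) auto
    then obtain m where "m < n" "h m = Max (h ` {..<n})" by auto
    then show thesis using that[of m] by simp
  qed
  have "h m > 0"
  proof -
    obtain i where "i < n" "Matrix.vec_index u i \<noteq> 0"
      using u0 u_dim by (metis eq_vecI index_zero_vec)
    then have "0 < h i" using \<nu> by (simp add: h_def)
    then show ?thesis using m(2)[OF \<open>i < n\<close>] by linarith
  qed
  have "norm e * (h m * \<nu> m) = cmod (e * Matrix.vec_index u m)"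
    using \<nu>[OF m(1)] by (simp add: h_def norm_mult)
  also have "e * Matrix.vec_index u m = Matrix.vec_index (?T *\<^sub>v u) m"
    using Tu m(1) u_dim by simp
  also have "\<dots> = (\<Sum>j<n. complex_of_real (T $$ (m, j)) * Matrix.vec_index u j)"
    using T m(1) u_dim by (auto simp: scalar_prod_def atLeast0LessThan intro!: sum.cong)
  also have "cmod \<dots> \<le> (\<Sum>j<n. T $$ (m, j) * (h m * \<nu> j))"
  proof (rule sum_norm_le)
    fix j assume "j \<in> {..<n}"
    then have j: "j < n" by simp
    have "cmod (Matrix.vec_index u j) = h j * \<nu> j" using \<nu>[OF j] by (simp add: h_def)
    also have "\<dots> \<le> h m * \<nu> j" using m(2)[OF j] \<nu>[OF j] by simp
    finally show "cmod (complex_of_real (T $$ (m, j)) * Matrix.vec_index u j)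
        \<le> T $$ (m, j) * (h m * \<nu> j)"
      using nonneg[OF m(1) j] by (simp add: norm_mult mult_left_mono)
  qed
  also have "\<dots> = h m * (\<Sum>j<n. T $$ (m, j) * \<nu> j)"
    by (simp add: sum_distrib_left mult_ac)
  also have "\<dots> < h m * \<nu> m" using decr[OF m(1)] \<open>h m > 0\<close> by simp
  finally have "norm e < 1" using \<open>h m > 0\<close> \<nu>[OF m(1)]
    by (simp add: mult_less_cancel_right1)
  then show ?thesis by (simp add: spec_radius_real_def e(2))
qed

lemma entries_3:
  fixes T :: "real Matrix.mat"
  assumes "T = mat_of_rows_list 3 [[a11, a12, a13], [a21, a22, a23], [a31, a32, a33]]"
  shows "T \<in> carrier_mat 3 3"
    and "T $$ (0, 0) = a11" "T $$ (0, 1) = a12" "T $$ (0, 2) = a13"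
    and "T $$ (1, 0) = a21" "T $$ (1, 1) = a22" "T $$ (1, 2) = a23"
    and "T $$ (2, 0) = a31" "T $$ (2, 1) = a32" "T $$ (2, 2) = a33"
  by (simp_all add: assms mat_of_rows_list_def numeral_3_eq_3)

lemma eigenvector_3:
  fixes T :: "real Matrix.mat"
  assumes T: "T = mat_of_rows_list 3 [[a11, a12, a13], [a21, a22, a23], [a31, a32, a33]]"
    and rows: "a11 * v1 + a12 * v2 + a13 * v3 = r * v1"
      "a21 * v1 + a22 * v2 + a23 * v3 = r * v2"
      "a31 * v1 + a32 * v2 + a33 * v3 = r * v3"
    and "v1 > 0"
  shows "eigenvector T (Matrix.vec 3 ((!) [v1, v2, v3])) r"
proof -
  let ?v = "Matrix.vec 3 ((!) [v1, v2, v3])"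
  have dim: "dim_row T = 3" "dim_col T = 3" by (simp_all add: T mat_of_rows_list_def)
  have sum3: "(\<Sum>j = 0..<3. f j) = f 0 + f 1 + f (2::nat)" for f :: "nat \<Rightarrow> real"
    by (simp add: numeral_3_eq_3 numeral_2_eq_2)
  have row: "Matrix.vec_index (T *\<^sub>v ?v) i = T $$ (i, 0) * v1 + T $$ (i, 1) * v2 + T $$ (i, 2) * v3"
    if "i < 3" for i
  proof -
    have "Matrix.vec_index (T *\<^sub>v ?v) i = (\<Sum>j = 0..<3. T $$ (i, j) * [v1, v2, v3] ! j)"
      using that by (simp add: dim scalar_prod_def)
    then show ?thesis unfolding sum3 by simp
  qed
  have "T *\<^sub>v ?v = r \<cdot>\<^sub>v ?v"
  proof (rule eq_vecI)
    fix i assume "i < dim_vec (r \<cdot>\<^sub>v ?v)"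
    then have "i < 3" by simp
    then have "i = 0 \<or> i = 1 \<or> i = 2" by arith
    then show "Matrix.vec_index (T *\<^sub>v ?v) i = Matrix.vec_index (r \<cdot>\<^sub>v ?v) i"
      unfolding row[OF \<open>i < 3\<close>] using rows by (elim disjE) (simp_all only: entries_3[OF T], simp_all)
  qed (simp add: dim)
  moreover have "?v \<noteq> 0\<^sub>v (dim_row T)"
  proof
    assume "?v = 0\<^sub>v (dim_row T)"
    then have "Matrix.vec_index ?v 0 = Matrix.vec_index (0\<^sub>v 3) 0" by (simp only: dim)
    with \<open>v1 > 0\<close> show False by simp
  qed
  moreover have "?v \<in> carrier_vec (dim_row T)" by (rule carrier_vecI) (simp add: dim)
  ultimately show ?thesis by (simp add: eigenvector_def)
qed

text \<open>
  A multiple of the positive eigenvector dominates the initial values, and domination by the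
  eigenvector is preserved by the positive coefficients. A bound by norms of matrix powers gives in
  general only rates above the spectral radius.
\<close>

lemma linear_recursion_bound_3:
  fixes T :: "real Matrix.mat" and X Y Z :: "nat \<Rightarrow> real"
  assumes T: "T = mat_of_rows_list 3 [[a11, a12, a13], [a21, a22, a23], [a31, a32, a33]]"
    and pos: "a11 > 0" "a12 > 0" "a13 > 0" "a21 > 0" "a22 > 0" "a23 > 0" "a31 > 0" "a32 > 0" "a33 > 0"
    and X: "\<And>t. X (Suc t) \<le> a11 * X t + a12 * Y t + a13 * Z t"
    and Y: "\<And>t. Y (Suc t) \<le> a21 * X t + a22 * Y t + a23 * Z t"
    and Z: "\<And>t. Z (Suc t) \<le> a31 * X t + a32 * Y t + a33 * Z t"
  obtains C where "\<And>t. X t \<le> C * spec_radius_real T ^ t"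
    "\<And>t. Y t \<le> C * spec_radius_real T ^ t" "\<And>t. Z t \<le> C * spec_radius_real T ^ t"
proof -
  define M :: "real ^ 3 ^ 3" where "M = vector [vector [a11, a12, a13], vector [a21, a22, a23], vector [a31, a32, a33]]"
  have "M $ i $ j > 0" for i j
    using exhaust_3[of i] exhaust_3[of j] pos by (auto simp: M_def)
  then obtain r v where r: "r > 0" and v: "\<And>i. v $ i > 0" and Mv: "M *v v = r *\<^sub>R v"
    by (rule positive_matrix_has_positive_eigenvector) blast
  have row: "(M *v v) $ i = r * v $ i" for i by (simp add: Mv)
  have rows: "a11 * v $ 1 + a12 * v $ 2 + a13 * v $ 3 = r * v $ 1"
      "a21 * v $ 1 + a22 * v $ 2 + a23 * v $ 3 = r * v $ 2"
      "a31 * v $ 1 + a32 * v $ 2 + a33 * v $ 3 = r * v $ 3"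
    using row[of 1] row[of 2] row[of 3] by (simp_all add: matrix_vector_mult_def M_def sum_3)
  have "eigenvector T (Matrix.vec 3 ((!) [v $ 1, v $ 2, v $ 3])) r"
    by (rule eigenvector_3[OF T rows v])
  moreover have "T \<in> carrier_mat 3 3" by (rule entries_3(1)[OF T])
  ultimately have r_le: "r \<le> spec_radius_real T"
    using spec_radius_real_ge_eigenvalue[of T 3] r by fastforce
  define c where "c = Max {\<bar>X 0\<bar> / v $ 1, \<bar>Y 0\<bar> / v $ 2, \<bar>Z 0\<bar> / v $ 3}"
  have c: "\<bar>X 0\<bar> / v $ 1 \<le> c" "\<bar>Y 0\<bar> / v $ 2 \<le> c" "\<bar>Z 0\<bar> / v $ 3 \<le> c"
    by (simp_all add: c_def)
  have "c \<ge> 0" using c(1) v[of 1] by (rule_tac order_trans[OF _ c(1)]) simp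
  have main: "X t \<le> c * r ^ t * v $ 1 \<and> Y t \<le> c * r ^ t * v $ 2 \<and> Z t \<le> c * r ^ t * v $ 3" for t
  proof (induction t)
    case 0
    have "\<bar>X 0\<bar> \<le> c * v $ 1" "\<bar>Y 0\<bar> \<le> c * v $ 2" "\<bar>Z 0\<bar> \<le> c * v $ 3"
      using c v[of 1] v[of 2] v[of 3] by (simp_all add: divide_le_eq)
    then show ?case by auto
  next
    case (Suc t)
    have step: "b1 * X t + b2 * Y t + b3 * Z t \<le> c * r ^ t * (b1 * v $ 1 + b2 * v $ 2 + b3 * v $ 3)"
      if "b1 > 0" "b2 > 0" "b3 > 0" for b1 b2 b3
    proof -
      have "b1 * X t + b2 * Y t + b3 * Z t
          \<le> b1 * (c * r ^ t * v $ 1) + b2 * (c * r ^ t * v $ 2) + b3 * (c * r ^ t * v $ 3)"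
        using Suc that by (intro add_mono mult_left_mono) auto
      then show ?thesis by (simp add: algebra_simps)
    qed
    show ?case
      using order_trans[OF X step[of a11 a12 a13]] order_trans[OF Y step[of a21 a22 a23]]
        order_trans[OF Z step[of a31 a32 a33]] pos
      by (simp add: rows mult_ac)
  qed
  define K where "K = c * Max {v $ 1, v $ 2, v $ 3}"
  have K: "c * r ^ t * v $ i \<le> K * spec_radius_real T ^ t" for t i
  proof -
    have "v $ i \<le> Max {v $ 1, v $ 2, v $ 3}" using exhaust_3[of i] by auto
    moreover have "r ^ t \<le> spec_radius_real T ^ t" using r r_le by (intro power_mono) auto
    ultimately have "c * (v $ i * r ^ t) \<le> c * (Max {v $ 1, v $ 2, v $ 3} * spec_radius_real T ^ t)"
      using \<open>c \<ge> 0\<close> v[of i] r by (intro mult_left_mono mult_mono) (auto simp: less_imp_le)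
    then show ?thesis by (simp add: K_def mult_ac)
  qed
  show thesis
    using main K order_trans by (intro that[of K]) blast+
qed

lemma spec_radius_3_less_1:
  fixes T :: "real Matrix.mat"
  assumes T: "T = mat_of_rows_list 3 [[a11, a12, a13], [a21, a22, a23], [a31, a32, a33]]"
    and pos: "a11 > 0" "a12 > 0" "a13 > 0" "a21 > 0" "a22 > 0" "a23 > 0" "a31 > 0" "a32 > 0" "a33 > 0"
    and \<nu>: "\<nu>1 > 0" "\<nu>2 > 0" "\<nu>3 > 0"
    and decrease: "a11 * \<nu>1 + a12 * \<nu>2 + a13 * \<nu>3 < \<nu>1"
      "a21 * \<nu>1 + a22 * \<nu>2 + a23 * \<nu>3 < \<nu>2" "a31 * \<nu>1 + a32 * \<nu>2 + a33 * \<nu>3 < \<nu>3"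
  shows "spec_radius_real T < 1"
proof (rule spec_radius_real_less_1[where \<nu> = "(!) [\<nu>1, \<nu>2, \<nu>3]"])
  show "T \<in> carrier_mat 3 3" by (rule entries_3(1)[OF T])
  have index: "i = 0 \<or> i = 1 \<or> i = 2" if "i < 3" for i :: nat using that by arith
  show "T $$ (i, j) \<ge> 0" if "i < 3" "j < 3" for i j
    using index[OF that(1)] index[OF that(2)] pos
    by (elim disjE) (simp_all only: entries_3[OF T] less_imp_le)
  show "[\<nu>1, \<nu>2, \<nu>3] ! i > 0" if "i < 3" for i
    using index[OF that] \<nu> by (elim disjE) simp_all
  have sum: "(\<Sum>j<3. h j) = h 0 + h 1 + h (2 :: nat)" for h :: "nat \<Rightarrow> real"
    by (simp add: numeral_3_eq_3 numeral_2_eq_2)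
  have nth: "[\<nu>1, \<nu>2, \<nu>3] ! 0 = \<nu>1" "[\<nu>1, \<nu>2, \<nu>3] ! 1 = \<nu>2" "[\<nu>1, \<nu>2, \<nu>3] ! 2 = \<nu>3"
    by simp_all
  show "(\<Sum>j<3. T $$ (i, j) * [\<nu>1, \<nu>2, \<nu>3] ! j) < [\<nu>1, \<nu>2, \<nu>3] ! i" if "i < 3" for i
    unfolding sum nth using index[OF that] decrease
    by (elim disjE) (simp_all only: entries_3[OF T] nth)
qed simp

lemma spec_radius_real_nonneg:
  assumes "T \<in> carrier_mat n n" "n > 0"
  shows "spec_radius_real T \<ge> 0"
proof -
  have "spec_radius_real T \<in> norm ` spectrum (map_mat complex_of_real T)"
    unfolding spec_radius_real_def using assms by (intro spectral_radius_mem_max(1)[of _ n]) simp_all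
  then show ?thesis by auto
qed

lemma converges_linearly_of_geometric_bound:
  assumes r: "0 \<le> r" "r < 1" and s: "\<And>t. s t \<le> C * r ^ t"
  shows "converges_linearly_to_0 (sup_tail s) r"
  unfolding converges_linearly_to_0_def sup_tail_def
proof (intro conjI exI allI r(2) SUP_least)
  fix t l :: nat assume "l \<in> {t..}"
  then have "r ^ l \<le> r ^ t" using r by (intro power_decreasing) simp_all
  have "s l \<le> \<bar>C\<bar> * r ^ l"
    by (rule order_trans[OF s]) (use r in \<open>intro mult_right_mono; simp\<close>)
  also have "\<dots> \<le> \<bar>C\<bar> * r ^ t" using \<open>r ^ l \<le> r ^ t\<close> by (rule mult_left_mono) simp
  finally show "ereal (s l) \<le> ereal (\<bar>C\<bar> * r ^ t)" by simp
qed

section \<open>Elementary inequalities\<close>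

text \<open>
  Young's inequality with the weight that puts the new factor midway between \<open>\<sigma>\<^sup>2\<close> and \<open>1\<close>. It is the
  source of the factors \<open>1 - k10\<close> and \<open>1 - k16\<close> and of the quotients \<open>\<tau>1\<close> and \<open>\<tau>2\<close>.
\<close>

lemma contraction_square_bound:
  fixes \<sigma> a b :: real
  assumes "0 \<le> \<sigma>" "\<sigma> < 1"
  shows "(\<sigma> * a + b)\<^sup>2 \<le> (1 + \<sigma>\<^sup>2) / 2 * a\<^sup>2 + (1 + \<sigma>\<^sup>2) / (1 - \<sigma>\<^sup>2) * b\<^sup>2"
proof -
  have pos: "1 - \<sigma>\<^sup>2 > 0" using assms by (simp add: power_less_one_iff)
  have "(1 + \<sigma>\<^sup>2) / 2 * a\<^sup>2 + (1 + \<sigma>\<^sup>2) / (1 - \<sigma>\<^sup>2) * b\<^sup>2 - (\<sigma> * a + b)\<^sup>2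
      = ((1 - \<sigma>\<^sup>2) * a - 2 * \<sigma> * b)\<^sup>2 / (2 * (1 - \<sigma>\<^sup>2))"
    using pos by (simp add: field_simps) (simp add: power2_eq_square power4_eq_xxxx algebra_simps)
  also have "\<dots> \<ge> 0" using pos by simp
  finally show ?thesis by linarith
qed

lemma square_sum_le_card: "(\<Sum>l\<in>S. f l :: real)\<^sup>2 \<le> real (card S) * (\<Sum>l\<in>S. (f l)\<^sup>2)"
  using Cauchy_Schwarz_ineq_sum[of "\<lambda>_. 1" f S] by simp

lemma square_sum3_le: "(a + b + c :: real)\<^sup>2 \<le> 3 * (a\<^sup>2 + b\<^sup>2 + c\<^sup>2)"
proof -
  have "3 * (a\<^sup>2 + b\<^sup>2 + c\<^sup>2) - (a + b + c)\<^sup>2 = (a - b)\<^sup>2 + (b - c)\<^sup>2 + (a - c)\<^sup>2"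
    by (simp add: power2_eq_square algebra_simps)
  then show ?thesis by (smt (verit) zero_le_power2)
qed

lemma norm_cart_sq: "(norm (u :: real ^ 'n::finite))\<^sup>2 = (\<Sum>p\<in>UNIV. (u $ p)\<^sup>2)"
  by (simp add: norm_vec_def L2_set_def sum_nonneg)

lemma young_bound:
  fixes c M a u e :: real
  assumes "c > 0" "0 \<le> a" "a \<le> M"
  shows "- 2 * (a * u * e) \<le> c * u\<^sup>2 + M\<^sup>2 / c * e\<^sup>2"
proof -
  have "0 \<le> (c * u + a * e)\<^sup>2 / c" using assms by simp
  also have "\<dots> = c * u\<^sup>2 + 2 * (a * u * e) + a\<^sup>2 / c * e\<^sup>2"
    using assms by (simp add: power2_eq_square field_simps)
  finally have "- 2 * (a * u * e) \<le> c * u\<^sup>2 + a\<^sup>2 / c * e\<^sup>2" by linarith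
  moreover have "a\<^sup>2 / c * e\<^sup>2 \<le> M\<^sup>2 / c * e\<^sup>2"
    using assms by (intro mult_right_mono divide_right_mono power_mono) auto
  ultimately show ?thesis by linarith
qed

section \<open>Weighted norms and column-stochastic blocks\<close>

lemma norm_padded: "norm (\<chi> p. if p \<in> I then f p else (0 :: real)) = L2_set f I"
  unfolding norm_vec_def L2_set_def
  by (intro arg_cong[where f = sqrt] sum.mono_neutral_cong_right) auto

lemma weighted_norm_sq:
  assumes "\<And>p. p \<in> I \<Longrightarrow> b $ p > 0"
  shows "(weighted_norm I b u)\<^sup>2 = (\<Sum>p\<in>I. (u $ p)\<^sup>2 / b $ p)"
proof -
  have "(weighted_norm I b u)\<^sup>2 = (\<Sum>p\<in>I. (u $ p / sqrt (b $ p))\<^sup>2)"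
    unfolding weighted_norm_def L2_set_def by (simp add: sum_nonneg)
  also have "\<dots> = (\<Sum>p\<in>I. (u $ p)\<^sup>2 / b $ p)"
    using assms by (intro sum.cong) (auto simp: power_divide less_imp_le)
  finally show ?thesis .
qed

lemma weighted_norm_nonneg: "weighted_norm I b u \<ge> 0"
  by (simp add: weighted_norm_def)

lemma weighted_norm_add_le: "weighted_norm I b (u + v) \<le> weighted_norm I b u + weighted_norm I b v"
  unfolding weighted_norm_def
  using L2_set_triangle_ineq[of "\<lambda>p. u $ p / sqrt (b $ p)" "\<lambda>p. v $ p / sqrt (b $ p)" I]
  by (simp add: add_divide_distrib)

lemma weighted_norm_cong:
  "(\<And>p. p \<in> I \<Longrightarrow> u $ p = v $ p) \<Longrightarrow> weighted_norm I b u = weighted_norm I b v"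
  unfolding weighted_norm_def by (rule L2_set_cong) simp_all

lemma weighted_matrix_norm_nonneg: "weighted_matrix_norm I b M \<ge> 0"
  unfolding weighted_matrix_norm_def by (intro onorm_pos_le matrix_vector_mul_bounded_linear)

lemma weighted_matrix_norm_compatible:
  assumes b: "\<And>p. p \<in> I \<Longrightarrow> b $ p > 0"
    and M: "\<And>p q. p \<in> I \<Longrightarrow> q \<notin> I \<Longrightarrow> M $ p $ q = 0"
  shows "weighted_norm I b (M *v u) \<le> weighted_matrix_norm I b M * weighted_norm I b u"
proof -
  define B :: "real ^ 'a ^ 'a" where "B = (\<chi> p q. if p \<in> I \<and> q \<in> I
    then inverse (sqrt (b $ p)) * M $ p $ q * sqrt (b $ q) else 0)"
  define z where "z = (\<chi> p. if p \<in> I then u $ p / sqrt (b $ p) else 0)"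
  have "B *v z = (\<chi> p. if p \<in> I then (M *v u) $ p / sqrt (b $ p) else 0)"
  proof (subst Finite_Cartesian_Product.vec_eq_iff, intro allI)
    fix p
    show "(B *v z) $ p = (\<chi> p. if p \<in> I then (M *v u) $ p / sqrt (b $ p) else 0) $ p"
    proof (cases "p \<in> I")
      case True
      have "(B *v z) $ p = (\<Sum>q\<in>UNIV. M $ p $ q * u $ q / sqrt (b $ p))"
        unfolding matrix_vector_mult_def using True b M[OF True]
        by (auto intro!: sum.cong simp: B_def z_def divide_simps order.strict_iff_order)
      also have "\<dots> = (M *v u) $ p / sqrt (b $ p)"
        by (simp add: matrix_vector_mult_def sum_divide_distrib)
      finally show ?thesis using True by simp
    qed (simp add: matrix_vector_mult_def B_def)
  qed
  then have "weighted_norm I b (M *v u) = norm (B *v z)"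
    by (simp add: norm_padded weighted_norm_def)
  also have "\<dots> \<le> onorm ((*v) B) * norm z"
    by (intro onorm matrix_vector_mul_bounded_linear)
  also have "norm z = weighted_norm I b u" by (simp add: z_def norm_padded weighted_norm_def)
  finally show ?thesis by (simp add: weighted_matrix_norm_def B_def)
qed

text \<open>
  In finite dimension the operator norm is attained on the compact unit sphere, so a pointwise strict
  inequality is a uniform one.
\<close>

lemma onorm_less_if_pointwise_less:
  fixes f :: "'a::euclidean_space \<Rightarrow> 'b::real_normed_vector"
  assumes f: "bounded_linear f" and less: "\<And>v. v \<noteq> 0 \<Longrightarrow> norm (f v) < norm v"
  shows "onorm f < 1"
proof -
  interpret bounded_linear f by fact
  have "continuous_on (sphere 0 1) (\<lambda>v. norm (f v))"
    by (intro continuous_intros continuous_on)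
  moreover have "sphere (0 :: 'a) 1 \<noteq> {}" by simp
  ultimately obtain u where u: "u \<in> sphere 0 1" "\<And>v. v \<in> sphere 0 1 \<Longrightarrow> norm (f v) \<le> norm (f u)"
    using continuous_attains_sup[OF compact_sphere] by metis
  have "onorm f \<le> norm (f u)"
  proof (rule onorm_bound)
    fix v :: 'a
    show "norm (f v) \<le> norm (f u) * norm v"
    proof (cases "v = 0")
      case False
      have "norm (f (v /\<^sub>R norm v)) \<le> norm (f u)" using False by (intro u(2)) simp
      then show ?thesis using False by (simp add: scaleR divide_simps mult.commute)
    qed (simp add: zero)
  qed simp
  also have "\<dots> < 1" using less[of u] u(1) by (cases "u = 0") auto
  finally show ?thesis .
qed

text \<open>
  One cluster with its network. The factor \<open>m\<close> is the size of the cluster in the application; the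
  weighted matrix norm does not change when the weight is rescaled.
\<close>

locale stochastic_block =
  fixes H :: "'v::finite pair_pre_digraph" and A :: "real ^ 'v ^ 'v" and w b :: "real ^ 'v"
    and I :: "'v set" and m :: real
  assumes wf: "pair_wf_digraph H" and verts: "pverts H = I" and loops: "all_loops H"
    and adjacency: "adjacency_matrix H A" and connected: "strongly_connected (with_proj H)"
    and stochastic: "column_stochastic_on I A" and perron: "perron_vector_on I A w"
    and m_pos: "m > 0" and b_eq: "\<And>p. p \<in> I \<Longrightarrow> b $ p = m * w $ p"
begin

lemma A_nonneg: "A $ p $ q \<ge> 0"
  using adjacency unfolding adjacency_matrix_def by (metis less_imp_le order_refl)

lemma A_outside: "p \<notin> I \<or> q \<notin> I \<Longrightarrow> A $ p $ q = 0"
  using adjacency pair_wf_digraph.in_arcsD1[OF wf, of q p] pair_wf_digraph.in_arcsD2[OF wf, of q p]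
  unfolding adjacency_matrix_def verts by blast

lemma A_diag_pos: "p \<in> I \<Longrightarrow> A $ p $ p > 0"
  using adjacency loops unfolding adjacency_matrix_def all_loops_def verts by blast

lemma column_sum: "q \<in> I \<Longrightarrow> (\<Sum>p\<in>I. A $ p $ q) = 1"
  using stochastic by (simp add: column_stochastic_on_def)

lemma w_pos: "p \<in> I \<Longrightarrow> w $ p > 0"
  and A_w: "p \<in> I \<Longrightarrow> (\<Sum>q\<in>I. A $ p $ q * w $ q) = w $ p"
  and sum_w: "(\<Sum>p\<in>I. w $ p) = 1"
  using perron by (simp_all add: perron_vector_on_def)

lemma b_pos: "p \<in> I \<Longrightarrow> b $ p > 0"
  by (simp add: b_eq m_pos w_pos)

lemma constant_along_arcs_imp_constant:
  assumes "\<And>p q. p \<in> I \<Longrightarrow> q \<in> I \<Longrightarrow> A $ p $ q > 0 \<Longrightarrow> c q = c p"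
    and "p \<in> I" "q \<in> I"
  shows "c q = c p"
proof -
  have "q \<rightarrow>\<^sup>*\<^bsub>with_proj H\<^esub> p"
    using connected assms(2,3) by (simp add: strongly_connected_def verts)
  then have "(q, p) \<in> rtrancl_on I (parcs H)"
    by (simp add: reachable_def verts)
  then show ?thesis
  proof (induction rule: rtrancl_on_induct)
    case (step y z)
    then have "A $ z $ y > 0" using adjacency by (simp add: adjacency_matrix_def)
    then show ?case using assms(1)[of z y] step by simp
  qed simp
qed

text \<open>
  The mean square of \<open>c\<close> under \<open>w\<close> exceeds that of its averages by the variances inside the rows:
  row \<open>p\<close> averages \<open>c\<close> with the weights \<open>A $ p $ q * w $ q\<close>, whose sum is \<open>w $ p\<close> since \<open>w\<close> is fixed by
  \<open>A\<close>, while the columns of \<open>A\<close> sum to \<open>1\<close>.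
\<close>

lemma variance_identity:
  "(\<Sum>q\<in>I. w $ q * (c q)\<^sup>2) - (\<Sum>p\<in>I. (\<Sum>q\<in>I. A $ p $ q * w $ q * c q)\<^sup>2 / w $ p)
    = (\<Sum>p\<in>I. \<Sum>q\<in>I. A $ p $ q * w $ q * (c q - (\<Sum>r\<in>I. A $ p $ r * w $ r * c r) / w $ p)\<^sup>2)"
proof -
  define s where "s p = (\<Sum>q\<in>I. A $ p $ q * w $ q * c q)" for p
  have "(\<Sum>q\<in>I. A $ p $ q * w $ q * (c q - s p / w $ p)\<^sup>2)
      = (\<Sum>q\<in>I. A $ p $ q * w $ q * (c q)\<^sup>2) - (s p)\<^sup>2 / w $ p" if p: "p \<in> I" for p
  proof -
    have "(\<Sum>q\<in>I. A $ p $ q * w $ q * (c q - s p / w $ p)\<^sup>2)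
        = (\<Sum>q\<in>I. A $ p $ q * w $ q * (c q)\<^sup>2 - 2 * (s p / w $ p) * (A $ p $ q * w $ q * c q)
             + (s p / w $ p)\<^sup>2 * (A $ p $ q * w $ q))"
      by (intro sum.cong refl) (simp add: power2_eq_square algebra_simps)
    also have "\<dots> = (\<Sum>q\<in>I. A $ p $ q * w $ q * (c q)\<^sup>2) - 2 * (s p / w $ p) * s p
             + (s p / w $ p)\<^sup>2 * w $ p"
      by (simp only: sum.distrib sum_subtractf sum_distrib_left[symmetric] s_def[symmetric] A_w[OF p])
    also have "\<dots> = (\<Sum>q\<in>I. A $ p $ q * w $ q * (c q)\<^sup>2) - (s p)\<^sup>2 / w $ p"
      using w_pos[OF p] by (simp add: power2_eq_square field_simps)
    finally show ?thesis .
  qed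
  then have "(\<Sum>p\<in>I. \<Sum>q\<in>I. A $ p $ q * w $ q * (c q - s p / w $ p)\<^sup>2)
      = (\<Sum>p\<in>I. \<Sum>q\<in>I. A $ p $ q * (w $ q * (c q)\<^sup>2)) - (\<Sum>p\<in>I. (s p)\<^sup>2 / w $ p)"
    by (simp add: sum_subtractf mult.assoc)
  also have "(\<Sum>p\<in>I. \<Sum>q\<in>I. A $ p $ q * (w $ q * (c q)\<^sup>2))
      = (\<Sum>q\<in>I. (\<Sum>p\<in>I. A $ p $ q) * (w $ q * (c q)\<^sup>2))"
    by (subst sum.swap) (simp add: sum_distrib_right)
  also have "\<dots> = (\<Sum>q\<in>I. w $ q * (c q)\<^sup>2)" by (simp add: column_sum)
  finally show ?thesis by (simp add: s_def)
qed

text \<open>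
  If no variance is lost, then \<open>c\<close> is constant on the set of in-neighbours of every vertex. Because of
  the loops this set contains the vertex itself, so \<open>c\<close> is constant along arcs.
\<close>

lemma averaging_strictly_contracts:
  assumes "p \<in> I" "q \<in> I" "c p \<noteq> c q"
  shows "(\<Sum>p\<in>I. (\<Sum>q\<in>I. A $ p $ q * w $ q * c q)\<^sup>2 / w $ p) < (\<Sum>q\<in>I. w $ q * (c q)\<^sup>2)"
proof (rule ccontr)
  define M where "M p = (\<Sum>r\<in>I. A $ p $ r * w $ r * c r) / w $ p" for p
  have nonneg: "A $ p $ q * w $ q * (c q - M p)\<^sup>2 \<ge> 0" if "q \<in> I" for p q
    using A_nonneg w_pos[OF that] by (simp add: less_imp_le)
  assume "\<not> ?thesis"
  then have "(\<Sum>p\<in>I. \<Sum>q\<in>I. A $ p $ q * w $ q * (c q - M p)\<^sup>2) \<le> 0"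
    using variance_identity[of c] by (simp add: M_def)
  moreover have "(\<Sum>p\<in>I. \<Sum>q\<in>I. A $ p $ q * w $ q * (c q - M p)\<^sup>2) \<ge> 0"
    by (intro sum_nonneg nonneg)
  ultimately have "(\<Sum>p\<in>I. \<Sum>q\<in>I. A $ p $ q * w $ q * (c q - M p)\<^sup>2) = 0" by linarith
  then have "\<forall>p\<in>I. (\<Sum>q\<in>I. A $ p $ q * w $ q * (c q - M p)\<^sup>2) = 0"
    by (subst (asm) sum_nonneg_eq_0_iff) (auto intro!: sum_nonneg nonneg)
  then have "\<forall>p\<in>I. \<forall>q\<in>I. A $ p $ q * w $ q * (c q - M p)\<^sup>2 = 0"
    using nonneg by (simp add: sum_nonneg_eq_0_iff)
  then have eq: "c q = M p" if "p \<in> I" "q \<in> I" "A $ p $ q > 0" for p q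
    using that w_pos[of q] by fastforce
  have "c q = c p" if "p \<in> I" "q \<in> I" "A $ p $ q > 0" for p q
    using eq[OF that] eq[OF that(1) that(1) A_diag_pos[OF that(1)]] by simp
  from constant_along_arcs_imp_constant[of c, OF this assms(1,2)] assms(3) show False by simp
qed

text \<open>
  The product of the Perron vector and the row of ones, padded with zeros; it turns out to be the limit
  of the powers of \<open>A\<close>.
\<close>

definition W :: "real ^ 'v ^ 'v" where
  "W = (\<chi> p q. if p \<in> I \<and> q \<in> I then w $ p else 0)"

lemma W_mult: "p \<in> I \<Longrightarrow> (W *v u) $ p = w $ p * (\<Sum>q\<in>I. u $ q)"
  unfolding matrix_vector_mult_def W_def
  by (simp add: sum_distrib_left if_distrib[of "\<lambda>x. x * _"] sum.If_cases cong: if_cong)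

lemma A_mult: "(A *v u) $ p = (\<Sum>q\<in>I. A $ p $ q * u $ q)"
  unfolding matrix_vector_mult_def using A_outside
  by (simp, intro sum.mono_neutral_right) auto

text \<open>
  With \<open>u = diag(sqrt b) v\<close> and \<open>c = u / w - s\<close>, where \<open>s\<close> is the sum of \<open>u\<close>, the matrix acts on \<open>v\<close> by
  averaging \<open>c\<close>, whose mean square is at most that of \<open>u / w\<close>. Averaging strictly reduces the mean
  square unless \<open>c\<close> is constant; a constant \<open>c\<close> vanishes, as its mean under \<open>w\<close> is zero, and so does the
  image of \<open>v\<close>.
\<close>

lemma deviation_contracts:
  "weighted_matrix_norm I b (A - W) < 1"
  unfolding weighted_matrix_norm_def
proof (rule onorm_less_if_pointwise_less[OF matrix_vector_mul_bounded_linear])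
  fix v :: "real ^ 'v" assume v0: "v \<noteq> 0"
  let ?B = "\<chi> p q. if p \<in> I \<and> q \<in> I then inverse (sqrt (b $ p)) * (A - W) $ p $ q * sqrt (b $ q) else 0"
  define u where "u q = sqrt (b $ q) * v $ q" for q
  define s where "s = (\<Sum>q\<in>I. u q)"
  \<comment> \<open>The part of \<open>u / w\<close> that is orthogonal to the constants for the weight \<open>w\<close>.\<close>
  define c where "c q = u q / w $ q - s" for q
  have wc: "w $ q * c q = u q - s * w $ q" if "q \<in> I" for q
    using w_pos[OF that] by (simp add: c_def field_simps)
  have sum_wc: "(\<Sum>q\<in>I. w $ q * c q) = 0"
    by (simp add: wc sum_subtractf s_def sum_w flip: sum_distrib_left)
  have Ac: "(\<Sum>q\<in>I. A $ p $ q * w $ q * c q) = (\<Sum>q\<in>I. (A $ p $ q - w $ p) * u q)" if "p \<in> I" for p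
  proof -
    have "(\<Sum>q\<in>I. A $ p $ q * w $ q * c q) = (\<Sum>q\<in>I. A $ p $ q * u q - s * (A $ p $ q * w $ q))"
      by (intro sum.cong refl) (simp add: mult.assoc wc right_diff_distrib mult.left_commute[of s])
    also have "\<dots> = (\<Sum>q\<in>I. A $ p $ q * u q) - s * w $ p"
      by (simp only: sum_subtractf sum_distrib_left[symmetric] A_w[OF that])
    also have "\<dots> = (\<Sum>q\<in>I. (A $ p $ q - w $ p) * u q)"
    proof -
      have "(\<Sum>q\<in>I. w $ p * u q) = s * w $ p"
        by (simp add: s_def sum_distrib_left mult.commute)
      then show ?thesis by (simp add: left_diff_distrib sum_subtractf)
    qed
    finally show ?thesis .
  qed
  have Bv: "?B *v v = (\<chi> p. if p \<in> I then (\<Sum>q\<in>I. A $ p $ q * w $ q * c q) / sqrt (b $ p) else 0)"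
  proof (subst Finite_Cartesian_Product.vec_eq_iff, intro allI)
    fix p
    have "(?B *v v) $ p = (\<Sum>q\<in>I. (A $ p $ q - w $ p) * u q) / sqrt (b $ p)" if "p \<in> I"
    proof -
      have "(?B *v v) $ p = (\<Sum>q\<in>I. inverse (sqrt (b $ p)) * (A $ p $ q - w $ p) * sqrt (b $ q) * v $ q)"
        unfolding matrix_vector_mult_def using that
        by (auto intro!: sum.mono_neutral_cong_right simp: W_def)
      then show ?thesis by (simp add: sum_divide_distrib u_def field_simps)
    qed
    then show "(?B *v v) $ p = (\<chi> p. if p \<in> I then (\<Sum>q\<in>I. A $ p $ q * w $ q * c q) / sqrt (b $ p) else 0) $ p"
      by (simp add: Ac) (simp add: matrix_vector_mult_def)
  qed
  have norm_Bv: "(norm (?B *v v))\<^sup>2 = (\<Sum>p\<in>I. (\<Sum>q\<in>I. A $ p $ q * w $ q * c q)\<^sup>2 / w $ p) / m"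
  proof -
    have "(norm (?B *v v))\<^sup>2 = (\<Sum>p\<in>I. ((\<Sum>q\<in>I. A $ p $ q * w $ q * c q) / sqrt (b $ p))\<^sup>2)"
      unfolding Bv norm_padded by (simp add: L2_set_def sum_nonneg)
    also have "\<dots> = (\<Sum>p\<in>I. (\<Sum>q\<in>I. A $ p $ q * w $ q * c q)\<^sup>2 / w $ p / m)"
      using b_pos by (intro sum.cong refl) (simp add: power_divide less_imp_le b_eq field_simps)
    finally show ?thesis by (simp add: sum_divide_distrib)
  qed
  have "(\<Sum>q\<in>I. w $ q * (c q)\<^sup>2) / m \<le> (norm v)\<^sup>2"
  proof -
    have "m * (v $ q)\<^sup>2 = w $ q * (c q + s)\<^sup>2" if "q \<in> I" for q
    proof -
      have "w $ q * (c q + s)\<^sup>2 = (u q)\<^sup>2 / w $ q"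
        using w_pos[OF that] by (simp add: c_def power2_eq_square)
      also have "\<dots> = m * (v $ q)\<^sup>2"
        using w_pos[OF that] m_pos by (simp add: u_def power_mult_distrib b_eq[OF that])
      finally show ?thesis by simp
    qed
    then have "(\<Sum>q\<in>I. m * (v $ q)\<^sup>2) = (\<Sum>q\<in>I. w $ q * (c q)\<^sup>2 + 2 * s * (w $ q * c q) + s\<^sup>2 * w $ q)"
      by (intro sum.cong refl) (simp add: power2_eq_square algebra_simps)
    also have "\<dots> = (\<Sum>q\<in>I. w $ q * (c q)\<^sup>2) + s\<^sup>2"
      by (simp only: sum.distrib sum_distrib_left[symmetric] sum_wc sum_w mult_zero_right add_0_right mult_1_right)
    finally have "(\<Sum>q\<in>I. w $ q * (c q)\<^sup>2) \<le> m * (\<Sum>q\<in>I. (v $ q)\<^sup>2)"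
      by (simp add: sum_distrib_left)
    also have "\<dots> \<le> m * (\<Sum>q\<in>UNIV. (v $ q)\<^sup>2)"
      using m_pos by (intro mult_left_mono sum_mono2) auto
    finally have "(\<Sum>q\<in>I. w $ q * (c q)\<^sup>2) \<le> m * (norm v)\<^sup>2"
      by (simp add: norm_vec_def L2_set_def sum_nonneg)
    then show ?thesis using m_pos by (simp add: divide_le_eq mult.commute)
  qed
  moreover have "(norm (?B *v v))\<^sup>2 < (norm v)\<^sup>2 \<or> (norm (?B *v v))\<^sup>2 < (\<Sum>q\<in>I. w $ q * (c q)\<^sup>2) / m"
  proof (cases "\<exists>p\<in>I. \<exists>q\<in>I. c p \<noteq> c q")
    case True
    then obtain p q where "p \<in> I" "q \<in> I" "c p \<noteq> c q" by blast
    from divide_strict_right_mono[OF averaging_strictly_contracts[of p q c, OF this] m_pos]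
    show ?thesis unfolding norm_Bv by blast
  next
    case False
    have "c p = 0" if p: "p \<in> I" for p
    proof -
      have "(\<Sum>q\<in>I. w $ q * c q) = (\<Sum>q\<in>I. w $ q * c p)" using False p by (intro sum.cong refl) metis
      also have "\<dots> = c p" by (simp add: sum_w flip: sum_distrib_right)
      finally show ?thesis using sum_wc by simp
    qed
    then have "(norm (?B *v v))\<^sup>2 = 0" unfolding norm_Bv by simp
    then show ?thesis using v0 by simp
  qed
  ultimately have "(norm (?B *v v))\<^sup>2 < (norm v)\<^sup>2" by linarith
  then show "norm (?B *v v) < norm v" by (rule power2_less_imp_less) simp
qed

lemma A_minus_W_outside: "p \<in> I \<Longrightarrow> q \<notin> I \<Longrightarrow> (A - W) $ p $ q = 0"
  by (simp add: A_outside W_def)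

text \<open>
  Since \<open>A\<close> preserves sums and fixes \<open>w\<close>, the deviation of \<open>h\<close> from its sum times \<open>w\<close> is mapped by
  \<open>A - W\<close>. The perturbation enters without a constant because \<open>W\<close> is an orthogonal projection for the
  inner product weighted by \<open>1 / b\<close>.
\<close>

lemma tracking_step:
  assumes h': "\<And>p. p \<in> I \<Longrightarrow> h' $ p = (\<Sum>q\<in>I. A $ p $ q * h $ q) + d $ p"
  shows "weighted_norm I b (h' - W *v h')
    \<le> weighted_matrix_norm I b (A - W) * weighted_norm I b (h - W *v h) + weighted_norm I b d"
proof -
  define s where "s = (\<Sum>q\<in>I. h $ q)"
  have sum_Ah: "(\<Sum>p\<in>I. \<Sum>q\<in>I. A $ p $ q * h $ q) = s"
    unfolding s_def by (subst sum.swap) (simp add: column_sum flip: sum_distrib_right)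
  have dev: "((A - W) *v (h - W *v h)) $ p = (\<Sum>q\<in>I. A $ p $ q * h $ q) - w $ p * s" if p: "p \<in> I" for p
  proof -
    have "(\<Sum>q\<in>I. A $ p $ q * (h - W *v h) $ q) = (\<Sum>q\<in>I. A $ p $ q * h $ q - s * (A $ p $ q * w $ q))"
      by (intro sum.cong refl) (simp add: W_mult s_def algebra_simps)
    also have "\<dots> = (\<Sum>q\<in>I. A $ p $ q * h $ q) - w $ p * s"
      by (simp only: sum_subtractf sum_distrib_left[symmetric] A_w[OF p]) simp
    finally have 1: "(A *v (h - W *v h)) $ p = (\<Sum>q\<in>I. A $ p $ q * h $ q) - w $ p * s"
      by (simp only: A_mult)
    have "(\<Sum>q\<in>I. (h - W *v h) $ q) = s - (\<Sum>q\<in>I. w $ q) * s"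
      by (simp add: W_mult s_def sum_subtractf sum_distrib_right)
    then have "(W *v (h - W *v h)) $ p = 0" by (simp add: W_mult[OF p] sum_w)
    with 1 show ?thesis by (simp add: matrix_vector_mult_diff_rdistrib)
  qed
  have "weighted_norm I b (h' - W *v h') = weighted_norm I b ((A - W) *v (h - W *v h) + (d - W *v d))"
  proof (rule weighted_norm_cong)
    fix p assume p: "p \<in> I"
    have sum_h': "(\<Sum>q\<in>I. h' $ q) = s + (\<Sum>q\<in>I. d $ q)" by (simp add: h' sum.distrib sum_Ah)
    show "(h' - W *v h') $ p = ((A - W) *v (h - W *v h) + (d - W *v d)) $ p"
      unfolding vector_add_component dev[OF p] vector_minus_component W_mult[OF p] sum_h' h'[OF p]
      by (simp add: algebra_simps)
  qed
  also have "\<dots> \<le> weighted_norm I b ((A - W) *v (h - W *v h)) + weighted_norm I b (d - W *v d)"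
    by (rule weighted_norm_add_le)
  also have "weighted_norm I b ((A - W) *v (h - W *v h))
      \<le> weighted_matrix_norm I b (A - W) * weighted_norm I b (h - W *v h)"
    by (intro weighted_matrix_norm_compatible b_pos A_minus_W_outside)
  also have "weighted_norm I b (d - W *v d) \<le> weighted_norm I b d"
  proof (rule power2_le_imp_le)
    define r where "r = (\<Sum>q\<in>I. d $ q)"
    have "(weighted_norm I b (d - W *v d))\<^sup>2 = (\<Sum>p\<in>I. (d $ p - w $ p * r)\<^sup>2 / b $ p)"
      by (simp add: weighted_norm_sq b_pos W_mult r_def)
    also have "\<dots> = (\<Sum>p\<in>I. (d $ p)\<^sup>2 / b $ p - 2 * r / m * d $ p + r\<^sup>2 / m * w $ p)"
    proof (intro sum.cong refl)
      fix p assume p: "p \<in> I"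
      show "(d $ p - w $ p * r)\<^sup>2 / b $ p = (d $ p)\<^sup>2 / b $ p - 2 * r / m * d $ p + r\<^sup>2 / m * w $ p"
        unfolding b_eq[OF p] using w_pos[OF p] m_pos by (simp add: power2_eq_square field_simps)
    qed
    also have "\<dots> = (\<Sum>p\<in>I. (d $ p)\<^sup>2 / b $ p) - 2 * r / m * r + r\<^sup>2 / m"
      by (simp only: sum.distrib sum_subtractf sum_distrib_left[symmetric] sum_w r_def[symmetric] mult_1_right)
    also have "\<dots> \<le> (\<Sum>p\<in>I. (d $ p)\<^sup>2 / b $ p)" using m_pos by (simp add: power2_eq_square)
    also have "\<dots> = (weighted_norm I b d)\<^sup>2" by (simp add: weighted_norm_sq b_pos)
    finally show "(weighted_norm I b (d - W *v d))\<^sup>2 \<le> (weighted_norm I b d)\<^sup>2" .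
  qed (rule weighted_norm_nonneg)
  finally show ?thesis by simp
qed

text \<open>
  Each column of a power of \<open>A\<close> that belongs to the block has sum \<open>1\<close>, so its deviation from \<open>w\<close> shrinks
  by the contraction factor in every step. Outside the block all powers except the zeroth vanish.
\<close>

lemma limit_matrix_eq: "limit_matrix A = W"
proof -
  define \<sigma> where "\<sigma> = weighted_matrix_norm I b (A - W)"
  have \<sigma>: "0 \<le> \<sigma>" "\<sigma> < 1" by (simp_all add: \<sigma>_def weighted_matrix_norm_nonneg deviation_contracts)
  have power_Suc: "matrix_power A (Suc k) = A ** matrix_power A k" for k
    by (simp add: matrix_power_def)
  have step: "column q (matrix_power A (Suc k)) $ p = (\<Sum>r\<in>I. A $ p $ r * column q (matrix_power A k) $ r)" for q k p
    unfolding power_Suc using A_mult[of "column q (matrix_power A k)" p]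
    by (simp add: column_def matrix_matrix_mult_def matrix_vector_mult_def)
  have col_sum: "(\<Sum>p\<in>I. column q (matrix_power A k) $ p) = 1" if "q \<in> I" for q k
  proof (induction k)
    case 0
    then show ?case using that by (simp add: matrix_power_def column_def Finite_Cartesian_Product.mat_def)
  next
    case (Suc k)
    have "(\<Sum>p\<in>I. column q (matrix_power A (Suc k)) $ p)
        = (\<Sum>r\<in>I. (\<Sum>p\<in>I. A $ p $ r) * column q (matrix_power A k) $ r)"
      unfolding step by (subst sum.swap) (simp add: sum_distrib_right)
    then show ?case using Suc by (simp add: column_sum)
  qed
  have inside: "(\<lambda>k. matrix_power A k $ p $ q) \<longlonglongrightarrow> w $ p" if p: "p \<in> I" and q: "q \<in> I" for p q
  proof -
    define e where "e k = weighted_norm I b (column q (matrix_power A k) - W *v column q (matrix_power A k))" for k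
    have e_le: "e k \<le> \<sigma> ^ k * e 0" for k
    proof (induction k)
      case (Suc k)
      have "e (Suc k) \<le> \<sigma> * e k"
        using tracking_step[of "column q (matrix_power A (Suc k))" "column q (matrix_power A k)" 0]
        by (simp add: step e_def \<sigma>_def weighted_norm_def L2_set_def)
      also have "\<dots> \<le> \<sigma> * (\<sigma> ^ k * e 0)" using Suc \<sigma> by (intro mult_left_mono) auto
      finally show ?case by (simp add: mult_ac)
    qed simp
    have e_ge: "\<bar>matrix_power A k $ p $ q - w $ p\<bar> \<le> sqrt (b $ p) * e k" for k
    proof -
      define z where "z = column q (matrix_power A k) - W *v column q (matrix_power A k)"
      have "\<bar>z $ p / sqrt (b $ p)\<bar> \<le> L2_set (\<lambda>p. \<bar>z $ p / sqrt (b $ p)\<bar>) I"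
        using p by (intro member_le_L2_set) auto
      also have "\<dots> = L2_set (\<lambda>p. z $ p / sqrt (b $ p)) I" unfolding L2_set_def power2_abs ..
      also have "\<dots> = e k" by (simp add: e_def z_def weighted_norm_def)
      finally have "\<bar>z $ p\<bar> \<le> sqrt (b $ p) * e k"
        using b_pos[OF p] by (simp add: divide_le_eq mult.commute)
      moreover have "z $ p = matrix_power A k $ p $ q - w $ p"
        by (simp add: z_def W_mult[OF p] col_sum[OF q]) (simp add: column_def)
      ultimately show ?thesis by simp
    qed
    have "norm (matrix_power A k $ p $ q - w $ p) \<le> sqrt (b $ p) * (\<sigma> ^ k * e 0)" for k
    proof -
      have "sqrt (b $ p) * e k \<le> sqrt (b $ p) * (\<sigma> ^ k * e 0)"
        using b_pos[OF p] by (intro mult_left_mono e_le) simp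
      with e_ge[of k] show ?thesis by simp
    qed
    then have "\<forall>\<^sub>F k in sequentially. norm (matrix_power A k $ p $ q - w $ p) \<le> sqrt (b $ p) * (\<sigma> ^ k * e 0)"
      by simp
    moreover have "(\<lambda>k. sqrt (b $ p) * (\<sigma> ^ k * e 0)) \<longlonglongrightarrow> 0"
      by (intro tendsto_mult_right_zero tendsto_mult_left_zero LIMSEQ_realpow_zero \<sigma>)
    ultimately have "(\<lambda>k. matrix_power A k $ p $ q - w $ p) \<longlonglongrightarrow> 0"
      by (rule Lim_null_comparison)
    then show ?thesis by (rule LIM_zero_cancel)
  qed
  have outside: "(\<lambda>k. matrix_power A k $ p $ q) \<longlonglongrightarrow> 0" if pq: "p \<notin> I \<or> q \<notin> I" for p q
  proof -
    have "matrix_power A (Suc k) $ p $ q = 0" for k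
    proof (cases "p \<in> I")
      case False
      then have "column q (matrix_power A (Suc k)) $ p = 0"
        unfolding step by (intro sum.neutral) (simp add: A_outside)
      then show ?thesis by (simp add: column_def)
    next
      case True
      then have q: "q \<notin> I" using pq by simp
      have "\<forall>p\<in>I. matrix_power A k $ p $ q = 0" for k
      proof (induction k)
        case 0
        then show ?case using q by (auto simp: matrix_power_def Finite_Cartesian_Product.mat_def)
      next
        case (Suc k)
        then have "column q (matrix_power A (Suc k)) $ p = 0" for p
          unfolding step by (intro sum.neutral) (simp add: column_def)
        then show ?case by (simp add: column_def)
      qed
      then show ?thesis using True by blast
    qed
    then have "(\<lambda>k. matrix_power A (Suc k) $ p $ q) \<longlonglongrightarrow> 0" by simp
    then show ?thesis by (rule LIMSEQ_imp_Suc)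
  qed
  have "matrix_power A \<longlonglongrightarrow> W"
    using inside outside by (intro vec_tendstoI) (auto simp: W_def)
  then show ?thesis unfolding limit_matrix_def by (rule limI)
qed

end

section \<open>The monotone hull of a norm\<close>

text \<open>
  The least value of \<open>f\<close> on vectors that dominate \<open>\<bar>v\<bar>\<close> entrywise. For a norm \<open>f\<close> this is again a norm,
  and it is monotone in the absolute values of the coordinates.
\<close>

definition monotone_hull :: "(real ^ 'n \<Rightarrow> real) \<Rightarrow> real ^ 'n \<Rightarrow> real" where
  "monotone_hull f v = Inf (f ` {u. \<forall>p. \<bar>v $ p\<bar> \<le> u $ p})"

context
  fixes f :: "real ^ 'n::finite \<Rightarrow> real"
  assumes f: "is_norm f"
begin

lemma is_norm_nonneg: "f u \<ge> 0"
  using f unfolding is_norm_def by blast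

lemma is_norm_triangle: "f (u + v) \<le> f u + f v"
  using f unfolding is_norm_def by blast

lemma monotone_hull_le: "(\<And>p. \<bar>v $ p\<bar> \<le> u $ p) \<Longrightarrow> monotone_hull f v \<le> f u"
  unfolding monotone_hull_def by (intro cInf_lower bdd_belowI2[of _ 0] is_norm_nonneg) simp

lemma monotone_hull_greatest:
  assumes "\<And>u. (\<And>p. \<bar>v $ p\<bar> \<le> u $ p) \<Longrightarrow> c \<le> f u"
  shows "c \<le> monotone_hull f v"
proof -
  have "(\<chi> p. \<bar>v $ p\<bar>) \<in> {u. \<forall>p. \<bar>v $ p\<bar> \<le> u $ p}" by simp
  then have "{u. \<forall>p. \<bar>v $ p\<bar> \<le> u $ p} \<noteq> {}" by (metis empty_iff)
  then show ?thesis unfolding monotone_hull_def using assms by (intro cINF_greatest) simp_all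
qed

lemma monotone_hull_nonneg: "monotone_hull f v \<ge> 0"
  by (intro monotone_hull_greatest is_norm_nonneg)

lemma monotone_hull_minus: "monotone_hull f (- v) = monotone_hull f v"
  by (simp add: monotone_hull_def)

lemma monotone_hull_add: "monotone_hull f (u + v) \<le> monotone_hull f u + monotone_hull f v"
proof -
  have "monotone_hull f (u + v) - f v' \<le> monotone_hull f u" if v': "\<And>p. \<bar>v $ p\<bar> \<le> v' $ p" for v'
  proof (rule monotone_hull_greatest)
    fix u' assume u': "\<And>p. \<bar>u $ p\<bar> \<le> u' $ p"
    have "monotone_hull f (u + v) \<le> f (u' + v')"
    proof (rule monotone_hull_le)
      fix p
      show "\<bar>(u + v) $ p\<bar> \<le> (u' + v') $ p"
        using u'[of p] v'[of p] by (simp add: abs_le_iff)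
    qed
    also have "\<dots> \<le> f u' + f v'" by (rule is_norm_triangle)
    finally show "monotone_hull f (u + v) - f v' \<le> f u'" by simp
  qed
  then have "monotone_hull f (u + v) - monotone_hull f u \<le> monotone_hull f v"
    by (intro monotone_hull_greatest) (simp add: algebra_simps)
  then show ?thesis by simp
qed

lemma monotone_hull_diff: "monotone_hull f (u - v) \<le> monotone_hull f u + monotone_hull f v"
  using monotone_hull_add[of u "- v"] by (simp add: monotone_hull_minus)

lemma monotone_hull_lower:
  assumes "C \<ge> 0" "\<And>u. C * norm u \<le> f u"
  shows "C * norm v \<le> monotone_hull f v"
proof (rule monotone_hull_greatest)
  fix u assume u: "\<And>p. \<bar>v $ p\<bar> \<le> u $ p"
  have "norm v \<le> norm u"
  proof (rule norm_le_componentwise_cart)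
    fix p show "norm (v $ p) \<le> norm (u $ p)" using u[of p] by simp
  qed
  then have "C * norm v \<le> C * norm u" using assms(1) by (rule mult_left_mono)
  with assms(2)[of u] show "C * norm v \<le> f u" by simp
qed

lemma monotone_hull_upper:
  assumes "\<And>u. f u \<le> C * norm u"
  shows "monotone_hull f v \<le> C * norm v"
proof -
  have "norm (\<chi> p. \<bar>v $ p\<bar>) = norm v" by (simp add: norm_vec_def)
  then show ?thesis using monotone_hull_le[of v "\<chi> p. \<bar>v $ p\<bar>"] assms[of "\<chi> p. \<bar>v $ p\<bar>"] by simp
qed

text \<open>
  If \<open>u\<close> dominates \<open>\<bar>v\<bar>\<close>, then \<open>P *v u\<close> dominates \<open>\<bar>B *v v\<bar>\<close>; so a contraction by the nonnegative
  matrix \<open>P\<close> in \<open>f\<close> becomes a contraction by every matrix with entries bounded by those of \<open>P\<close>.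
\<close>

lemma monotone_hull_contraction:
  assumes B: "\<And>p q. \<bar>B $ p $ q\<bar> \<le> P $ p $ q" and P: "\<And>u. f (P *v u) \<le> \<sigma> * f u" and "\<sigma> \<ge> 0"
  shows "monotone_hull f (B *v v) \<le> \<sigma> * monotone_hull f v"
proof -
  have le: "monotone_hull f (B *v v) \<le> \<sigma> * f u" if u: "\<And>p. \<bar>v $ p\<bar> \<le> u $ p" for u
  proof -
    have "monotone_hull f (B *v v) \<le> f (P *v u)"
    proof (rule monotone_hull_le)
      fix p
      have "\<bar>(B *v v) $ p\<bar> \<le> (\<Sum>q\<in>UNIV. \<bar>B $ p $ q * v $ q\<bar>)"
        by (simp add: matrix_vector_mult_def)
      also have "\<dots> \<le> (\<Sum>q\<in>UNIV. P $ p $ q * u $ q)"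
        unfolding abs_mult by (intro sum_mono mult_mono' B u) auto
      finally show "\<bar>(B *v v) $ p\<bar> \<le> (P *v u) $ p" by (simp add: matrix_vector_mult_def)
    qed
    with P[of u] show ?thesis by simp
  qed
  show ?thesis
  proof (cases "\<sigma> = 0")
    case True
    then show ?thesis using le[of "\<chi> p. \<bar>v $ p\<bar>"] by simp
  next
    case False
    then have "monotone_hull f (B *v v) / \<sigma> \<le> monotone_hull f v"
      using \<open>\<sigma> \<ge> 0\<close> le by (intro monotone_hull_greatest) (simp add: divide_le_eq mult.commute)
    then show ?thesis using False \<open>\<sigma> \<ge> 0\<close> by (simp add: divide_le_eq mult.commute)
  qed
qed

end

section \<open>Gradients of a cluster game\<close>

lemma sum_by_cluster:
  fixes cl :: "'v::finite \<Rightarrow> 'c::finite"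
  shows "(\<Sum>p\<in>UNIV. h p) = (\<Sum>i\<in>UNIV. \<Sum>p\<in>cluster cl i. h p)"
  using sum.group[of "UNIV :: 'v set" "UNIV :: 'c set" cl h] by (simp add: cluster_def)

lemma sum_by_cluster_dependent:
  fixes cl :: "'v::finite \<Rightarrow> 'c::finite"
  shows "(\<Sum>p\<in>UNIV. h (cl p) p) = (\<Sum>i\<in>UNIV. \<Sum>p\<in>cluster cl i. h i p)"
  unfolding sum_by_cluster[of _ cl] by (intro sum.cong refl) (simp add: cluster_def)

locale smooth_cluster_game =
  fixes cl :: "'v::finite \<Rightarrow> 'c::finite" and J :: "'v \<Rightarrow> real ^ 'v \<Rightarrow> real" and L :: real
  assumes J_C1: "\<And>p. continuously_differentiable_in_block (cluster cl (cl p)) (J p)"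
    and J_lipschitz: "\<And>p k. k \<in> cluster cl (cl p) \<Longrightarrow> L-lipschitz_on UNIV (partial_deriv k (J p))"
begin

abbreviation peers :: "'v \<Rightarrow> 'v set" where "peers k \<equiv> cluster cl (cl k)"

abbreviation csize :: "'v \<Rightarrow> real" where "csize k \<equiv> real (card (peers k))"

abbreviation F :: "real ^ 'v \<Rightarrow> real ^ 'v" where "F \<equiv> game_mapping cl J"

definition aggregate :: "real ^ 'v ^ 'v \<Rightarrow> 'v \<Rightarrow> real" where
  "aggregate Y k = (\<Sum>l\<in>peers k. partial_deriv k (J l) (Y $ l))"

lemma self_peer: "k \<in> peers k"
  by (simp add: cluster_def)

lemma csize_pos: "csize k > 0"
  using self_peer[of k] by (auto simp: card_gt_0_iff)

lemma L_nonneg: "L \<ge> 0"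
  using J_lipschitz[OF self_peer] by (rule lipschitz_on_nonneg)

text \<open>
  Along the coordinate of a member \<open>k\<close> of the same cluster the argument stays in the block, so
  smoothness in the block suffices for the derivative to exist.
\<close>

lemma J_has_partial_deriv:
  assumes "l \<in> peers k"
  shows "((\<lambda>h. J l (x + h *\<^sub>R axis k 1)) has_real_derivative partial_deriv k (J l) x) (at 0)"
proof -
  let ?f = "\<lambda>u. J l (replace_on (peers l) u x)" and ?line = "\<lambda>h :: real. x + h *\<^sub>R axis k 1"
  obtain f' where "(?f has_derivative blinfun_apply f') (at (?line 0))"
    using J_C1[of l] unfolding continuously_differentiable_in_block_def continuously_differentiable_def
    by blast
  moreover have "(?line has_derivative (\<lambda>h. h *\<^sub>R axis k 1)) (at 0)"
    by (auto intro!: derivative_eq_intros)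
  ultimately have "((\<lambda>h. ?f (?line h)) has_derivative (\<lambda>h. f' (h *\<^sub>R axis k 1))) (at 0)"
    by (rule has_derivative_compose[rotated])
  moreover have "?f (?line h) = J l (?line h)" for h
  proof -
    have "replace_on (peers l) (?line h) x = ?line h"
      using assms by (auto simp: replace_on_def Finite_Cartesian_Product.vec_eq_iff axis_def cluster_def)
    then show ?thesis by simp
  qed
  ultimately have "(\<lambda>h. J l (?line h)) differentiable at 0"
    unfolding differentiable_def by auto
  then show ?thesis
    unfolding partial_deriv_def by (simp add: DERIV_deriv_iff_real_differentiable)
qed

lemma cost_has_partial_deriv:
  "((\<lambda>h. cluster_cost cl J (cl k) (x + h *\<^sub>R axis k 1)) has_real_derivative
     (\<Sum>l\<in>peers k. partial_deriv k (J l) x) / csize k) (at 0)"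
  unfolding cluster_cost_def
  by (intro DERIV_cdivide DERIV_sum J_has_partial_deriv)

lemma csize_F: "csize k * F x $ k = (\<Sum>l\<in>peers k. partial_deriv k (J l) x)"
proof -
  have "F x $ k = (\<Sum>l\<in>peers k. partial_deriv k (J l) x) / csize k"
    unfolding game_mapping_def partial_deriv_def[of k "cluster_cost cl J (cl k)"] vec_lambda_beta
    by (rule DERIV_imp_deriv[OF cost_has_partial_deriv])
  then show ?thesis using csize_pos[of k] by simp
qed

lemma F_zero_at_nash:
  assumes "nash_equilibrium cl J xs"
  shows "F xs = 0"
proof (subst Finite_Cartesian_Product.vec_eq_iff, intro allI)
  fix k
  have "cluster_cost cl J (cl k) (xs + 0 *\<^sub>R axis k 1) \<le> cluster_cost cl J (cl k) (xs + h *\<^sub>R axis k 1)" for h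
  proof -
    have "replace_on (peers k) (xs + h *\<^sub>R axis k 1) xs = xs + h *\<^sub>R axis k 1"
      by (auto simp: replace_on_def Finite_Cartesian_Product.vec_eq_iff axis_def cluster_def)
    then show ?thesis
      using assms[unfolded nash_equilibrium_def, rule_format, of "cl k" "xs + h *\<^sub>R axis k 1"] by simp
  qed
  then have "(\<Sum>l\<in>peers k. partial_deriv k (J l) xs) / csize k = 0"
    by (intro DERIV_local_min[OF cost_has_partial_deriv[of k xs], of 1]) simp_all
  then have "F xs $ k = 0"
    unfolding csize_F[symmetric] using csize_pos[of k] by (auto split: if_splits)
  then show "F xs $ k = 0 $ k" by simp
qed

lemma partial_lipschitz:
  "l \<in> peers k \<Longrightarrow> \<bar>partial_deriv k (J l) x - partial_deriv k (J l) x'\<bar> \<le> L * norm (x - x')"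
  using lipschitz_onD[OF J_lipschitz[of k l]] by (auto simp: dist_norm cluster_def)

lemma F_lipschitz: "\<bar>F x $ k - F x' $ k\<bar> \<le> L * norm (x - x')"
proof -
  have "csize k * \<bar>F x $ k - F x' $ k\<bar> = \<bar>csize k * F x $ k - csize k * F x' $ k\<bar>"
    by (simp add: abs_mult flip: right_diff_distrib)
  also have "\<dots> \<le> (\<Sum>l\<in>peers k. \<bar>partial_deriv k (J l) x - partial_deriv k (J l) x'\<bar>)"
    unfolding csize_F sum_subtractf[symmetric] by (rule sum_abs)
  also have "\<dots> \<le> (\<Sum>l\<in>peers k. L * norm (x - x'))"
    by (intro sum_mono partial_lipschitz)
  finally have "csize k * \<bar>F x $ k - F x' $ k\<bar> \<le> csize k * (L * norm (x - x'))" by simp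
  then show ?thesis using csize_pos[of k] by (rule mult_left_le_imp_le)
qed

text \<open>
  The aggregate agrees with \<open>csize k * F z $ k\<close> when all estimates equal \<open>z\<close>.
\<close>

lemma aggregate_error:
  "(aggregate Y k - csize k * F z $ k)\<^sup>2 \<le> L\<^sup>2 * (csize k * (\<Sum>l\<in>peers k. (norm (Y $ l - z))\<^sup>2))"
proof -
  have "\<bar>aggregate Y k - csize k * F z $ k\<bar> \<le> (\<Sum>l\<in>peers k. \<bar>partial_deriv k (J l) (Y $ l) - partial_deriv k (J l) z\<bar>)"
    unfolding csize_F aggregate_def sum_subtractf[symmetric] by (rule sum_abs)
  also have "\<dots> \<le> (\<Sum>l\<in>peers k. L * norm (Y $ l - z))"
    by (intro sum_mono partial_lipschitz)
  also have "\<dots> = L * (\<Sum>l\<in>peers k. norm (Y $ l - z))" by (simp add: sum_distrib_left)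
  finally have "(aggregate Y k - csize k * F z $ k)\<^sup>2 \<le> (L * (\<Sum>l\<in>peers k. norm (Y $ l - z)))\<^sup>2"
    using power_mono[of "\<bar>aggregate Y k - csize k * F z $ k\<bar>" _ 2] by simp
  also have "\<dots> \<le> L\<^sup>2 * (csize k * (\<Sum>l\<in>peers k. (norm (Y $ l - z))\<^sup>2))"
    unfolding power_mult_distrib by (intro mult_left_mono square_sum_le_card) simp
  finally show ?thesis .
qed

lemma lipschitz_const_pos:
  assumes "strongly_monotone \<mu> F" "\<mu> > 0"
  shows "L > 0"
proof (rule ccontr)
  assume "\<not> L > 0"
  then have "L = 0" using L_nonneg by simp
  define v where "v = axis (undefined :: 'v) (1 :: real)"
  have "F v = F 0"
    using F_lipschitz[of v _ 0] \<open>L = 0\<close> by (simp add: Finite_Cartesian_Product.vec_eq_iff)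
  \<comment> \<open>A constant game mapping is not strongly monotone.\<close>
  then have "\<mu> * (norm (v - 0))\<^sup>2 \<le> 0 \<bullet> (v - 0)"
    using assms(1)[unfolded strongly_monotone_def, rule_format, of v 0] by simp
  then show False using assms(2) by (simp add: v_def)
qed

end

section \<open>Three coupled error recursions\<close>

text \<open>
  The algorithm, with the constants of the theorem replaced by arbitrary bounds on the quantities that
  they bound. The parameter \<open>f\<close> is the norm in which the matrices \<open>A_tilde Abar \<delta> q\<close> contract.
\<close>

locale gradient_tracking = smooth_cluster_game cl J L
  for cl :: "'v::finite \<Rightarrow> 'c::finite" and J L +
  fixes G :: "'c \<Rightarrow> 'v pair_pre_digraph" and A :: "'c \<Rightarrow> real ^ 'v ^ 'v"
    and w bw :: "real ^ 'v" and Abar :: "real ^ 'v ^ 'v" and \<delta> \<gamma> :: "real ^ 'v"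
    and x :: "nat \<Rightarrow> real ^ 'v" and y g :: "nat \<Rightarrow> real ^ 'v ^ 'v" and xs :: "real ^ 'v"
    and f :: "real ^ 'v \<Rightarrow> real" and C_lo C_up \<mu> b_lo b_hi \<iota> s1 \<tau>1 s2 \<tau>2 \<gamma>M \<gamma>avg \<epsilon> n :: real
    and \<sigma>2 :: "'v \<Rightarrow> real"
  assumes n: "n = real CARD('v)" and monotone: "strongly_monotone \<mu> F" and \<mu>_pos: "\<mu> > 0"
    and nash: "nash_equilibrium cl J xs"
    and block: "\<And>i. stochastic_block (G i) (A i) w bw (cluster cl i) (real (card (cluster cl i)))"
    and b_lo: "b_lo > 0" "\<And>p. b_lo \<le> bw $ p" and b_hi: "\<And>p. bw $ p \<le> b_hi"
    and \<iota>: "\<And>i. L2_set (\<lambda>p. w $ p) (cluster cl i) \<le> \<iota>"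
    and s1: "\<And>i. weighted_matrix_norm (cluster cl i) bw (A i - limit_matrix (A i)) \<le> s1"
    and \<tau>1: "\<And>i. (1 + (weighted_matrix_norm (cluster cl i) bw (A i - limit_matrix (A i)))\<^sup>2)
        / (1 - (weighted_matrix_norm (cluster cl i) bw (A i - limit_matrix (A i)))\<^sup>2) \<le> \<tau>1"
    and Abar: "row_stochastic Abar"
    and f: "is_norm f" and C_lo: "C_lo > 0" "\<And>v. C_lo * norm v \<le> f v"
    and C_up: "\<And>v. f v \<le> C_up * norm v"
    and Abar_nonneg: "\<And>p q. Abar $ p $ q \<ge> 0"
    and \<sigma>2: "\<And>q. 0 \<le> \<sigma>2 q" "\<And>q. \<sigma>2 q < 1" "\<And>q v. f (A_tilde Abar \<delta> q *v v) \<le> \<sigma>2 q * f v"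
    and s2: "\<And>q. \<sigma>2 q \<le> s2"
    and \<tau>2: "\<And>q. (1 + (\<sigma>2 q)\<^sup>2) / (1 - (\<sigma>2 q)\<^sup>2) \<le> \<tau>2"
    and \<gamma>: "\<And>p. 0 \<le> \<gamma> $ p" "\<And>p. \<gamma> $ p \<le> \<gamma>M" and \<gamma>avg: "\<gamma>avg > 0"
    and heterogeneity: "norm (\<gamma> - (\<chi> p. \<gamma>avg)) \<le> \<epsilon> * \<gamma>avg * sqrt n"
    and y_step: "\<And>t p q. y (Suc t) $ p $ q =
        (\<Sum>l\<in>UNIV. Abar $ p $ l * y t $ l $ q) + \<delta> $ p * Abar $ p $ q * (x t $ q - y t $ p $ q)"
    and x_step: "\<And>t p. x (Suc t) $ p = x t $ p - \<gamma> $ p * g t $ p $ p"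
    and g_init: "\<And>p k. k \<in> cluster cl (cl p) \<Longrightarrow> g 0 $ p $ k = partial_deriv k (J p) (y 0 $ p)"
    and g_step: "\<And>t p k. k \<in> cluster cl (cl p) \<Longrightarrow> g (Suc t) $ p $ k =
        (\<Sum>l\<in>cluster cl (cl p). A (cl p) $ p $ l * g t $ l $ k)
        + partial_deriv k (J p) (y (Suc t) $ p) - partial_deriv k (J p) (y t $ p)"
begin

definition size_cube_sum :: real where "size_cube_sum = (\<Sum>i\<in>UNIV. real (card (cluster cl i)) ^ 3)"

definition action_error :: "nat \<Rightarrow> real" where "action_error t = (weighted_norm UNIV bw (x t - xs))\<^sup>2"

definition tracker_deviation :: "nat \<Rightarrow> real" where
  "tracker_deviation t = (\<Sum>i\<in>UNIV. \<Sum>k\<in>cluster cl i.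
     (weighted_norm (cluster cl i) bw (column k (g t) - limit_matrix (A i) *v column k (g t)))\<^sup>2)"

definition estimate_err :: "nat \<Rightarrow> 'v \<Rightarrow> real ^ 'v" where
  "estimate_err t q = (\<chi> p. x t $ q) - column q (y t)"

definition consensus_error :: "nat \<Rightarrow> real" where "consensus_error t = (\<Sum>q\<in>UNIV. (monotone_hull f (estimate_err t q))\<^sup>2)"

definition estimate_gap :: "nat \<Rightarrow> real" where "estimate_gap t = (\<Sum>l\<in>UNIV. (norm (y t $ l - x t))\<^sup>2)"

definition direction :: "nat \<Rightarrow> real ^ 'v" where "direction t = (\<chi> p. g t $ p $ p)"

lemma bw_pos: "bw $ p > 0"
  using b_lo(1) b_lo(2)[of p] by linarith

lemma bw_eq: "bw $ p = csize p * w $ p"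
  using stochastic_block.b_eq[OF block[of "cl p"] self_peer] .

lemma w_pos: "w $ p > 0"
  using stochastic_block.w_pos[OF block[of "cl p"] self_peer] .

lemma b_hi_pos: "b_hi > 0"
  using bw_pos b_hi by (rule less_le_trans)

lemma action_error_eq: "action_error t = (\<Sum>p\<in>UNIV. ((x t - xs) $ p)\<^sup>2 / bw $ p)"
  unfolding action_error_def by (rule weighted_norm_sq) (rule bw_pos)

lemma action_error_lower: "b_lo * action_error t \<le> (norm (x t - xs))\<^sup>2"
  unfolding action_error_eq norm_cart_sq sum_distrib_left
proof (rule sum_mono)
  fix p
  have "b_lo * ((x t - xs) $ p)\<^sup>2 \<le> bw $ p * ((x t - xs) $ p)\<^sup>2"
    by (intro mult_right_mono b_lo) simp
  then show "b_lo * (((x t - xs) $ p)\<^sup>2 / bw $ p) \<le> ((x t - xs) $ p)\<^sup>2"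
    using bw_pos[of p] by (simp add: divide_le_eq mult.commute)
qed

lemma weighted_sum_le: "(\<Sum>p\<in>UNIV. (h p)\<^sup>2) \<le> b_hi * (\<Sum>p\<in>UNIV. (h p)\<^sup>2 / bw $ p)"
  unfolding sum_distrib_left
proof (rule sum_mono)
  fix p
  have "bw $ p * (h p)\<^sup>2 \<le> b_hi * (h p)\<^sup>2"
    by (intro mult_right_mono b_hi) simp
  then show "(h p)\<^sup>2 \<le> b_hi * ((h p)\<^sup>2 / bw $ p)"
    using bw_pos[of p] by (simp add: le_divide_eq mult.commute)
qed

lemma action_error_upper: "(norm (x t - xs))\<^sup>2 \<le> b_hi * action_error t"
  unfolding action_error_eq norm_cart_sq by (rule weighted_sum_le)

lemma tracker_deviation_nonneg: "tracker_deviation t \<ge> 0"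
  unfolding tracker_deviation_def by (intro sum_nonneg) simp

lemma limit_mult:
  "p \<in> cluster cl i \<Longrightarrow> (limit_matrix (A i) *v u) $ p = w $ p * (\<Sum>q\<in>cluster cl i. u $ q)"
  using stochastic_block.W_mult[OF block] stochastic_block.limit_matrix_eq[OF block] by metis

text \<open>
  The conservation law of gradient tracking: mixing with a column-stochastic matrix preserves sums,
  and the increments telescope.
\<close>

lemma tracker_sum: "(\<Sum>l\<in>peers k. g t $ l $ k) = aggregate (y t) k"
proof (induction t)
  case 0
  then show ?case unfolding aggregate_def
    by (intro sum.cong refl g_init) (simp add: cluster_def)
next
  case (Suc t)
  have "(\<Sum>p\<in>peers k. g (Suc t) $ p $ k)
      = (\<Sum>p\<in>peers k. (\<Sum>l\<in>peers k. A (cl k) $ p $ l * g t $ l $ k)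
          + (partial_deriv k (J p) (y (Suc t) $ p) - partial_deriv k (J p) (y t $ p)))"
  proof (intro sum.cong refl)
    fix p assume "p \<in> peers k"
    then have "cl p = cl k" by (simp add: cluster_def)
    then show "g (Suc t) $ p $ k = (\<Sum>l\<in>peers k. A (cl k) $ p $ l * g t $ l $ k)
          + (partial_deriv k (J p) (y (Suc t) $ p) - partial_deriv k (J p) (y t $ p))"
      using g_step[of k p t] self_peer[of k] by simp
  qed
  also have "\<dots> = (\<Sum>p\<in>peers k. \<Sum>l\<in>peers k. A (cl k) $ p $ l * g t $ l $ k)
      + (aggregate (y (Suc t)) k - aggregate (y t) k)"
    by (simp add: sum.distrib sum_subtractf aggregate_def)
  also have "(\<Sum>p\<in>peers k. \<Sum>l\<in>peers k. A (cl k) $ p $ l * g t $ l $ k)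
      = (\<Sum>l\<in>peers k. (\<Sum>p\<in>peers k. A (cl k) $ p $ l) * g t $ l $ k)"
    by (subst sum.swap) (simp add: sum_distrib_right)
  also have "\<dots> = (\<Sum>l\<in>peers k. g t $ l $ k)"
    by (simp add: stochastic_block.column_sum[OF block])
  finally show ?case using Suc by simp
qed

lemma tracker_error: "(\<Sum>k\<in>UNIV. (g t $ k $ k - w $ k * aggregate (y t) k)\<^sup>2 / bw $ k) \<le> tracker_deviation t"
  unfolding tracker_deviation_def sum_by_cluster_dependent[symmetric]
proof (rule sum_mono)
  fix k
  define z where "z = column k (g t) - limit_matrix (A (cl k)) *v column k (g t)"
  have "z $ k = g t $ k $ k - w $ k * aggregate (y t) k"
    unfolding z_def by (simp add: limit_mult self_peer) (simp add: column_def tracker_sum)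
  then have "(g t $ k $ k - w $ k * aggregate (y t) k)\<^sup>2 / bw $ k = (z $ k)\<^sup>2 / bw $ k" by simp
  also have "\<dots> \<le> (\<Sum>p\<in>peers k. (z $ p)\<^sup>2 / bw $ p)"
    using bw_pos by (intro member_le_sum self_peer) (simp_all add: less_imp_le)
  also have "\<dots> = (weighted_norm (peers k) bw z)\<^sup>2"
    by (rule weighted_norm_sq[symmetric]) (rule bw_pos)
  finally show "(g t $ k $ k - w $ k * aggregate (y t) k)\<^sup>2 / bw $ k
      \<le> (weighted_norm (peers k) bw (column k (g t) - limit_matrix (A (cl k)) *v column k (g t)))\<^sup>2"
    by (simp add: z_def)
qed

lemma csize_le: "real (card (cluster cl i)) \<le> n"
  by (simp add: n card_mono)

lemma cluster_square_sum: "(\<Sum>p\<in>cluster cl i. (w $ p)\<^sup>2) \<le> \<iota>\<^sup>2"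
  using power_mono[OF \<iota>[of i] L2_set_nonneg, of 2] by (simp add: L2_set_def sum_nonneg)

text \<open>
  The weight satisfies \<open>(w $ k)\<^sup>2 / bw $ k = bw $ k / (csize k)\<^sup>2\<close>. One factor \<open>csize k\<close> cancels the constant
  of the Cauchy--Schwarz inequality, the other one the sum over the cluster.
\<close>

lemma estimate_error_weighted:
  "(\<Sum>k\<in>UNIV. (w $ k * (aggregate (y t) k - csize k * F (x t) $ k))\<^sup>2 / bw $ k) \<le> b_hi * L\<^sup>2 * estimate_gap t"
proof -
  define r where "r i = (\<Sum>l\<in>cluster cl i. (norm (y t $ l - x t))\<^sup>2)" for i
  have r: "r i \<ge> 0" for i unfolding r_def by (intro sum_nonneg) simp
  have "(\<Sum>k\<in>UNIV. (w $ k * (aggregate (y t) k - csize k * F (x t) $ k))\<^sup>2 / bw $ k)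
      \<le> (\<Sum>k\<in>UNIV. b_hi * L\<^sup>2 * r (cl k) / csize k)"
  proof (rule sum_mono)
    fix k
    have "(w $ k * (aggregate (y t) k - csize k * F (x t) $ k))\<^sup>2 / bw $ k
        = w $ k / csize k * (aggregate (y t) k - csize k * F (x t) $ k)\<^sup>2"
      using w_pos[of k] by (simp add: bw_eq power2_eq_square)
    also have "\<dots> \<le> w $ k / csize k * (L\<^sup>2 * (csize k * r (cl k)))"
      unfolding r_def using w_pos[of k] by (intro mult_left_mono aggregate_error) (simp add: less_imp_le)
    also have "\<dots> = bw $ k * (L\<^sup>2 * r (cl k) / csize k)"
      using csize_pos[of k] by (simp add: bw_eq)
    also have "\<dots> \<le> b_hi * (L\<^sup>2 * r (cl k) / csize k)"
      using r by (intro mult_right_mono b_hi) simp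
    finally show "(w $ k * (aggregate (y t) k - csize k * F (x t) $ k))\<^sup>2 / bw $ k
        \<le> b_hi * L\<^sup>2 * r (cl k) / csize k" by (simp add: mult.assoc)
  qed
  also have "\<dots> = (\<Sum>i\<in>UNIV. \<Sum>k\<in>cluster cl i. b_hi * L\<^sup>2 * r i / real (card (cluster cl i)))"
    by (rule sum_by_cluster_dependent[where h = "\<lambda>i k. b_hi * L\<^sup>2 * r i / real (card (cluster cl i))"])
  also have "\<dots> \<le> (\<Sum>i\<in>UNIV. b_hi * L\<^sup>2 * r i)"
    using r b_hi_pos by (intro sum_mono) simp
  also have "\<dots> = b_hi * L\<^sup>2 * estimate_gap t"
    by (simp add: estimate_gap_def r_def sum_by_cluster[of _ cl] sum_distrib_left)
  finally show ?thesis .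
qed

lemma estimate_error:
  "(\<Sum>k\<in>UNIV. (w $ k * (aggregate (y t) k - csize k * F (x t) $ k))\<^sup>2) \<le> \<iota>\<^sup>2 * L\<^sup>2 * n * estimate_gap t"
proof -
  define r where "r i = (\<Sum>l\<in>cluster cl i. (norm (y t $ l - x t))\<^sup>2)" for i
  have r: "r i \<ge> 0" for i unfolding r_def by (intro sum_nonneg) simp
  have "(\<Sum>k\<in>UNIV. (w $ k * (aggregate (y t) k - csize k * F (x t) $ k))\<^sup>2)
      \<le> (\<Sum>k\<in>UNIV. (w $ k)\<^sup>2 * (L\<^sup>2 * (csize k * r (cl k))))"
    unfolding power_mult_distrib r_def by (intro sum_mono mult_left_mono aggregate_error) simp
  also have "\<dots> = (\<Sum>i\<in>UNIV. \<Sum>k\<in>cluster cl i. (w $ k)\<^sup>2 * (L\<^sup>2 * (real (card (cluster cl i)) * r i)))"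
    by (rule sum_by_cluster_dependent[where h = "\<lambda>i k. (w $ k)\<^sup>2 * (L\<^sup>2 * (real (card (cluster cl i)) * r i))"])
  also have "\<dots> \<le> (\<Sum>i\<in>UNIV. \<iota>\<^sup>2 * (L\<^sup>2 * (n * r i)))"
  proof (rule sum_mono)
    fix i
    have "(\<Sum>k\<in>cluster cl i. (w $ k)\<^sup>2 * (L\<^sup>2 * (real (card (cluster cl i)) * r i)))
        = (\<Sum>k\<in>cluster cl i. (w $ k)\<^sup>2) * (L\<^sup>2 * (real (card (cluster cl i)) * r i))"
      by (simp only: sum_distrib_right)
    also have "\<dots> \<le> \<iota>\<^sup>2 * (L\<^sup>2 * (n * r i))"
      using r by (intro mult_mono cluster_square_sum mult_left_mono csize_le mult_right_mono) simp_all
    finally show "(\<Sum>k\<in>cluster cl i. (w $ k)\<^sup>2 * (L\<^sup>2 * (real (card (cluster cl i)) * r i)))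
      \<le> \<iota>\<^sup>2 * (L\<^sup>2 * (n * r i))" .
  qed
  also have "\<dots> = \<iota>\<^sup>2 * L\<^sup>2 * n * estimate_gap t"
    by (simp add: estimate_gap_def r_def sum_by_cluster[of _ cl] sum_distrib_left mult.assoc)
  finally show ?thesis .
qed

lemma F_bound: "\<bar>F (x t) $ k\<bar> \<le> L * norm (x t - xs)"
  using F_lipschitz[of "x t" k xs] F_zero_at_nash[OF nash] by simp

lemma gradient_bound:
  "(\<Sum>k\<in>UNIV. (bw $ k * F (x t) $ k)\<^sup>2) \<le> \<iota>\<^sup>2 * L\<^sup>2 * size_cube_sum * (b_hi * action_error t)"
proof -
  define c where "c i = real (card (cluster cl i))" for i
  have S_ge: "(\<Sum>i\<in>UNIV. (c i)\<^sup>2) \<le> size_cube_sum"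
    unfolding size_cube_sum_def
  proof (rule sum_mono)
    fix i
    show "(c i)\<^sup>2 \<le> real (card (cluster cl i)) ^ 3"
      by (cases "card (cluster cl i)") (auto simp: c_def power2_eq_square power3_eq_cube)
  qed
  have "(\<Sum>k\<in>UNIV. (bw $ k * F (x t) $ k)\<^sup>2)
      \<le> (\<Sum>k\<in>UNIV. (w $ k)\<^sup>2 * ((c (cl k))\<^sup>2 * (L\<^sup>2 * (norm (x t - xs))\<^sup>2)))"
  proof (rule sum_mono)
    fix k
    have "(F (x t) $ k)\<^sup>2 \<le> L\<^sup>2 * (norm (x t - xs))\<^sup>2"
      using power_mono[OF F_bound[of t k], of 2] by (simp add: power_mult_distrib)
    then have "(w $ k)\<^sup>2 * ((c (cl k))\<^sup>2 * (F (x t) $ k)\<^sup>2)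
        \<le> (w $ k)\<^sup>2 * ((c (cl k))\<^sup>2 * (L\<^sup>2 * (norm (x t - xs))\<^sup>2))"
      by (intro mult_left_mono) simp_all
    then show "(bw $ k * F (x t) $ k)\<^sup>2 \<le> (w $ k)\<^sup>2 * ((c (cl k))\<^sup>2 * (L\<^sup>2 * (norm (x t - xs))\<^sup>2))"
      by (simp add: bw_eq c_def power_mult_distrib mult_ac)
  qed
  also have "\<dots> = (\<Sum>i\<in>UNIV. \<Sum>k\<in>cluster cl i. (w $ k)\<^sup>2 * ((c i)\<^sup>2 * (L\<^sup>2 * (norm (x t - xs))\<^sup>2)))"
    by (rule sum_by_cluster_dependent[where h = "\<lambda>i k. (w $ k)\<^sup>2 * ((c i)\<^sup>2 * (L\<^sup>2 * (norm (x t - xs))\<^sup>2))"])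
  also have "\<dots> \<le> (\<Sum>i\<in>UNIV. \<iota>\<^sup>2 * ((c i)\<^sup>2 * (L\<^sup>2 * (norm (x t - xs))\<^sup>2)))"
    unfolding sum_distrib_right[symmetric] by (intro sum_mono mult_right_mono cluster_square_sum) simp
  also have "\<dots> = \<iota>\<^sup>2 * L\<^sup>2 * ((\<Sum>i\<in>UNIV. (c i)\<^sup>2) * (norm (x t - xs))\<^sup>2)"
    by (simp add: sum_distrib_left sum_distrib_right mult_ac)
  also have "\<dots> \<le> \<iota>\<^sup>2 * L\<^sup>2 * (size_cube_sum * (b_hi * action_error t))"
    by (intro mult_left_mono mult_mono S_ge action_error_upper) (simp_all add: size_cube_sum_def sum_nonneg)
  finally show ?thesis by (simp add: mult.assoc)
qed

text \<open>
  Since \<open>bw $ k = csize k * w $ k\<close>, the share \<open>w $ k\<close> of the summed partial derivatives is \<open>bw $ k\<close> times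
  the game mapping; the two differences are the errors that the other recursions control.
\<close>

lemma direction_split:
  "direction t $ k = bw $ k * F (x t) $ k + (g t $ k $ k - w $ k * aggregate (y t) k)
     + w $ k * (aggregate (y t) k - csize k * F (x t) $ k)"
  by (simp add: direction_def bw_eq algebra_simps)

lemma direction_bound:
  "(norm (direction t))\<^sup>2 \<le> 3 * (\<iota>\<^sup>2 * L\<^sup>2 * size_cube_sum * (b_hi * action_error t) + b_hi * tracker_deviation t + \<iota>\<^sup>2 * L\<^sup>2 * n * estimate_gap t)"
proof -
  have "(norm (direction t))\<^sup>2 \<le> (\<Sum>k\<in>UNIV. 3 * ((bw $ k * F (x t) $ k)\<^sup>2
      + (g t $ k $ k - w $ k * aggregate (y t) k)\<^sup>2
      + (w $ k * (aggregate (y t) k - csize k * F (x t) $ k))\<^sup>2))"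
    unfolding norm_cart_sq direction_split by (intro sum_mono square_sum3_le)
  also have "\<dots> = 3 * ((\<Sum>k\<in>UNIV. (bw $ k * F (x t) $ k)\<^sup>2)
      + (\<Sum>k\<in>UNIV. (g t $ k $ k - w $ k * aggregate (y t) k)\<^sup>2)
      + (\<Sum>k\<in>UNIV. (w $ k * (aggregate (y t) k - csize k * F (x t) $ k))\<^sup>2))"
    by (simp only: sum.distrib sum_distrib_left[symmetric])
  also have "\<dots> \<le> 3 * (\<iota>\<^sup>2 * L\<^sup>2 * size_cube_sum * (b_hi * action_error t) + b_hi * tracker_deviation t + \<iota>\<^sup>2 * L\<^sup>2 * n * estimate_gap t)"
  proof (intro mult_left_mono add_mono gradient_bound estimate_error)
    have "(\<Sum>k\<in>UNIV. (g t $ k $ k - w $ k * aggregate (y t) k)\<^sup>2)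
        \<le> b_hi * (\<Sum>k\<in>UNIV. (g t $ k $ k - w $ k * aggregate (y t) k)\<^sup>2 / bw $ k)"
      by (rule weighted_sum_le)
    also have "\<dots> \<le> b_hi * tracker_deviation t"
      using b_hi_pos by (intro mult_left_mono tracker_error) simp
    finally show "(\<Sum>k\<in>UNIV. (g t $ k $ k - w $ k * aggregate (y t) k)\<^sup>2) \<le> b_hi * tracker_deviation t" .
  qed simp
  finally show ?thesis .
qed

lemma estimate_gap_eq: "estimate_gap t = (\<Sum>q\<in>UNIV. (norm (estimate_err t q))\<^sup>2)"
  unfolding estimate_gap_def norm_cart_sq estimate_err_def
  by (subst sum.swap) (simp add: column_def power2_commute)

lemma estimate_gap_le: "estimate_gap t \<le> consensus_error t / C_lo\<^sup>2"
proof -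
  have "C_lo\<^sup>2 * estimate_gap t = (\<Sum>q\<in>UNIV. (C_lo * norm (estimate_err t q))\<^sup>2)"
    by (simp add: estimate_gap_eq sum_distrib_left power_mult_distrib)
  also have "\<dots> \<le> consensus_error t"
    unfolding consensus_error_def using C_lo
    by (intro sum_mono power_mono monotone_hull_lower[OF f]) simp_all
  finally show ?thesis using C_lo(1) by (simp add: le_divide_eq mult.commute)
qed


lemma \<epsilon>_nonneg: "\<epsilon> \<ge> 0"
proof -
  have "0 \<le> \<epsilon> * (\<gamma>avg * sqrt n)"
    using order_trans[OF norm_ge_zero heterogeneity] by (simp add: mult.assoc)
  moreover have "\<gamma>avg * sqrt n > 0" using \<gamma>avg by (simp add: n)
  ultimately show ?thesis by (simp add: zero_le_mult_iff)
qed

text \<open>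
  Strong monotonicity applies to the average step-size. The deviations from it are paired with the
  coordinates of the actions by the Cauchy--Schwarz inequality, while every coordinate of the game
  mapping has the same Lipschitz bound; this costs \<open>sqrt n\<close> rather than \<open>n\<close>.
\<close>

lemma progress:
  "(\<Sum>p\<in>UNIV. \<gamma> $ p * (x t - xs) $ p * F (x t) $ p)
    \<ge> (\<gamma>avg * \<mu> - \<epsilon> * \<gamma>avg * sqrt n * L) * (norm (x t - xs))\<^sup>2"
proof -
  define u where "u = x t - xs"
  define a where "a = \<gamma> - (\<chi> p. \<gamma>avg)"
  have "\<mu> * (norm u)\<^sup>2 \<le> (F (x t) - F xs) \<bullet> (x t - xs)"
    using monotone by (simp add: strongly_monotone_def u_def)
  also have "\<dots> = (\<Sum>p\<in>UNIV. u $ p * F (x t) $ p)"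
    unfolding F_zero_at_nash[OF nash] by (simp add: inner_vec_def u_def mult.commute)
  finally have main: "\<gamma>avg * (\<mu> * (norm u)\<^sup>2) \<le> \<gamma>avg * (\<Sum>p\<in>UNIV. u $ p * F (x t) $ p)"
    using \<gamma>avg by (intro mult_left_mono) simp_all
  have "\<bar>\<Sum>p\<in>UNIV. a $ p * u $ p * F (x t) $ p\<bar> \<le> (\<Sum>p\<in>UNIV. \<bar>a $ p\<bar> * \<bar>u $ p\<bar> * \<bar>F (x t) $ p\<bar>)"
    using sum_abs[of "\<lambda>p. a $ p * u $ p * F (x t) $ p" UNIV] by (simp add: abs_mult)
  also have "\<dots> \<le> (\<Sum>p\<in>UNIV. \<bar>a $ p\<bar> * \<bar>u $ p\<bar> * (L * norm u))"
    unfolding u_def by (intro sum_mono mult_left_mono F_bound) simp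
  also have "\<dots> = (\<Sum>p\<in>UNIV. \<bar>a $ p\<bar> * \<bar>u $ p\<bar>) * (L * norm u)" by (simp only: sum_distrib_right)
  also have "\<dots> \<le> (\<epsilon> * \<gamma>avg * sqrt n * norm u) * (L * norm u)"
  proof (rule mult_right_mono)
    have "(\<Sum>p\<in>UNIV. \<bar>a $ p\<bar> * \<bar>u $ p\<bar>) \<le> L2_set (($) a) UNIV * L2_set (($) u) UNIV"
      by (rule L2_set_mult_ineq)
    also have "\<dots> = norm a * norm u" by (simp add: norm_vec_def L2_set_def)
    also have "\<dots> \<le> \<epsilon> * \<gamma>avg * sqrt n * norm u"
      using heterogeneity unfolding a_def by (intro mult_right_mono) simp_all
    finally show "(\<Sum>p\<in>UNIV. \<bar>a $ p\<bar> * \<bar>u $ p\<bar>) \<le> \<epsilon> * \<gamma>avg * sqrt n * norm u" .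
  qed (simp add: L_nonneg)
  finally have side: "- (\<epsilon> * \<gamma>avg * sqrt n * L * (norm u)\<^sup>2) \<le> (\<Sum>p\<in>UNIV. a $ p * u $ p * F (x t) $ p)"
    by (simp add: power2_eq_square mult_ac)
  have "(\<Sum>p\<in>UNIV. \<gamma> $ p * u $ p * F (x t) $ p)
      = \<gamma>avg * (\<Sum>p\<in>UNIV. u $ p * F (x t) $ p) + (\<Sum>p\<in>UNIV. a $ p * u $ p * F (x t) $ p)"
    unfolding sum_distrib_left sum.distrib[symmetric] by (intro sum.cong refl) (simp add: a_def algebra_simps)
  then show ?thesis using main side by (simp add: u_def algebra_simps)
qed

text \<open>
  Strong monotonicity provides a decrease with twice the coefficient \<open>b_lo * \<mu> * \<gamma>avg\<close>. One half of it is
  spent on the two cross terms with the errors of tracking and of the estimates.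
\<close>

lemma action_error_step:
  "action_error (Suc t) \<le> (1 - b_lo * \<mu> * \<gamma>avg + 3 * b_hi * \<iota>\<^sup>2 * L\<^sup>2 / b_lo * size_cube_sum * \<gamma>M\<^sup>2
                  + 2 * b_hi * sqrt n * L * \<epsilon> * \<gamma>avg) * action_error t
    + (3 * b_hi / b_lo * \<gamma>M\<^sup>2 + 2 / (b_lo * \<mu>) * \<gamma>M\<^sup>2 / \<gamma>avg) * tracker_deviation t
    + (3 * n * \<iota>\<^sup>2 * L\<^sup>2 / (b_lo * C_lo\<^sup>2) * \<gamma>M\<^sup>2
        + 2 * b_hi * L\<^sup>2 / (b_lo * C_lo\<^sup>2 * \<mu>) * \<gamma>M\<^sup>2 / \<gamma>avg) * consensus_error t"
proof -
  define u where "u = x t - xs"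
  define e1 where "e1 k = g t $ k $ k - w $ k * aggregate (y t) k" for k
  define e2 where "e2 k = w $ k * (aggregate (y t) k - csize k * F (x t) $ k)" for k
  \<comment> \<open>The weight in Young's inequality: each of the two cross terms uses a quarter of the decrease.\<close>
  define c where "c = \<gamma>avg * (b_lo * \<mu>) / 2"
  have c: "c > 0" using \<gamma>avg b_lo \<mu>_pos by (simp add: c_def)
  have nonneg: "b_hi \<ge> 0" "b_lo > 0" "C_lo > 0" "\<mu> > 0" "\<gamma>avg > 0"
    using b_hi_pos b_lo C_lo \<mu>_pos \<gamma>avg by auto
  have u': "(x (Suc t) - xs) $ p = u $ p - \<gamma> $ p * direction t $ p" for p
    by (simp add: u_def x_step direction_def)
  have coordinate: "(u $ p - \<gamma> $ p * direction t $ p)\<^sup>2 / bw $ p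
      \<le> (u $ p)\<^sup>2 / bw $ p - 2 * (\<gamma> $ p * u $ p * F (x t) $ p) + 2 * c * ((u $ p)\<^sup>2 / bw $ p)
        + \<gamma>M\<^sup>2 / c * ((e1 p)\<^sup>2 / bw $ p) + \<gamma>M\<^sup>2 / c * ((e2 p)\<^sup>2 / bw $ p)
        + \<gamma>M\<^sup>2 / b_lo * (direction t $ p)\<^sup>2" for p
  proof -
    have split: "direction t $ p = bw $ p * F (x t) $ p + e1 p + e2 p"
      by (simp add: direction_split e1_def e2_def)
    have "(u $ p - \<gamma> $ p * direction t $ p)\<^sup>2 / bw $ p
        = (u $ p)\<^sup>2 / bw $ p - 2 * (\<gamma> $ p * u $ p * (direction t $ p)) / bw $ p
          + (\<gamma> $ p * direction t $ p)\<^sup>2 / bw $ p"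
      by (simp add: power2_eq_square diff_divide_distrib add_divide_distrib algebra_simps)
    also have "2 * (\<gamma> $ p * u $ p * (direction t $ p)) / bw $ p = 2 * (\<gamma> $ p * u $ p * F (x t) $ p)
        + 2 * (\<gamma> $ p * u $ p * e1 p) / bw $ p + 2 * (\<gamma> $ p * u $ p * e2 p) / bw $ p"
      unfolding split using bw_pos[of p] by (simp add: field_simps)
    finally have expand: "(u $ p - \<gamma> $ p * direction t $ p)\<^sup>2 / bw $ p
        = (u $ p)\<^sup>2 / bw $ p - 2 * (\<gamma> $ p * u $ p * F (x t) $ p)
          + (- 2 * (\<gamma> $ p * u $ p * e1 p)) / bw $ p + (- 2 * (\<gamma> $ p * u $ p * e2 p)) / bw $ p
          + (\<gamma> $ p * direction t $ p)\<^sup>2 / bw $ p" by simp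
    have young: "(- 2 * (\<gamma> $ p * u $ p * e)) / bw $ p \<le> c * ((u $ p)\<^sup>2 / bw $ p) + \<gamma>M\<^sup>2 / c * (e\<^sup>2 / bw $ p)" for e
      using divide_right_mono[OF young_bound[OF c \<gamma>, of p "u $ p" e], of "bw $ p"] bw_pos[of p]
      by (simp add: add_divide_distrib)
    have last: "(\<gamma> $ p * direction t $ p)\<^sup>2 / bw $ p \<le> \<gamma>M\<^sup>2 / b_lo * (direction t $ p)\<^sup>2"
    proof -
      have "(\<gamma> $ p)\<^sup>2 / bw $ p \<le> \<gamma>M\<^sup>2 / b_lo"
        using b_lo \<gamma> by (intro frac_le power_mono) simp_all
      then have "(\<gamma> $ p)\<^sup>2 / bw $ p * (direction t $ p)\<^sup>2 \<le> \<gamma>M\<^sup>2 / b_lo * (direction t $ p)\<^sup>2"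
        by (rule mult_right_mono) simp
      then show ?thesis by (simp add: power_mult_distrib)
    qed
    show ?thesis unfolding expand using young[of "e1 p"] young[of "e2 p"] last by linarith
  qed
  have "action_error (Suc t) \<le> action_error t - 2 * (\<Sum>p\<in>UNIV. \<gamma> $ p * u $ p * F (x t) $ p) + 2 * c * action_error t
      + \<gamma>M\<^sup>2 / c * (\<Sum>p\<in>UNIV. (e1 p)\<^sup>2 / bw $ p) + \<gamma>M\<^sup>2 / c * (\<Sum>p\<in>UNIV. (e2 p)\<^sup>2 / bw $ p)
      + \<gamma>M\<^sup>2 / b_lo * (norm (direction t))\<^sup>2"
    unfolding action_error_eq u' norm_cart_sq u_def[symmetric] sum_distrib_left sum.distrib[symmetric] sum_subtractf[symmetric]
    using coordinate by (intro sum_mono) (simp add: sum_distrib_left)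
  also have "\<dots> \<le> action_error t - 2 * ((\<gamma>avg * \<mu> - \<epsilon> * \<gamma>avg * sqrt n * L) * (norm u)\<^sup>2) + 2 * c * action_error t
      + \<gamma>M\<^sup>2 / c * tracker_deviation t + \<gamma>M\<^sup>2 / c * (b_hi * L\<^sup>2 * estimate_gap t)
      + \<gamma>M\<^sup>2 / b_lo * (3 * (\<iota>\<^sup>2 * L\<^sup>2 * size_cube_sum * (b_hi * action_error t) + b_hi * tracker_deviation t + \<iota>\<^sup>2 * L\<^sup>2 * n * estimate_gap t))"
    unfolding u_def e1_def e2_def using c nonneg
    by (intro add_mono diff_mono mult_left_mono order_refl progress tracker_error estimate_error_weighted direction_bound)
      simp_all
  also have "\<dots> = action_error t + 2 * c * action_error t - 2 * \<gamma>avg * \<mu> * (norm u)\<^sup>2 + 2 * (\<epsilon> * \<gamma>avg * sqrt n * L) * (norm u)\<^sup>2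
      + (\<gamma>M\<^sup>2 / c * tracker_deviation t + \<gamma>M\<^sup>2 / b_lo * (3 * (\<iota>\<^sup>2 * L\<^sup>2 * size_cube_sum * (b_hi * action_error t) + b_hi * tracker_deviation t)))
      + (\<gamma>M\<^sup>2 / c * (b_hi * L\<^sup>2) + \<gamma>M\<^sup>2 / b_lo * (3 * \<iota>\<^sup>2 * L\<^sup>2 * n)) * estimate_gap t"
    by (simp add: algebra_simps)
  also have "\<dots> \<le> action_error t + 2 * c * action_error t - 2 * \<gamma>avg * \<mu> * (b_lo * action_error t) + 2 * (\<epsilon> * \<gamma>avg * sqrt n * L) * (b_hi * action_error t)
      + (\<gamma>M\<^sup>2 / c * tracker_deviation t + \<gamma>M\<^sup>2 / b_lo * (3 * (\<iota>\<^sup>2 * L\<^sup>2 * size_cube_sum * (b_hi * action_error t) + b_hi * tracker_deviation t)))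
      + (\<gamma>M\<^sup>2 / c * (b_hi * L\<^sup>2) + \<gamma>M\<^sup>2 / b_lo * (3 * \<iota>\<^sup>2 * L\<^sup>2 * n)) * (consensus_error t / C_lo\<^sup>2)"
    unfolding u_def using c nonneg \<epsilon>_nonneg L_nonneg
    by (intro add_mono diff_mono mult_left_mono order_refl action_error_lower action_error_upper estimate_gap_le) (simp_all add: n)
  also have "\<dots> = (1 - b_lo * \<mu> * \<gamma>avg + 3 * b_hi * \<iota>\<^sup>2 * L\<^sup>2 / b_lo * size_cube_sum * \<gamma>M\<^sup>2
                  + 2 * b_hi * sqrt n * L * \<epsilon> * \<gamma>avg) * action_error t
    + (3 * b_hi / b_lo * \<gamma>M\<^sup>2 + \<gamma>M\<^sup>2 / c) * tracker_deviation t
    + (3 * n * \<iota>\<^sup>2 * L\<^sup>2 / (b_lo * C_lo\<^sup>2) * \<gamma>M\<^sup>2 + b_hi * L\<^sup>2 / C_lo\<^sup>2 * (\<gamma>M\<^sup>2 / c)) * consensus_error t"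
    using nonneg by (simp add: c_def algebra_simps)
  also have "\<gamma>M\<^sup>2 / c = 2 / (b_lo * \<mu>) * \<gamma>M\<^sup>2 / \<gamma>avg" by (simp add: c_def mult_ac)
  also have "b_hi * L\<^sup>2 / C_lo\<^sup>2 * (2 / (b_lo * \<mu>) * \<gamma>M\<^sup>2 / \<gamma>avg)
      = 2 * b_hi * L\<^sup>2 / (b_lo * C_lo\<^sup>2 * \<mu>) * \<gamma>M\<^sup>2 / \<gamma>avg" by (simp add: mult_ac)
  finally show ?thesis .
qed

text \<open>
  The matrix that updates the errors of the estimates of action \<open>q\<close>. Its diagonal entries may be
  negative, and \<open>A_tilde Abar \<delta> q\<close> consists of the absolute values of its entries.
\<close>

definition error_matrix :: "'v \<Rightarrow> real ^ 'v ^ 'v" where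
  "error_matrix q = (\<chi> p m. Abar $ p $ m - (if p = m then \<delta> $ p * Abar $ p $ q else 0))"

lemma error_matrix_mult: "(error_matrix q *v v) $ p = (\<Sum>m\<in>UNIV. Abar $ p $ m * v $ m) - \<delta> $ p * Abar $ p $ q * v $ p"
proof -
  have "(error_matrix q *v v) $ p = (\<Sum>m\<in>UNIV. Abar $ p $ m * v $ m - (if p = m then \<delta> $ p * Abar $ p $ q * v $ m else 0))"
    unfolding matrix_vector_mult_def error_matrix_def by (auto simp: left_diff_distrib intro!: sum.cong)
  then show ?thesis by (simp add: sum_subtractf)
qed

lemma monotone_hull_error_matrix: "monotone_hull f (error_matrix q *v v) \<le> \<sigma>2 q * monotone_hull f v"
proof (rule monotone_hull_contraction[OF f _ \<sigma>2(3) \<sigma>2(1)])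
  fix p m
  show "\<bar>error_matrix q $ p $ m\<bar> \<le> A_tilde Abar \<delta> q $ p $ m"
    using Abar_nonneg by (simp add: error_matrix_def A_tilde_def)
qed

text \<open>
  Averaging with the row-stochastic \<open>Abar\<close> reproduces a value common to all agents, so the error of the
  new estimates relative to the old action is linear in the old errors.
\<close>

lemma estimate_update:
  "y (Suc t) $ p $ q = x t $ q - (error_matrix q *v estimate_err t q) $ p"
proof -
  have "(\<Sum>m\<in>UNIV. Abar $ p $ m * estimate_err t q $ m) = x t $ q * (\<Sum>m\<in>UNIV. Abar $ p $ m) - (\<Sum>m\<in>UNIV. Abar $ p $ m * y t $ m $ q)"
    by (simp add: estimate_err_def column_def right_diff_distrib sum_subtractf sum_distrib_left mult.commute)
  moreover have "(\<Sum>m\<in>UNIV. Abar $ p $ m) = 1" using Abar by (simp add: row_stochastic_def)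
  ultimately show ?thesis by (simp add: error_matrix_mult y_step estimate_err_def column_def)
qed

lemma estimate_err_step: "estimate_err (Suc t) q = error_matrix q *v estimate_err t q + (\<chi> p. (x (Suc t) - x t) $ q)"
  by (simp add: Finite_Cartesian_Product.vec_eq_iff estimate_err_def[of "Suc t"] column_def estimate_update)

lemma estimate_change: "column q (y (Suc t)) - column q (y t) = estimate_err t q - error_matrix q *v estimate_err t q"
  by (simp add: Finite_Cartesian_Product.vec_eq_iff column_def estimate_update)
    (simp add: estimate_err_def column_def)

lemma action_change: "(norm (x (Suc t) - x t))\<^sup>2 \<le> \<gamma>M\<^sup>2 * (norm (direction t))\<^sup>2"
proof -
  have "((x (Suc t) - x t) $ p)\<^sup>2 \<le> \<gamma>M\<^sup>2 * (direction t $ p)\<^sup>2" for p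
    using \<gamma> by (simp add: x_step direction_def power_mult_distrib mult_right_mono power_mono)
  then show ?thesis unfolding norm_cart_sq sum_distrib_left by (intro sum_mono)
qed

lemma one_minus_sq_pos: "0 \<le> s \<Longrightarrow> s < 1 \<Longrightarrow> 0 < 1 - (s :: real)\<^sup>2"
  by (simp add: power_less_one_iff)

lemma \<tau>2_nonneg: "\<tau>2 \<ge> 0"
  by (rule order_trans[OF _ \<tau>2[of undefined]])
    (use one_minus_sq_pos[OF \<sigma>2(1,2), of undefined] in simp)

lemma consensus_error_step:
  "consensus_error (Suc t) \<le> 3 * b_hi * n * \<tau>2 * C_up\<^sup>2 * \<iota>\<^sup>2 * L\<^sup>2 * size_cube_sum * \<gamma>M\<^sup>2 * action_error t
    + 3 * b_hi * n * \<tau>2 * C_up\<^sup>2 * \<gamma>M\<^sup>2 * tracker_deviation t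
    + ((1 + s2\<^sup>2) / 2 + 3 * n\<^sup>2 * \<tau>2 * C_up\<^sup>2 * \<iota>\<^sup>2 * L\<^sup>2 / C_lo\<^sup>2 * \<gamma>M\<^sup>2) * consensus_error t"
proof -
  have "(monotone_hull f (estimate_err (Suc t) q))\<^sup>2
      \<le> (1 + s2\<^sup>2) / 2 * (monotone_hull f (estimate_err t q))\<^sup>2 + \<tau>2 * (C_up\<^sup>2 * n * ((x (Suc t) - x t) $ q)\<^sup>2)" for q
  proof -
    define d :: "real ^ 'v" where "d = (\<chi> p. (x (Suc t) - x t) $ q)"
    have d: "(norm d)\<^sup>2 = n * ((x (Suc t) - x t) $ q)\<^sup>2"
      by (simp add: norm_cart_sq d_def n)
    have "monotone_hull f (estimate_err (Suc t) q) \<le> monotone_hull f (error_matrix q *v estimate_err t q) + monotone_hull f d"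
      unfolding estimate_err_step d_def by (rule monotone_hull_add[OF f])
    also have "\<dots> \<le> \<sigma>2 q * monotone_hull f (estimate_err t q) + C_up * norm d"
      by (intro add_mono monotone_hull_error_matrix monotone_hull_upper[OF f] C_up)
    finally have "(monotone_hull f (estimate_err (Suc t) q))\<^sup>2 \<le> (\<sigma>2 q * monotone_hull f (estimate_err t q) + C_up * norm d)\<^sup>2"
      by (intro power_mono monotone_hull_nonneg[OF f])
    also have "\<dots> \<le> (1 + (\<sigma>2 q)\<^sup>2) / 2 * (monotone_hull f (estimate_err t q))\<^sup>2
        + (1 + (\<sigma>2 q)\<^sup>2) / (1 - (\<sigma>2 q)\<^sup>2) * (C_up * norm d)\<^sup>2"
      by (rule contraction_square_bound) (rule \<sigma>2)+
    also have "\<dots> \<le> (1 + s2\<^sup>2) / 2 * (monotone_hull f (estimate_err t q))\<^sup>2 + \<tau>2 * (C_up * norm d)\<^sup>2"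
      using power_mono[OF s2[of q] \<sigma>2(1)[of q], of 2] by (intro add_mono mult_right_mono \<tau>2) simp_all
    finally show ?thesis by (simp add: power_mult_distrib d mult.assoc)
  qed
  then have "consensus_error (Suc t) \<le> (\<Sum>q\<in>UNIV. (1 + s2\<^sup>2) / 2 * (monotone_hull f (estimate_err t q))\<^sup>2 + \<tau>2 * (C_up\<^sup>2 * n * ((x (Suc t) - x t) $ q)\<^sup>2))"
    unfolding consensus_error_def by (rule sum_mono)
  also have "\<dots> = (1 + s2\<^sup>2) / 2 * consensus_error t + \<tau>2 * C_up\<^sup>2 * n * (norm (x (Suc t) - x t))\<^sup>2"
    unfolding consensus_error_def norm_cart_sq sum.distrib sum_distrib_left by (simp add: mult.assoc)
  also have "\<dots> \<le> (1 + s2\<^sup>2) / 2 * consensus_error t + \<tau>2 * C_up\<^sup>2 * n * (\<gamma>M\<^sup>2 *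
      (3 * (\<iota>\<^sup>2 * L\<^sup>2 * size_cube_sum * (b_hi * action_error t) + b_hi * tracker_deviation t + \<iota>\<^sup>2 * L\<^sup>2 * n * (consensus_error t / C_lo\<^sup>2))))"
  proof (intro add_left_mono mult_left_mono)
    have "\<gamma>M\<^sup>2 * (norm (direction t))\<^sup>2 \<le> \<gamma>M\<^sup>2 * (3 * (\<iota>\<^sup>2 * L\<^sup>2 * size_cube_sum * (b_hi * action_error t) + b_hi * tracker_deviation t + \<iota>\<^sup>2 * L\<^sup>2 * n * estimate_gap t))"
      by (intro mult_left_mono direction_bound) simp
    also have "\<dots> \<le> \<gamma>M\<^sup>2 * (3 * (\<iota>\<^sup>2 * L\<^sup>2 * size_cube_sum * (b_hi * action_error t) + b_hi * tracker_deviation t + \<iota>\<^sup>2 * L\<^sup>2 * n * (consensus_error t / C_lo\<^sup>2)))"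
      by (intro mult_left_mono add_left_mono estimate_gap_le) (simp_all add: n)
    finally show "(norm (x (Suc t) - x t))\<^sup>2 \<le> \<gamma>M\<^sup>2 *
      (3 * (\<iota>\<^sup>2 * L\<^sup>2 * size_cube_sum * (b_hi * action_error t) + b_hi * tracker_deviation t + \<iota>\<^sup>2 * L\<^sup>2 * n * (consensus_error t / C_lo\<^sup>2)))"
      by (rule order_trans[OF action_change])
  qed (use \<tau>2_nonneg n in simp)
  also have "\<dots> = 3 * b_hi * n * \<tau>2 * C_up\<^sup>2 * \<iota>\<^sup>2 * L\<^sup>2 * size_cube_sum * \<gamma>M\<^sup>2 * action_error t
    + 3 * b_hi * n * \<tau>2 * C_up\<^sup>2 * \<gamma>M\<^sup>2 * tracker_deviation t
    + ((1 + s2\<^sup>2) / 2 + 3 * n\<^sup>2 * \<tau>2 * C_up\<^sup>2 * \<iota>\<^sup>2 * L\<^sup>2 / C_lo\<^sup>2 * \<gamma>M\<^sup>2) * consensus_error t"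
    by (simp add: algebra_simps power2_eq_square)
  finally show ?thesis .
qed

text \<open>
  The change of the estimates is the current error minus its image under a contraction, whatever the
  actions do.
\<close>

lemma estimate_change_bound:
  "(\<Sum>l\<in>UNIV. (norm (y (Suc t) $ l - y t $ l))\<^sup>2) \<le> (1 + s2)\<^sup>2 / C_lo\<^sup>2 * consensus_error t"
proof -
  have "(\<Sum>l\<in>UNIV. (norm (y (Suc t) $ l - y t $ l))\<^sup>2)
      = (\<Sum>q\<in>UNIV. (norm (column q (y (Suc t)) - column q (y t)))\<^sup>2)"
    unfolding norm_cart_sq by (subst sum.swap) (simp add: column_def)
  also have "\<dots> \<le> (\<Sum>q\<in>UNIV. (1 + s2)\<^sup>2 / C_lo\<^sup>2 * (monotone_hull f (estimate_err t q))\<^sup>2)"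
  proof (rule sum_mono)
    fix q
    have "C_lo * norm (column q (y (Suc t)) - column q (y t)) \<le> monotone_hull f (estimate_err t q - error_matrix q *v estimate_err t q)"
      unfolding estimate_change using C_lo by (intro monotone_hull_lower[OF f]) simp_all
    also have "\<dots> \<le> monotone_hull f (estimate_err t q) + \<sigma>2 q * monotone_hull f (estimate_err t q)"
      by (rule order_trans[OF monotone_hull_diff[OF f] add_left_mono[OF monotone_hull_error_matrix]])
    also have "\<dots> \<le> (1 + s2) * monotone_hull f (estimate_err t q)"
      using mult_right_mono[OF s2[of q] monotone_hull_nonneg[OF f, of "estimate_err t q"]] by (simp add: algebra_simps)
    finally have "(C_lo * norm (column q (y (Suc t)) - column q (y t)))\<^sup>2 \<le> ((1 + s2) * monotone_hull f (estimate_err t q))\<^sup>2"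
      using C_lo(1) by (intro power_mono) simp_all
    then show "(norm (column q (y (Suc t)) - column q (y t)))\<^sup>2 \<le> (1 + s2)\<^sup>2 / C_lo\<^sup>2 * (monotone_hull f (estimate_err t q))\<^sup>2"
      using C_lo(1) by (simp add: power_mult_distrib le_divide_eq mult.commute)
  qed
  finally show ?thesis by (simp add: consensus_error_def sum_distrib_left)
qed

lemma \<tau>1_nonneg: "\<tau>1 \<ge> 0"
proof -
  fix i :: 'c
  have "weighted_matrix_norm (cluster cl i) bw (A i - limit_matrix (A i)) < 1"
    using stochastic_block.deviation_contracts[OF block] stochastic_block.limit_matrix_eq[OF block] by simp
  from one_minus_sq_pos[OF weighted_matrix_norm_nonneg this] show ?thesis
    by (intro order_trans[OF _ \<tau>1[of i]]) simp
qed

text \<open>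
  The perturbation of the trackers is the change of the local partial derivatives, which is controlled
  by the change of the estimates.
\<close>

lemma tracker_deviation_step:
  "tracker_deviation (Suc t) \<le> (1 + s1\<^sup>2) / 2 * tracker_deviation t + \<tau>1 * n * L\<^sup>2 * (1 + s2)\<^sup>2 / (b_lo * C_lo\<^sup>2) * consensus_error t"
proof -
  define dev where "dev t i k = weighted_norm (cluster cl i) bw (column k (g t) - limit_matrix (A i) *v column k (g t))" for t i k
  define change where "change i = (\<Sum>p\<in>cluster cl i. (norm (y (Suc t) $ p - y t $ p))\<^sup>2)" for i
  have change_nonneg: "change i \<ge> 0" for i unfolding change_def by (intro sum_nonneg) simp
  have step: "(dev (Suc t) i k)\<^sup>2 \<le> (1 + s1\<^sup>2) / 2 * (dev t i k)\<^sup>2 + \<tau>1 * (L\<^sup>2 / b_lo * change i)"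
    if k: "k \<in> cluster cl i" for i k
  proof -
    define \<sigma> where "\<sigma> = weighted_matrix_norm (cluster cl i) bw (A i - limit_matrix (A i))"
    have \<sigma>: "0 \<le> \<sigma>" "\<sigma> < 1"
      using stochastic_block.deviation_contracts[OF block] stochastic_block.limit_matrix_eq[OF block]
      by (simp_all add: \<sigma>_def weighted_matrix_norm_nonneg)
    define d :: "real ^ 'v" where "d = (\<chi> p. partial_deriv k (J p) (y (Suc t) $ p) - partial_deriv k (J p) (y t $ p))"
    have "dev (Suc t) i k \<le> \<sigma> * dev t i k + weighted_norm (cluster cl i) bw d"
      unfolding dev_def \<sigma>_def stochastic_block.limit_matrix_eq[OF block]
    proof (rule stochastic_block.tracking_step[OF block])
      fix p assume "p \<in> cluster cl i"
      then have "cl p = i" by (simp add: cluster_def)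
      then show "column k (g (Suc t)) $ p = (\<Sum>q\<in>cluster cl i. A i $ p $ q * column k (g t) $ q) + d $ p"
        using g_step[of k p t] k by (simp add: column_def d_def)
    qed
    then have "(dev (Suc t) i k)\<^sup>2 \<le> (\<sigma> * dev t i k + weighted_norm (cluster cl i) bw d)\<^sup>2"
      by (intro power_mono) (simp_all add: dev_def weighted_norm_nonneg)
    also have "\<dots> \<le> (1 + \<sigma>\<^sup>2) / 2 * (dev t i k)\<^sup>2 + (1 + \<sigma>\<^sup>2) / (1 - \<sigma>\<^sup>2) * (weighted_norm (cluster cl i) bw d)\<^sup>2"
      by (rule contraction_square_bound) (rule \<sigma>)+
    also have "\<dots> \<le> (1 + s1\<^sup>2) / 2 * (dev t i k)\<^sup>2 + \<tau>1 * (weighted_norm (cluster cl i) bw d)\<^sup>2"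
      using power_mono[OF s1[of i] weighted_matrix_norm_nonneg, of 2] \<tau>1[of i] unfolding \<sigma>_def
      by (intro add_mono mult_right_mono) simp_all
    also have "(weighted_norm (cluster cl i) bw d)\<^sup>2 \<le> L\<^sup>2 / b_lo * change i"
    proof -
      have "(weighted_norm (cluster cl i) bw d)\<^sup>2 = (\<Sum>p\<in>cluster cl i. (d $ p)\<^sup>2 / bw $ p)"
        by (rule weighted_norm_sq) (rule bw_pos)
      also have "\<dots> \<le> (\<Sum>p\<in>cluster cl i. L\<^sup>2 / b_lo * (norm (y (Suc t) $ p - y t $ p))\<^sup>2)"
      proof (rule sum_mono)
        fix p assume p: "p \<in> cluster cl i"
        then have "p \<in> peers k" using k by (simp add: cluster_def)
        from power_mono[OF partial_lipschitz[OF this], of "y (Suc t) $ p" "y t $ p" 2]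
        have "(d $ p)\<^sup>2 \<le> L\<^sup>2 * (norm (y (Suc t) $ p - y t $ p))\<^sup>2"
          by (simp add: d_def power_mult_distrib)
        then have "(d $ p)\<^sup>2 / bw $ p \<le> L\<^sup>2 * (norm (y (Suc t) $ p - y t $ p))\<^sup>2 / b_lo"
          using b_lo by (intro frac_le) simp_all
        then show "(d $ p)\<^sup>2 / bw $ p \<le> L\<^sup>2 / b_lo * (norm (y (Suc t) $ p - y t $ p))\<^sup>2" by simp
      qed
      finally show ?thesis by (simp add: change_def sum_distrib_left)
    qed
    finally show ?thesis using \<tau>1_nonneg by (simp add: mult_left_mono)
  qed
  have "tracker_deviation (Suc t) \<le> (\<Sum>i\<in>UNIV. \<Sum>k\<in>cluster cl i. (1 + s1\<^sup>2) / 2 * (dev t i k)\<^sup>2 + \<tau>1 * (L\<^sup>2 / b_lo * change i))"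
    unfolding tracker_deviation_def dev_def[symmetric] by (intro sum_mono step)
  also have "\<dots> = (1 + s1\<^sup>2) / 2 * tracker_deviation t + (\<Sum>i\<in>UNIV. real (card (cluster cl i)) * (\<tau>1 * (L\<^sup>2 / b_lo * change i)))"
    unfolding tracker_deviation_def dev_def[symmetric] by (simp add: sum.distrib sum_distrib_left)
  also have "\<dots> \<le> (1 + s1\<^sup>2) / 2 * tracker_deviation t + (\<Sum>i\<in>UNIV. n * (\<tau>1 * (L\<^sup>2 / b_lo * change i)))"
    using \<tau>1_nonneg b_lo(1) change_nonneg
    by (intro add_left_mono sum_mono mult_right_mono csize_le) simp
  also have "\<dots> = (1 + s1\<^sup>2) / 2 * tracker_deviation t + n * \<tau>1 * L\<^sup>2 / b_lo * (\<Sum>l\<in>UNIV. (norm (y (Suc t) $ l - y t $ l))\<^sup>2)"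
    unfolding sum_by_cluster[of "\<lambda>l. (norm (y (Suc t) $ l - y t $ l))\<^sup>2" cl] change_def[symmetric]
    by (simp add: sum_distrib_left sum_distrib_right sum_divide_distrib mult_ac)
  also have "\<dots> \<le> (1 + s1\<^sup>2) / 2 * tracker_deviation t + n * \<tau>1 * L\<^sup>2 / b_lo * ((1 + s2)\<^sup>2 / C_lo\<^sup>2 * consensus_error t)"
    using \<tau>1_nonneg b_lo(1) by (intro add_left_mono mult_left_mono estimate_change_bound) (simp add: n)
  also have "n * \<tau>1 * L\<^sup>2 / b_lo * ((1 + s2)\<^sup>2 / C_lo\<^sup>2 * consensus_error t)
      = \<tau>1 * n * L\<^sup>2 * (1 + s2)\<^sup>2 / (b_lo * C_lo\<^sup>2) * consensus_error t" by (simp add: mult_ac)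
  finally show ?thesis .
qed

end

section \<open>Admissible step-sizes\<close>

text \<open>
  The vector \<open>(\<nu>, 2 * k11, k10)\<close> is decreased by \<open>T\<close>. Here \<open>h\<close> is the largest step-size and \<open>c\<close> the
  average one. For vanishing \<open>h\<close> the last two rows leave the gaps \<open>k10 * k11\<close> and \<open>k10 * k16\<close>. In the
  first row the terms with \<open>h\<^sup>2 / c\<close> are, relative to \<open>c\<close>, only bounded by \<open>n\<^sup>2 * (2 * k5 * k11 + k7 * k10)\<close>,
  and \<open>\<nu>\<close> is chosen such that \<open>a * \<nu>\<close> exceeds this by \<open>n\<^sup>2 * k7 * k10\<close>. The numbers \<open>q1\<close>, \<open>q2\<close>, \<open>q3\<close> are \<open>a\<close>
  times the coefficients of the remaining terms, which have to fit into these gaps.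
\<close>

lemma small_step_decrease:
  fixes n a h c k2 k4 k5 k6 k7 k8 k9 k10 k11 k12 k13 k14 k15 k16 :: real
  assumes n: "n \<ge> 1" and a: "a > 0" and c: "c > 0" "h > 0" "h \<le> n * c"
    and pos: "k2 > 0" "k4 > 0" "k5 > 0" "k6 > 0" "k7 > 0" "k8 > 0" "k9 > 0" "k10 > 0" "k11 > 0" "k12 > 0"
      "k13 > 0" "k14 > 0" "k15 > 0" "k16 > 0"
    and q1: "q1 = 2 * n\<^sup>2 * k2 * (k5 * k11 + k7 * k10) + (2 * k4 * k11 + k6 * k10) * a"
    and q2: "q2 = 2 * n\<^sup>2 * k8 * (k5 * k11 + k7 * k10) + (2 * k9 * k11 + k10 * k12) * a"
    and q3: "q3 = 2 * n\<^sup>2 * k13 * (k5 * k11 + k7 * k10) + (2 * k11 * k14 + k10 * k15) * a"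
    and h: "h < k7 * k10 * a / q1" "h < sqrt (k10 * k11 * a / q2)" "h < sqrt (k10 * k16 * a / q3)"
    and \<nu>: "\<nu> = 2 * n\<^sup>2 * (k5 * k11 + k7 * k10) / a"
  shows "(1 - a * c + k2 * h\<^sup>2) * \<nu> + (k4 * h\<^sup>2 + k5 * h\<^sup>2 / c) * (2 * k11) + (k6 * h\<^sup>2 + k7 * h\<^sup>2 / c) * k10 < \<nu>"
    and "k8 * h\<^sup>2 * \<nu> + (1 - k10 + k9 * h\<^sup>2) * (2 * k11) + (k11 + k12 * h\<^sup>2) * k10 < 2 * k11"
    and "k13 * h\<^sup>2 * \<nu> + k14 * h\<^sup>2 * (2 * k11) + (1 - k16 + k15 * h\<^sup>2) * k10 < k10"
    and "\<nu> > 0"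
proof -
  have kk: "k5 * k11 + k7 * k10 > 0" using pos by (simp add: add_pos_pos)
  show \<nu>_pos: "\<nu> > 0" unfolding \<nu> using n a kk by simp
  have a\<nu>: "a * \<nu> = 2 * n\<^sup>2 * (k5 * k11 + k7 * k10)" using a by (simp add: \<nu>)
  have scale: "2 * n\<^sup>2 * k * (k5 * k11 + k7 * k10) = a * (k * \<nu>)" for k
  proof -
    have "2 * n\<^sup>2 * k * (k5 * k11 + k7 * k10) = k * (a * \<nu>)" unfolding a\<nu> by (simp add: mult_ac)
    also have "\<dots> = a * (k * \<nu>)" by (rule mult.left_commute)
    finally show ?thesis .
  qed
  have q1': "q1 = a * (k2 * \<nu> + 2 * k4 * k11 + k6 * k10)"
    and q2': "q2 = a * (k8 * \<nu> + 2 * k9 * k11 + k10 * k12)"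
    and q3': "q3 = a * (k13 * \<nu> + 2 * k11 * k14 + k10 * k15)"
    unfolding q1 q2 q3 scale by (simp_all add: algebra_simps)
  have q_pos: "q1 > 0" "q2 > 0" "q3 > 0"
    unfolding q1' q2' q3' using a pos \<nu>_pos by (simp_all add: add_pos_pos)
  have sq: "h\<^sup>2 < r" if "h < sqrt r" for r
    using that c(2) real_less_rsqrt[of h r] by (metis less_imp_le not_le order_trans real_le_lsqrt)
  have "h\<^sup>2 * q2 < k10 * k11 * a" using sq[OF h(2)] q_pos by (simp add: less_divide_eq)
  then have 2: "h\<^sup>2 * (k8 * \<nu> + 2 * k9 * k11 + k10 * k12) < k10 * k11"
    unfolding q2' using a by (simp add: mult.left_commute[of _ a] mult.commute[of _ a])
  then show "k8 * h\<^sup>2 * \<nu> + (1 - k10 + k9 * h\<^sup>2) * (2 * k11) + (k11 + k12 * h\<^sup>2) * k10 < 2 * k11"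
    by (simp add: algebra_simps)
  have "h\<^sup>2 * q3 < k10 * k16 * a" using sq[OF h(3)] q_pos by (simp add: less_divide_eq)
  then have 3: "h\<^sup>2 * (k13 * \<nu> + 2 * k11 * k14 + k10 * k15) < k10 * k16"
    unfolding q3' using a by (simp add: mult.left_commute[of _ a] mult.commute[of _ a])
  then show "k13 * h\<^sup>2 * \<nu> + k14 * h\<^sup>2 * (2 * k11) + (1 - k16 + k15 * h\<^sup>2) * k10 < k10"
    by (simp add: algebra_simps)
  have "h * q1 < k7 * k10 * a" using h(1) q_pos by (simp add: less_divide_eq)
  then have 1: "h * (k2 * \<nu> + 2 * k4 * k11 + k6 * k10) < k7 * k10"
    unfolding q1' using a by (simp add: mult.left_commute[of _ a] mult.commute[of _ a])
  have h_c: "h / c \<le> n" using c by (simp add: divide_le_eq)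
  have "c * (h * (h / c) * (k2 * \<nu> + 2 * k4 * k11 + k6 * k10) + (h / c)\<^sup>2 * (2 * k5 * k11 + k7 * k10) - a * \<nu>) < 0"
  proof (rule mult_pos_neg[OF c(1)])
    have "h * (h / c) * (k2 * \<nu> + 2 * k4 * k11 + k6 * k10) \<le> n * (h * (k2 * \<nu> + 2 * k4 * k11 + k6 * k10))"
      using mult_right_mono[OF h_c, of "h * (k2 * \<nu> + 2 * k4 * k11 + k6 * k10)"] pos \<nu>_pos c by (simp add: mult_ac)
    also have "\<dots> < n * (k7 * k10)" using 1 n by (intro mult_strict_left_mono) simp_all
    also have "\<dots> \<le> n\<^sup>2 * (k7 * k10)" using n pos by (intro mult_right_mono) (simp_all add: power2_eq_square)
    finally have "h * (h / c) * (k2 * \<nu> + 2 * k4 * k11 + k6 * k10) < n\<^sup>2 * (k7 * k10)" .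
    moreover have "(h / c)\<^sup>2 * (2 * k5 * k11 + k7 * k10) \<le> n\<^sup>2 * (2 * k5 * k11 + k7 * k10)"
      using h_c c pos by (intro mult_right_mono power_mono) (simp_all add: less_imp_le add_nonneg_nonneg)
    ultimately show "h * (h / c) * (k2 * \<nu> + 2 * k4 * k11 + k6 * k10) + (h / c)\<^sup>2 * (2 * k5 * k11 + k7 * k10) - a * \<nu> < 0"
      unfolding a\<nu> by (simp add: algebra_simps)
  qed
  moreover have "c * (h * (h / c) * (k2 * \<nu> + 2 * k4 * k11 + k6 * k10) + (h / c)\<^sup>2 * (2 * k5 * k11 + k7 * k10) - a * \<nu>)
      = (1 - a * c + k2 * h\<^sup>2) * \<nu> + (k4 * h\<^sup>2 + k5 * h\<^sup>2 / c) * (2 * k11) + (k6 * h\<^sup>2 + k7 * h\<^sup>2 / c) * k10 - \<nu>"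
    using c(1) by (simp add: field_simps power2_eq_square)
  ultimately show "(1 - a * c + k2 * h\<^sup>2) * \<nu> + (k4 * h\<^sup>2 + k5 * h\<^sup>2 / c) * (2 * k11) + (k6 * h\<^sup>2 + k7 * h\<^sup>2 / c) * k10 < \<nu>"
    by linarith
qed

section \<open>Linear convergence\<close>

theorem theorem1:
  fixes cl :: "'v::finite \<Rightarrow> 'c::finite"
    and J :: "'v \<Rightarrow> real ^ 'v \<Rightarrow> real"
    and G :: "'c \<Rightarrow> 'v pair_pre_digraph" and A :: "'c \<Rightarrow> real ^ 'v ^ 'v"
    and Gbar :: "'v pair_pre_digraph" and Abar :: "real ^ 'v ^ 'v"
    and L \<mu> :: real
    and w :: "real ^ 'v"
    and normE :: "real ^ 'v ^ 'v \<Rightarrow> real" and norme :: "real ^ 'v \<Rightarrow> real"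
    and C_lo C_up :: real
    and \<delta> \<gamma> :: "real ^ 'v"
    and x :: "nat \<Rightarrow> real ^ 'v" and y g :: "nat \<Rightarrow> real ^ 'v ^ 'v"
    and xstar :: "real ^ 'v"
    and V :: "'c \<Rightarrow> 'v set" and n S :: real
    and \<iota> :: real and bw :: "real ^ 'v" and bw_min bw_max :: real
    and \<sigma>1 :: "'c \<Rightarrow> real" and \<sigma>1_max \<tau>1 :: real
    and \<sigma>2 :: "'v \<Rightarrow> real" and \<sigma>2_max \<tau>2 :: real
    and \<gamma>M \<gamma>avg \<epsilon> :: real
    and k1 k2 k3 k4 k5 k6 k7 k8 k9 k10 k11 k12 k13 k14 k15 k16 :: real
    and q1 q2 q3 \<gamma>1 \<gamma>2 \<gamma>3 :: real
    and T :: "real Matrix.mat"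
  assumes V_def: "V = cluster cl"
    and n_def: "n = real CARD('v)"
    and S_def: "S = (\<Sum>i\<in>UNIV. real (card (V i)) ^ 3)"
    \<comment> \<open>\<open>w\<close> stacks the Perron vectors of all clusters, \<open>bw\<close> rescales each by the cluster size\<close>
    and \<iota>_def: "\<iota> = Max (range (\<lambda>i. L2_set (\<lambda>p. w $ p) (V i)))"
    and bw_def: "bw = (\<chi> p. real (card (V (cl p))) * w $ p)"
    and bw_min_def: "bw_min = Min (range (\<lambda>p. bw $ p))"
    and bw_max_def: "bw_max = Max (range (\<lambda>p. bw $ p))"
    and \<sigma>1_def: "\<sigma>1 = (\<lambda>i. weighted_matrix_norm (V i) bw (A i - limit_matrix (A i)))"
    and \<sigma>1_max_def: "\<sigma>1_max = Max (range \<sigma>1)"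
    and \<tau>1_def: "\<tau>1 = Max (range (\<lambda>i. (1 + (\<sigma>1 i)\<^sup>2) / (1 - (\<sigma>1 i)\<^sup>2)))"
    and \<sigma>2_def: "\<sigma>2 = (\<lambda>q. normE (A_tilde Abar \<delta> q))"
    and \<sigma>2_max_def: "\<sigma>2_max = Max (range \<sigma>2)"
    and \<tau>2_def: "\<tau>2 = Max (range (\<lambda>q. (1 + (\<sigma>2 q)\<^sup>2) / (1 - (\<sigma>2 q)\<^sup>2)))"
    and \<gamma>M_def: "\<gamma>M = Max (range (\<lambda>p. \<gamma> $ p))"
    and \<gamma>avg_def: "\<gamma>avg = (\<Sum>p\<in>UNIV. \<gamma> $ p) / n"
    and \<epsilon>_def: "\<epsilon> = norm (\<gamma> - (\<chi> p. \<gamma>avg)) / norm ((\<chi> p. \<gamma>avg) :: real ^ 'v)"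
    and k1_def: "k1 = bw_min * \<mu>"
    and k2_def: "k2 = 3 * bw_max * \<iota>\<^sup>2 * L\<^sup>2 / bw_min * S"
    and k3_def: "k3 = 2 * bw_max * sqrt n * L"
    and k4_def: "k4 = 3 * bw_max / bw_min"
    and k5_def: "k5 = 2 / (bw_min * \<mu>)"
    and k6_def: "k6 = 3 * n\<^sup>2 * \<iota>\<^sup>2 * L\<^sup>2 / (bw_min * C_lo\<^sup>2)"
    and k7_def: "k7 = 2 * bw_max * n * L\<^sup>2 / (bw_min * C_lo\<^sup>2 * \<mu>)"
    and k8_def: "k8 = 9 * bw_max * n\<^sup>2 * \<tau>1 * (1 + n * \<tau>2 * C_up\<^sup>2) * \<iota>\<^sup>2 * L ^ 4 / bw_min * S"
    and k9_def: "k9 = 9 * bw_max * n\<^sup>2 * \<tau>1 * (1 + n * \<tau>2 * C_up\<^sup>2) * L\<^sup>2 / bw_min * S"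
    and k10_def: "k10 = (1 - \<sigma>1_max\<^sup>2) / 2"
    and k11_def: "k11 = 3 * n * \<tau>1 * (3 + \<sigma>2_max\<^sup>2) * L\<^sup>2 / (2 * bw_min * C_lo\<^sup>2)"
    and k12_def: "k12 = 9 * n ^ 4 * \<tau>1 * (1 + n * \<tau>2 * C_up\<^sup>2) * \<iota>\<^sup>2 * L ^ 4 / (bw_min * C_lo\<^sup>2)"
    and k13_def: "k13 = 3 * bw_max * n * \<tau>2 * C_up\<^sup>2 * \<iota>\<^sup>2 * L\<^sup>2 * S"
    and k14_def: "k14 = 3 * bw_max * n * \<tau>2 * C_up\<^sup>2"
    and k15_def: "k15 = 3 * n ^ 3 * \<tau>2 * C_up\<^sup>2 * \<iota>\<^sup>2 * L\<^sup>2 / C_lo\<^sup>2"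
    and k16_def: "k16 = (1 - \<sigma>2_max\<^sup>2) / 2"
    and q1_def: "q1 = 2 * n\<^sup>2 * k2 * (k5 * k11 + k7 * k10)
                + (2 * k4 * k11 + k6 * k10) * (k1 - k3 * \<epsilon>)"
    and q2_def: "q2 = 2 * n\<^sup>2 * k8 * (k5 * k11 + k7 * k10)
                + (2 * k9 * k11 + k10 * k12) * (k1 - k3 * \<epsilon>)"
    and q3_def: "q3 = 2 * n\<^sup>2 * k13 * (k5 * k11 + k7 * k10)
                + (2 * k11 * k14 + k10 * k15) * (k1 - k3 * \<epsilon>)"
    and \<gamma>1_def: "\<gamma>1 = k7 * k10 * (k1 - k3 * \<epsilon>) / q1"
    and \<gamma>2_def: "\<gamma>2 = sqrt (k10 * k11 * (k1 - k3 * \<epsilon>) / q2)"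
    and \<gamma>3_def: "\<gamma>3 = sqrt (k10 * k16 * (k1 - k3 * \<epsilon>) / q3)"
    and T_def: "T = mat_of_rows_list 3
      [[1 - k1 * \<gamma>avg + k2 * \<gamma>M\<^sup>2 + k3 * \<epsilon> * \<gamma>avg,
        k4 * \<gamma>M\<^sup>2 + k5 * \<gamma>M\<^sup>2 / \<gamma>avg,
        k6 * \<gamma>M\<^sup>2 + k7 * \<gamma>M\<^sup>2 / \<gamma>avg],
       [k8 * \<gamma>M\<^sup>2, 1 - k10 + k9 * \<gamma>M\<^sup>2, k11 + k12 * \<gamma>M\<^sup>2],
       [k13 * \<gamma>M\<^sup>2, k14 * \<gamma>M\<^sup>2, 1 - k16 + k15 * \<gamma>M\<^sup>2]]"
    and clusters_nonempty: "surj cl"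
    and G_digraph: "\<And>i. pair_wf_digraph (G i)" "\<And>i. pverts (G i) = V i" "\<And>i. all_loops (G i)"
    and A_adjacency: "\<And>i. adjacency_matrix (G i) (A i)"
    and G_connected: "\<And>i. strongly_connected (with_proj (G i))"
    and A_stochastic: "\<And>i. column_stochastic_on (V i) (A i)"
    and Gbar_digraph: "pair_wf_digraph Gbar" "pverts Gbar = UNIV" "all_loops Gbar"
    and Abar_adjacency: "adjacency_matrix Gbar Abar"
    and Gbar_connected: "strongly_connected (with_proj Gbar)"
    and Abar_stochastic: "row_stochastic Abar"
    and J_convex: "\<And>p. convex_in_block (V (cl p)) (J p)"
    and J_C1: "\<And>p. continuously_differentiable_in_block (V (cl p)) (J p)"
    and J_lipschitz: "\<And>p k. k \<in> V (cl p) \<Longrightarrow> L-lipschitz_on UNIV (partial_deriv k (J p))"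
    and \<mu>_pos: "\<mu> > 0"
    and F_monotone: "strongly_monotone \<mu> (game_mapping cl J)"
    and NE: "nash_equilibrium cl J xstar"
    \<comment> \<open>Perron vectors, and the norms fixed in terms of \<open>\<delta>\<close>\<close>
    and perron: "\<And>i. perron_vector_on (V i) (A i) w"
    and \<delta>_pos: "\<And>p. \<delta> $ p > 0"
    and \<delta>_bound: "\<And>p q. 0 \<le> \<delta> $ p * Abar $ p $ q \<and> \<delta> $ p * Abar $ p $ q < 2 * Abar $ p $ p"
    and normE: "is_matrix_norm normE" "\<And>q. normE (A_tilde Abar \<delta> q) < 1"
    and norme: "is_norm norme" "\<And>M v. norme (M *v v) \<le> normE M * norme v"
    and C_pos: "C_lo > 0" "C_up > 0"
    and norme_equiv: "\<And>v. C_lo * norm v \<le> norme v \<and> norme v \<le> C_up * norm v"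
    \<comment> \<open>algorithm: \<open>y t $ p\<close> is the estimate vector of agent \<open>p\<close>, and \<open>g t $ p $ k\<close>
        is the tracker of agent \<open>p\<close> for the agent \<open>k\<close> of the same cluster\<close>
    and y_step: "\<And>t p q. y (Suc t) $ p $ q =
        (\<Sum>l\<in>UNIV. Abar $ p $ l * y t $ l $ q) + \<delta> $ p * Abar $ p $ q * (x t $ q - y t $ p $ q)"
    and x_step: "\<And>t p. x (Suc t) $ p = x t $ p - \<gamma> $ p * g t $ p $ p"
    and g_init: "\<And>p k. k \<in> V (cl p) \<Longrightarrow> g 0 $ p $ k = partial_deriv k (J p) (y 0 $ p)"
    and g_step: "\<And>t p k. k \<in> V (cl p) \<Longrightarrow> g (Suc t) $ p $ k =
        (\<Sum>l\<in>V (cl p). A (cl p) $ p $ l * g t $ l $ k)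
        + partial_deriv k (J p) (y (Suc t) $ p) - partial_deriv k (J p) (y t $ p)"
    and \<gamma>_pos: "\<And>p. \<gamma> $ p > 0"
    and \<epsilon>_bound: "0 \<le> \<epsilon>" "\<epsilon> < k1 / k3"
    and \<gamma>M_bound: "0 < \<gamma>M" "\<gamma>M < Min {1 / k1, \<gamma>1, \<gamma>2, \<gamma>3}"
  shows "spec_radius_real T < 1 \<and>
    converges_linearly_to_0
      (sup_tail (\<lambda>l. (weighted_norm UNIV bw (x l - xstar))\<^sup>2))
      (spec_radius_real T) \<and>
    converges_linearly_to_0
      (sup_tail (\<lambda>l. \<Sum>i\<in>UNIV. \<Sum>k\<in>V i.
         (weighted_norm (V i) bw (column k (g l) - limit_matrix (A i) *v column k (g l)))\<^sup>2))
      (spec_radius_real T) \<and>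
    converges_linearly_to_0
      (sup_tail (\<lambda>l. \<Sum>q\<in>UNIV. (norme ((\<chi> p. x l $ q) - column q (y l)))\<^sup>2))
      (spec_radius_real T)"
proof -
  have n_ge: "n \<ge> 1" by (simp add: n_def Suc_leI)
  have block: "stochastic_block (G i) (A i) w bw (cluster cl i) (real (card (cluster cl i)))" for i
  proof (rule stochastic_block.intro)
    obtain p where "cl p = i" using clusters_nonempty by (metis surjD)
    then have "cluster cl i \<noteq> {}" by (auto simp: cluster_def)
    then show "real (card (cluster cl i)) > 0" by (simp add: card_gt_0_iff)
    show "bw $ p = real (card (cluster cl i)) * w $ p" if "p \<in> cluster cl i" for p
      using that by (simp add: bw_def V_def cluster_def)
  qed (use G_digraph A_adjacency G_connected A_stochastic perron in \<open>simp_all add: V_def\<close>)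
  interpret game: smooth_cluster_game cl J L
    using J_C1 J_lipschitz by unfold_locales (simp_all add: V_def)
  have L_pos: "L > 0" using game.lipschitz_const_pos[OF F_monotone \<mu>_pos] .
  have card_pos: "real (card (cluster cl i)) > 0" for i
    using stochastic_block.m_pos[OF block] .
  have w_pos: "w $ p > 0" for p
    using stochastic_block.w_pos[OF block[of "cl p"], of p] by (simp add: cluster_def)
  have bw_pos: "bw $ p > 0" for p
    using w_pos card_pos by (simp add: bw_def V_def)
  have bw_min: "bw_min > 0" "bw_min \<le> bw $ p" and bw_max: "bw $ p \<le> bw_max" for p
    unfolding bw_min_def bw_max_def using bw_pos by (simp_all add: Min_gr_iff)
  have bw_max_pos: "bw_max > 0" using less_le_trans[OF bw_pos bw_max] .
  have \<sigma>1: "0 \<le> \<sigma>1 i" "\<sigma>1 i < 1" for i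
    using stochastic_block.deviation_contracts[OF block, of i] stochastic_block.limit_matrix_eq[OF block, of i]
    by (simp_all add: \<sigma>1_def V_def weighted_matrix_norm_nonneg)
  have \<sigma>1_max: "\<sigma>1 i \<le> \<sigma>1_max" "0 \<le> \<sigma>1_max" "\<sigma>1_max < 1" for i
  proof -
    show *: "\<sigma>1 i \<le> \<sigma>1_max" for i by (simp add: \<sigma>1_max_def)
    show "0 \<le> \<sigma>1_max" using order_trans[OF \<sigma>1(1) *] .
    show "\<sigma>1_max < 1" using \<sigma>1 by (simp add: \<sigma>1_max_def)
  qed
  have \<sigma>2: "0 \<le> \<sigma>2 q" "\<sigma>2 q < 1" for q
    using normE by (simp_all add: \<sigma>2_def is_matrix_norm_def is_norm_def)
  have \<sigma>2_max: "\<sigma>2 q \<le> \<sigma>2_max" "0 \<le> \<sigma>2_max" "\<sigma>2_max < 1" for q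
  proof -
    show *: "\<sigma>2 q \<le> \<sigma>2_max" for q by (simp add: \<sigma>2_max_def)
    show "0 \<le> \<sigma>2_max" using order_trans[OF \<sigma>2(1) *] .
    show "\<sigma>2_max < 1" using \<sigma>2 by (simp add: \<sigma>2_max_def)
  qed
  have ratio: "(1 + s\<^sup>2) / (1 - s\<^sup>2) \<ge> 1" if "0 \<le> s" "s < 1" for s :: real
    using that by (simp add: le_divide_eq power_less_one_iff)
  have \<tau>1: "(1 + (\<sigma>1 i)\<^sup>2) / (1 - (\<sigma>1 i)\<^sup>2) \<le> \<tau>1" for i by (simp add: \<tau>1_def)
  have \<tau>2: "(1 + (\<sigma>2 q)\<^sup>2) / (1 - (\<sigma>2 q)\<^sup>2) \<le> \<tau>2" for q by (simp add: \<tau>2_def)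
  have \<tau>_pos: "\<tau>1 > 0" "\<tau>2 > 0"
    using order_trans[OF ratio[OF \<sigma>1] \<tau>1] order_trans[OF ratio[OF \<sigma>2] \<tau>2] by simp_all
  have \<iota>: "L2_set (\<lambda>p. w $ p) (cluster cl i) \<le> \<iota>" for i by (simp add: \<iota>_def V_def)
  have \<iota>_pos: "\<iota> > 0"
  proof -
    fix p
    have "0 < w $ p" by (rule w_pos)
    also have "\<dots> \<le> L2_set (\<lambda>p. w $ p) (cluster cl (cl p))"
      using w_pos by (intro member_le_L2_set) (simp_all add: cluster_def less_imp_le)
    also note \<iota>
    finally show ?thesis .
  qed
  have S_pos: "S > 0"
    unfolding S_def V_def using card_pos by (intro sum_pos) simp_all
  have \<gamma>_le: "\<gamma> $ p \<le> \<gamma>M" for p by (simp add: \<gamma>M_def)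
  have \<gamma>avg_pos: "\<gamma>avg > 0"
    unfolding \<gamma>avg_def using \<gamma>_pos n_ge by (intro divide_pos_pos sum_pos) simp_all
  have \<gamma>avg_le: "\<gamma>avg \<le> \<gamma>M"
  proof -
    have "(\<Sum>p\<in>UNIV. \<gamma> $ p) \<le> (\<Sum>p\<in>(UNIV :: 'v set). \<gamma>M)" by (intro sum_mono \<gamma>_le)
    then show ?thesis using n_ge by (simp add: \<gamma>avg_def n_def divide_le_eq mult.commute)
  qed
  have \<gamma>M_le: "\<gamma>M \<le> n * \<gamma>avg"
  proof -
    have "\<gamma>M \<in> range (\<lambda>p. \<gamma> $ p)" unfolding \<gamma>M_def by (intro Max_in) simp_all
    then obtain p where "\<gamma>M = \<gamma> $ p" by blast
    also have "\<dots> \<le> (\<Sum>p\<in>UNIV. \<gamma> $ p)" using \<gamma>_pos by (intro member_le_sum) (simp_all add: less_imp_le)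
    finally show ?thesis using n_ge by (simp add: \<gamma>avg_def)
  qed
  have heterogeneity: "norm (\<gamma> - (\<chi> p. \<gamma>avg)) \<le> \<epsilon> * \<gamma>avg * sqrt n"
  proof -
    have "norm ((\<chi> p. \<gamma>avg) :: real ^ 'v) = sqrt (n * \<gamma>avg\<^sup>2)"
      by (simp add: norm_vec_def L2_set_def n_def)
    also have "\<dots> = \<gamma>avg * sqrt n" using \<gamma>avg_pos by (simp add: real_sqrt_mult)
    finally have "\<epsilon> * (\<gamma>avg * sqrt n) = norm (\<gamma> - (\<chi> p. \<gamma>avg))"
      using \<gamma>avg_pos n_ge by (simp add: \<epsilon>_def)
    then show ?thesis by (simp add: mult.assoc)
  qed
  interpret trk: gradient_tracking cl J L G A w bw Abar \<delta> \<gamma> x y g xstar norme C_lo C_up \<mu> bw_min bw_max \<iota>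
    \<sigma>1_max \<tau>1 \<sigma>2_max \<tau>2 \<gamma>M \<gamma>avg \<epsilon> n \<sigma>2
  proof (rule gradient_tracking.intro[OF game.smooth_cluster_game_axioms gradient_tracking_axioms.intro])
    show "norme (A_tilde Abar \<delta> q *v v) \<le> \<sigma>2 q * norme v" for q v
      unfolding \<sigma>2_def by (rule norme(2))
    show "Abar $ p $ q \<ge> 0" for p q
      using Abar_adjacency unfolding adjacency_matrix_def by (metis less_imp_le order_refl)
    show "weighted_matrix_norm (cluster cl i) bw (A i - limit_matrix (A i)) \<le> \<sigma>1_max" for i
      using \<sigma>1_max(1)[of i] by (simp add: \<sigma>1_def V_def)
    show "(1 + (weighted_matrix_norm (cluster cl i) bw (A i - limit_matrix (A i)))\<^sup>2)
        / (1 - (weighted_matrix_norm (cluster cl i) bw (A i - limit_matrix (A i)))\<^sup>2) \<le> \<tau>1" for i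
      using \<tau>1[of i] by (simp add: \<sigma>1_def V_def)
    show "g 0 $ p $ k = partial_deriv k (J p) (y 0 $ p)" if "k \<in> cluster cl (cl p)" for p k
      using g_init that by (simp add: V_def)
    show "g (Suc t) $ p $ k = (\<Sum>l\<in>cluster cl (cl p). A (cl p) $ p $ l * g t $ l $ k)
        + partial_deriv k (J p) (y (Suc t) $ p) - partial_deriv k (J p) (y t $ p)"
      if "k \<in> cluster cl (cl p)" for t p k
      using g_step[of k p t] that by (simp add: V_def)
  qed (fact n_def F_monotone \<mu>_pos NE block bw_min bw_max \<iota> Abar_stochastic norme(1) C_pos(1) \<sigma>2 \<sigma>2_max(1) \<tau>2 \<gamma>_le
        \<gamma>avg_pos heterogeneity y_step x_step | use C_pos norme_equiv \<gamma>_pos in \<open>simp add: less_imp_le\<close>)+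
  have S_eq: "S = trk.size_cube_sum" by (simp add: S_def trk.size_cube_sum_def V_def)
  have n_sq: "n \<le> n\<^sup>2" "n\<^sup>2 \<le> n ^ 3"
    using n_ge by (simp_all add: power2_eq_square power3_eq_cube)
  have E_nonneg: "trk.consensus_error t \<ge> 0" and X_nonneg: "trk.action_error t \<ge> 0" for t
    by (simp_all add: trk.consensus_error_def trk.action_error_def sum_nonneg)

  have X_row: "trk.action_error (Suc t) \<le> (1 - k1 * \<gamma>avg + k2 * \<gamma>M\<^sup>2 + k3 * \<epsilon> * \<gamma>avg) * trk.action_error t
      + (k4 * \<gamma>M\<^sup>2 + k5 * \<gamma>M\<^sup>2 / \<gamma>avg) * trk.tracker_deviation t + (k6 * \<gamma>M\<^sup>2 + k7 * \<gamma>M\<^sup>2 / \<gamma>avg) * trk.consensus_error t" for t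
  proof -
    have "3 * n * \<iota>\<^sup>2 * L\<^sup>2 / (bw_min * C_lo\<^sup>2) \<le> k6"
      unfolding k6_def using n_sq bw_min by (intro divide_right_mono mult_right_mono mult_left_mono) simp_all
    moreover have "2 * bw_max * L\<^sup>2 / (bw_min * C_lo\<^sup>2 * \<mu>) \<le> k7"
      unfolding k7_def using n_ge bw_min bw_max_pos \<mu>_pos by (intro divide_right_mono mult_right_mono) simp_all
    ultimately have E_coeff: "(3 * n * \<iota>\<^sup>2 * L\<^sup>2 / (bw_min * C_lo\<^sup>2) * \<gamma>M\<^sup>2
        + 2 * bw_max * L\<^sup>2 / (bw_min * C_lo\<^sup>2 * \<mu>) * \<gamma>M\<^sup>2 / \<gamma>avg) * trk.consensus_error t
      \<le> (k6 * \<gamma>M\<^sup>2 + k7 * \<gamma>M\<^sup>2 / \<gamma>avg) * trk.consensus_error t"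
      using \<gamma>avg_pos E_nonneg by (intro mult_right_mono add_mono divide_right_mono) simp_all
    have X_coeff: "1 - bw_min * \<mu> * \<gamma>avg + 3 * bw_max * \<iota>\<^sup>2 * L\<^sup>2 / bw_min * trk.size_cube_sum * \<gamma>M\<^sup>2
        + 2 * bw_max * sqrt n * L * \<epsilon> * \<gamma>avg = 1 - k1 * \<gamma>avg + k2 * \<gamma>M\<^sup>2 + k3 * \<epsilon> * \<gamma>avg"
      by (simp add: k1_def k2_def k3_def S_eq)
    show ?thesis using trk.action_error_step[of t] E_coeff unfolding X_coeff k4_def k5_def by linarith
  qed

  have k_pos: "k1 > 0" "k2 > 0" "k3 > 0" "k4 > 0" "k5 > 0" "k6 > 0" "k7 > 0" "k8 > 0" "k9 > 0"
      "k10 > 0" "k11 > 0" "k12 > 0" "k13 > 0" "k14 > 0" "k15 > 0" "k16 > 0"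
    and k_le: "k10 \<le> 1 / 2" "k16 \<le> 1 / 2"
  proof -
    have sq: "\<sigma>1_max\<^sup>2 < 1" "\<sigma>2_max\<^sup>2 < 1"
      using \<sigma>1_max \<sigma>2_max by (simp_all add: power_less_one_iff)
    have n_pos: "n > 0" using n_ge by simp
    note pos = n_pos bw_min(1) bw_max_pos \<mu>_pos L_pos \<iota>_pos S_pos \<tau>_pos C_pos
    have mix: "1 + n * \<tau>2 * C_up\<^sup>2 > 0" using pos by (simp add: add_pos_pos)
    have mix': "3 + \<sigma>2_max\<^sup>2 > 0" by (simp add: add_pos_nonneg)
    show "k1 > 0" "k2 > 0" "k3 > 0" "k4 > 0" "k5 > 0" "k6 > 0" "k7 > 0"
      "k13 > 0" "k14 > 0" "k15 > 0"
      unfolding k1_def k2_def k3_def k4_def k5_def k6_def k7_def k13_def k14_def k15_def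
      using pos by simp_all
    show "k8 > 0" "k9 > 0" "k11 > 0" "k12 > 0"
      unfolding k8_def k9_def k11_def k12_def using pos mix mix' by simp_all
    show "k10 > 0" "k16 > 0" "k10 \<le> 1 / 2" "k16 \<le> 1 / 2"
      unfolding k10_def k16_def using sq by simp_all
  qed

  have D_row: "trk.tracker_deviation (Suc t) \<le> k8 * \<gamma>M\<^sup>2 * trk.action_error t + (1 - k10 + k9 * \<gamma>M\<^sup>2) * trk.tracker_deviation t
      + (k11 + k12 * \<gamma>M\<^sup>2) * trk.consensus_error t" for t
  proof -
    have "(1 + \<sigma>2_max)\<^sup>2 \<le> 3 * (3 + \<sigma>2_max\<^sup>2) / 2"
    proof -
      have "2 * \<sigma>2_max \<le> 7 / 2 + \<sigma>2_max\<^sup>2 / 2"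
        using \<sigma>2_max(3) by (intro add_increasing2) simp_all
      then show ?thesis by (simp add: power2_sum field_simps)
    qed
    then have "\<tau>1 * n * L\<^sup>2 * (1 + \<sigma>2_max)\<^sup>2 / (bw_min * C_lo\<^sup>2)
        \<le> \<tau>1 * n * L\<^sup>2 * (3 * (3 + \<sigma>2_max\<^sup>2) / 2) / (bw_min * C_lo\<^sup>2)"
      using \<tau>_pos n_ge bw_min(1) by (intro divide_right_mono mult_left_mono) simp_all
    also have "\<dots> = k11" by (simp add: k11_def mult_ac)
    finally have "\<tau>1 * n * L\<^sup>2 * (1 + \<sigma>2_max)\<^sup>2 / (bw_min * C_lo\<^sup>2) * trk.consensus_error t \<le> (k11 + k12 * \<gamma>M\<^sup>2) * trk.consensus_error t"
      using k_pos E_nonneg by (intro mult_right_mono) (simp_all add: add_increasing2)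
    moreover have "(1 + \<sigma>1_max\<^sup>2) / 2 * trk.tracker_deviation t \<le> (1 - k10 + k9 * \<gamma>M\<^sup>2) * trk.tracker_deviation t"
      using k_pos trk.tracker_deviation_nonneg by (intro mult_right_mono) (simp_all add: k10_def field_simps)
    moreover have "0 \<le> k8 * \<gamma>M\<^sup>2 * trk.action_error t" using k_pos X_nonneg by simp
    ultimately show ?thesis using trk.tracker_deviation_step[of t] by linarith
  qed

  have E_row: "trk.consensus_error (Suc t) \<le> k13 * \<gamma>M\<^sup>2 * trk.action_error t + k14 * \<gamma>M\<^sup>2 * trk.tracker_deviation t
      + (1 - k16 + k15 * \<gamma>M\<^sup>2) * trk.consensus_error t" for t
  proof -
    have "3 * n\<^sup>2 * \<tau>2 * C_up\<^sup>2 * \<iota>\<^sup>2 * L\<^sup>2 / C_lo\<^sup>2 \<le> k15"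
      unfolding k15_def using n_sq \<tau>_pos by (intro divide_right_mono mult_right_mono mult_left_mono) simp_all
    then have "(1 + \<sigma>2_max\<^sup>2) / 2 + 3 * n\<^sup>2 * \<tau>2 * C_up\<^sup>2 * \<iota>\<^sup>2 * L\<^sup>2 / C_lo\<^sup>2 * \<gamma>M\<^sup>2 \<le> 1 - k16 + k15 * \<gamma>M\<^sup>2"
      by (intro add_mono mult_right_mono) (simp_all add: k16_def field_simps)
    from mult_right_mono[OF this E_nonneg[of t]] show ?thesis
      using trk.consensus_error_step[of t] by (simp add: k13_def k14_def S_eq)
  qed

  define a where "a = k1 - k3 * \<epsilon>"
  have a_pos: "a > 0" using \<epsilon>_bound(2) k_pos by (simp add: a_def less_divide_eq mult.commute)
  define \<nu> where "\<nu> = 2 * n\<^sup>2 * (k5 * k11 + k7 * k10) / a"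
  have steps: "\<gamma>M < 1 / k1" "\<gamma>M < k7 * k10 * a / q1" "\<gamma>M < sqrt (k10 * k11 * a / q2)" "\<gamma>M < sqrt (k10 * k16 * a / q3)"
    using \<gamma>M_bound(2) by (simp_all add: \<gamma>1_def \<gamma>2_def \<gamma>3_def a_def)
  note decrease = small_step_decrease[OF n_ge a_pos \<gamma>avg_pos \<gamma>M_bound(1) \<gamma>M_le k_pos(2,4-16)
      q1_def[folded a_def] q2_def[folded a_def] q3_def[folded a_def] steps(2-4) \<nu>_def]
  have T11: "1 - k1 * \<gamma>avg + k2 * \<gamma>M\<^sup>2 + k3 * \<epsilon> * \<gamma>avg = 1 - a * \<gamma>avg + k2 * \<gamma>M\<^sup>2"
    by (simp add: a_def algebra_simps)
  have "k1 * \<gamma>avg < 1"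
  proof -
    have "k1 * \<gamma>avg \<le> k1 * \<gamma>M" using \<gamma>avg_le k_pos by (intro mult_left_mono) simp_all
    also have "\<dots> < 1" using steps(1) k_pos by (simp add: less_divide_eq mult.commute)
    finally show ?thesis .
  qed
  moreover have "0 \<le> k2 * \<gamma>M\<^sup>2" "0 \<le> k3 * \<epsilon> * \<gamma>avg" "0 \<le> k9 * \<gamma>M\<^sup>2" "0 \<le> k15 * \<gamma>M\<^sup>2"
    using k_pos \<gamma>avg_pos \<epsilon>_bound(1) by simp_all
  ultimately have diag: "1 - k1 * \<gamma>avg + k2 * \<gamma>M\<^sup>2 + k3 * \<epsilon> * \<gamma>avg > 0" "1 - k10 + k9 * \<gamma>M\<^sup>2 > 0"
      "1 - k16 + k15 * \<gamma>M\<^sup>2 > 0"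
    using k_le by linarith+
  have off: "k4 * \<gamma>M\<^sup>2 + k5 * \<gamma>M\<^sup>2 / \<gamma>avg > 0" "k6 * \<gamma>M\<^sup>2 + k7 * \<gamma>M\<^sup>2 / \<gamma>avg > 0" "k8 * \<gamma>M\<^sup>2 > 0"
      "k11 + k12 * \<gamma>M\<^sup>2 > 0" "k13 * \<gamma>M\<^sup>2 > 0" "k14 * \<gamma>M\<^sup>2 > 0"
    using k_pos \<gamma>avg_pos \<gamma>M_bound(1) by (simp_all add: add_pos_pos)
  note T_pos = diag(1) off(1-3) diag(2) off(4-6) diag(3)
  have "spec_radius_real T < 1"
    using decrease k_pos by (intro spec_radius_3_less_1[OF T_def T_pos, of \<nu> "2 * k11" k10]) (simp_all add: T11)
  moreover have "T \<in> carrier_mat 3 3" by (rule entries_3(1)[OF T_def])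
  then have "0 \<le> spec_radius_real T" by (rule spec_radius_real_nonneg) simp
  moreover obtain C where C: "\<And>t. trk.action_error t \<le> C * spec_radius_real T ^ t"
      "\<And>t. trk.tracker_deviation t \<le> C * spec_radius_real T ^ t" "\<And>t. trk.consensus_error t \<le> C * spec_radius_real T ^ t"
    using linear_recursion_bound_3[where X = trk.action_error and Y = trk.tracker_deviation and Z = trk.consensus_error, OF T_def T_pos X_row D_row E_row] by blast
  moreover have "(\<Sum>q\<in>UNIV. (norme ((\<chi> p. x t $ q) - column q (y t)))\<^sup>2)
      \<le> (C_up / C_lo)\<^sup>2 * C * spec_radius_real T ^ t" for t
  proof -
    \<comment> \<open>The given norm and its hull are compared through the Euclidean norm.\<close>
    have "(\<Sum>q\<in>UNIV. (norme ((\<chi> p. x t $ q) - column q (y t)))\<^sup>2) \<le> (C_up / C_lo)\<^sup>2 * trk.consensus_error t"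
      unfolding trk.consensus_error_def sum_distrib_left power_mult_distrib[symmetric]
    proof (intro sum_mono power_mono)
      fix q
      have "norme (trk.estimate_err t q) \<le> C_up * norm (trk.estimate_err t q)" by (rule norme_equiv[THEN conjunct2])
      also have "\<dots> \<le> C_up * (monotone_hull norme (trk.estimate_err t q) / C_lo)"
        using monotone_hull_lower[OF norme(1) _ norme_equiv[THEN conjunct1], of "trk.estimate_err t q"] C_pos
        by (intro mult_left_mono) (simp_all add: le_divide_eq mult.commute)
      finally show "norme ((\<chi> p. x t $ q) - column q (y t)) \<le> C_up / C_lo * monotone_hull norme (trk.estimate_err t q)"
        by (simp add: trk.estimate_err_def)
      show "0 \<le> norme ((\<chi> p. x t $ q) - column q (y t))" using norme(1) unfolding is_norm_def by blast
    qed
    also have "\<dots> \<le> (C_up / C_lo)\<^sup>2 * (C * spec_radius_real T ^ t)"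
      by (intro mult_left_mono C) simp
    finally show ?thesis by (simp add: mult.assoc)
  qed
  ultimately show ?thesis
    unfolding V_def
    by (intro conjI converges_linearly_of_geometric_bound[where C = C]
        converges_linearly_of_geometric_bound[where C = "(C_up / C_lo)\<^sup>2 * C"])
      (simp_all add: trk.action_error_def trk.tracker_deviation_def)
qed

end
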